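(* Assume that the Hamiltonians $H_1,\dots,H_N:\mathbb{R}^{d+1}\to\mathbb{R}$ are continuous, quasi-convex (all sub-level sets $\{H_i\le\lambda\}$ are convex) and coercive ($H_i(p)\to+\infty$ as $|p|\to+\infty$), that $A:\mathbb{R}^d\to\mathbb{R}$ is continuous and quasi-convex with $A\ge A_0$, and that $u_0:J\to\mathbb{R}$ is uniformly continuous. Let $T>0$, and let $u,v:[0,T)\times J\to\mathbb{R}$ be respectively an $A$-flux-limited sub-solution and an $A$-flux-limited super-solution of $$u_t+H_i(Du)=0\ \text{ for } t>0,\ X\in J_i\setminus\Gamma,\qquad u_t+F_A(Du)=0\ \text{ for } t>0,\ X\in\Gamma$$ in $J_T$, such that for some $C_T>0$ and $X_0\in J$, $$u(t,X)\le C_T(1+d(X_0,X)),\qquad v(t,X)\ge -C_T(1+d(X_0,X))\qquad\text{for all }(t,X)\in[0,T)\times J,$$ and such that $u(0,X)\le u_0(X)\le v(0,X)$ for all $X\in J$. Then $u\le v$ in $[0,T)\times J$.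
   Context: Let $N\ge1$ and $d\ge0$ be integers. The multi-dimensional junction is $J=\bigcup_{i=1}^N J_i$, where $J_i=\{X=(x',x_i):x'\in\mathbb{R}^d,\ x_i\ge0\}\simeq\mathbb{R}^d\times[0,+\infty)$ are $N$ copies of a half-space glued along their common boundary: $J_i\cap J_j=\Gamma\simeq\mathbb{R}^d\times\{0\}$ for $i\ne j$. Set $J_i^*=J_i\setminus\Gamma$. The distance on $J$ is given by $d^2(X,Y)=|x'-y'|^2+(x_i+y_j)^2$ if $X\in J_i$, $Y\in J_j$, $i\ne j$, and $d^2(X,Y)=|x'-y'|^2+|x_i-y_i|^2$ if $X,Y\in J_i$. For a function regular on each $J_i$ up to $\Gamma$, $D'u$ is the gradient in $x'$, $\partial_iu$ the derivative in $x_i$ on $J_i$, and $Du(X)=(D'u(X),\partial_iu(X))$ if $X\in J_i^*$, $Du(X)=(D'u,\partial_1u,\dots,\partial_Nu)(x',0)$ if $X=(x',0)\in\Gamma$. Set $A_i(p')=\min_{p_i\in\mathbb{R}}H_i(p',p_i)$, $A_0(p')=\max_iA_i(p')$. Let $\pi_i^0(p')$ be the minimal minimizer of $p_i\mapsto H_i(p',p_i)$, and $H_i^-(p',p_i)=H_i(p',p_i)$ if $p_i\le\pi_i^0(p')$, $H_i^-(p',p_i)=H_i(p',\pi_i^0(p'))$ otherwise. $F_A(p',p_1,\dots,p_N)=\max\big(A(p'),\max_iH_i^-(p',p_i)\big)$. Let $J_T=(0,T)\times J$ and $C^1(J_T)=\{\varphi\in C(J_T):\varphi|_{(0,T)\times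 J_i}\text{ is }C^1\text{ (up to }\Gamma)\text{ for all }i\}$. For locally bounded $u$ on $[0,T)\times J$, $u^*(t,X)=\limsup_{(s,Y)\to(t,X)}u(s,Y)$ and $u_*(t,X)=\liminf_{(s,Y)\to(t,X)}u(s,Y)$. A locally bounded $u:[0,T)\times J\to\mathbb{R}$ is an $A$-flux-limited sub-solution (resp. super-solution) in $J_T$ if for every $\varphi\in C^1(J_T)$ with $u^*\le\varphi$ (resp. $u_*\ge\varphi$) in a neighborhood of $(t_0,X_0)\in J_T$ and equality at $(t_0,X_0)$, $t_0>0$, one has at $(t_0,X_0)$: $\varphi_t+H_i(D\varphi)\le0$ (resp. $\ge0$) if $X_0\in J_i^*$, and $\varphi_t+F_A(D\varphi)\le0$ (resp. $\ge0$) if $X_0\in\Gamma$.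
   Formalization: The initial condition u(0,X) ≤ u_0(X) ≤ v(0,X) is replaced by u^*(0,X) ≤ u_0(X) ≤ v_*(0,X), since with raw values at t=0 the claim fails (H_i=|p|, A=|p'|, u_0=v=0, u=0 at t=0 and u=1 for t>0). *)

theory Defs
  imports "HOL-Analysis.Analysis"
begin

text \<open>
  The space \<open>\<real>\<^sup>d\<close> with \<open>d \<ge> 0\<close> is rendered by a type \<open>'a\<close> of the class below
  (\<open>d = dim (UNIV :: 'a set)\<close>).  The class \<open>euclidean_space\<close> is too small, because it
  excludes \<open>d = 0\<close>; this dimension is provided here by \<open>unit\<close>.
\<close>

class finite_dim_inner = real_inner +
  assumes ex_finite_spanning: "\<exists>B. finite B \<and> (\<forall>x. \<exists>c. x = (\<Sum>b\<in>B. c b *\<^sub>R b))"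

instance euclidean_space \<subseteq> finite_dim_inner
  by standard (metis finite_Basis euclidean_representation)

instantiation unit :: real_inner
begin
definition "plus (_ :: unit) (_ :: unit) = ()"
definition "(0 :: unit) = ()"
definition "scaleR (_ :: real) (_ :: unit) = ()"
definition "inner (_ :: unit) (_ :: unit) = (0 :: real)"
definition "norm (_ :: unit) = (0 :: real)"
definition "dist (_ :: unit) (_ :: unit) = (0 :: real)"
definition "sgn (_ :: unit) = ()"
definition "uniformity = (INF e\<in>{0<..}. principal {(x :: unit, y). dist x y < e})"
definition "open (U :: unit set) \<longleftrightarrow> (\<forall>x\<in>U. \<forall>\<^sub>F (x', y) in uniformity. x' = x \<longrightarrow> y \<in> U)"
instance
  by standard (simp_all add: norm_unit_def inner_unit_def dist_unit_def
      uniformity_unit_def open_unit_def)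
end

instance unit :: finite_dim_inner
  by standard (rule exI[of _ "{}"], simp)

section \<open>The junction\<close>

text \<open>
  A point is \<open>x' \<in> \<real>\<^sup>d\<close> together with normal coordinates \<open>s i \<ge> 0\<close>, \<open>i :: 'n\<close>, at most one of
  which is nonzero; \<open>(x', x\<^sub>i) \<in> J\<^sub>i\<close> has \<open>s i = x\<^sub>i\<close> and \<open>s j = 0\<close> for \<open>j \<noteq> i\<close>, so that the
  points with \<open>x\<^sub>i = 0\<close> are automatically glued.  The number of branches is \<open>N = CARD('n) \<ge> 1\<close>.
\<close>

typedef ('a, 'n) junction =
  "{(x' :: 'a, s :: 'n \<Rightarrow> real). (\<forall>i. 0 \<le> s i) \<and> (\<forall>i j. i \<noteq> j \<longrightarrow> s i = 0 \<or> s j = 0)}"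
  by (rule exI[of _ "(undefined, \<lambda>_. 0)"]) simp

definition tang :: "('a, 'n) junction \<Rightarrow> 'a" where
  "tang X = fst (Rep_junction X)"

definition nrm :: "('a, 'n) junction \<Rightarrow> 'n \<Rightarrow> real" where
  "nrm X = snd (Rep_junction X)"

definition branch :: "'n \<Rightarrow> ('a, 'n) junction set" where
  "branch i = {X. \<forall>j. j \<noteq> i \<longrightarrow> nrm X j = 0}"

definition interface :: "('a, 'n) junction set" where
  "interface = {X. \<forall>j. nrm X j = 0}"

text \<open>The point \<open>(x', r)\<close> of \<open>J\<^sub>i\<close>, meaningful for \<open>r \<ge> 0\<close>.\<close>

definition branch_pt :: "'n \<Rightarrow> 'a \<Rightarrow> real \<Rightarrow> ('a, 'n) junction" where
  "branch_pt i x' r = Abs_junction (x', \<lambda>j. if j = i then r else 0)"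

definition with_tang :: "('a, 'n) junction \<Rightarrow> 'a \<Rightarrow> ('a, 'n) junction" where
  "with_tang X y' = Abs_junction (y', nrm X)"

lemma nrm_nonneg: "0 \<le> nrm X i"
  using Rep_junction[of X] by (auto simp: nrm_def)

lemma nrm_unique: "nrm X i \<noteq> 0 \<Longrightarrow> nrm X j \<noteq> 0 \<Longrightarrow> i = j"
  using Rep_junction[of X] unfolding nrm_def case_prod_beta mem_Collect_eq by blast

lemma junction_eqI: "tang X = tang Y \<Longrightarrow> nrm X = nrm Y \<Longrightarrow> X = Y"
  by (metis Rep_junction_inject nrm_def prod.expand tang_def)

lemma branch_pt_sel [simp]:
  assumes "0 \<le> r"
  shows "tang (branch_pt i x' r) = x'" "nrm (branch_pt i x' r) = (\<lambda>j. if j = i then r else 0)"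
  using assms by (simp_all add: tang_def nrm_def branch_pt_def Abs_junction_inverse)

lemma with_tang_sel [simp]: "tang (with_tang X y') = y'" "nrm (with_tang X y') = nrm X"
proof -
  have "(y', nrm X) \<in> {(x', s). (\<forall>i. 0 \<le> s i) \<and> (\<forall>i j. i \<noteq> j \<longrightarrow> s i = 0 \<or> s j = 0)}"
    using nrm_nonneg[of X] nrm_unique[of X] by auto
  note * = Abs_junction_inverse[OF this]
  show "tang (with_tang X y') = y'" "nrm (with_tang X y') = nrm X"
    unfolding with_tang_def tang_def[of "Abs_junction _"] nrm_def[of "Abs_junction _"]
    by (simp_all add: *)
qed

lemma branch_eq_range:
  fixes i :: 'n
  shows "branch i = {branch_pt i x' r | x' r. 0 \<le> r}"
proof (intro set_eqI iffI)
  fix X :: "('a, 'n) junction" assume "X \<in> branch i"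
  then have "X = branch_pt i (tang X) (nrm X i)"
    by (intro junction_eqI ext) (auto simp: nrm_nonneg branch_def)
  moreover have "0 \<le> nrm X i"
    by (rule nrm_nonneg)
  ultimately show "X \<in> {branch_pt i x' r | x' r. 0 \<le> r}"
    unfolding mem_Collect_eq by (intro exI conjI)
next
  fix X :: "('a, 'n) junction" assume "X \<in> {branch_pt i x' r | x' r. 0 \<le> r}"
  then obtain x' r where "X = branch_pt i x' r" "0 \<le> r"
    unfolding mem_Collect_eq by (elim exE conjE)
  then show "X \<in> branch i"
    by (simp add: branch_def)
qed

lemma Union_branch: "(\<Union>i. branch i) = (UNIV :: ('a, 'n) junction set)"
proof -
  have "\<exists>i. X \<in> branch i" for X :: "('a, 'n) junction"
  proof (cases "\<exists>i. nrm X i \<noteq> 0")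
    case True
    then obtain i where "nrm X i \<noteq> 0" ..
    then have "X \<in> branch i" by (auto simp: branch_def dest: nrm_unique)
    then show ?thesis ..
  next
    case False
    then show ?thesis by (simp add: branch_def)
  qed
  then show ?thesis by blast
qed

lemma branch_Int_branch: "i \<noteq> j \<Longrightarrow> branch i \<inter> branch j = interface"
  by (auto simp: branch_def interface_def)

text \<open>
  The sum below equals \<open>\<bar>x\<^sub>i - y\<^sub>i\<bar>\<close> for two points of the same branch and \<open>x\<^sub>i + y\<^sub>j\<close>
  for points of different branches; see \<open>dist_same_branch\<close> and \<open>dist_other_branch\<close>.
\<close>

instantiation junction :: (metric_space, finite) metric_space
begin
definition dist_junction_def:
  "dist X Y = sqrt ((dist (tang X) (tang Y))\<^sup>2 + (\<Sum>i\<in>UNIV. \<bar>nrm X i - nrm Y i\<bar>)\<^sup>2)"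
definition uniformity_junction_def:
  "uniformity = (INF e\<in>{0<..}. principal {(X :: ('a, 'b) junction, Y). dist X Y < e})"
definition open_junction_def:
  "open (U :: ('a, 'b) junction set) \<longleftrightarrow>
     (\<forall>X\<in>U. \<forall>\<^sub>F (X', Y) in uniformity. X' = X \<longrightarrow> Y \<in> U)"
instance
proof
  fix X Y Z :: "('a, 'b) junction"
  let ?s = "\<lambda>X Y :: ('a, 'b) junction. \<Sum>i\<in>UNIV. \<bar>nrm X i - nrm Y i\<bar>"
  show "dist X Y = 0 \<longleftrightarrow> X = Y"
    by (auto simp: dist_junction_def add_nonneg_eq_0_iff sum_nonneg_eq_0_iff sum_nonneg
        intro!: junction_eqI)
  have s: "?s X Y \<le> ?s X Z + ?s Y Z"
    unfolding sum.distrib[symmetric] by (rule sum_mono) linarith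
  have "dist X Y \<le> sqrt ((dist (tang X) (tang Z) + dist (tang Y) (tang Z))\<^sup>2 + (?s X Z + ?s Y Z)\<^sup>2)"
    unfolding dist_junction_def
    by (intro real_sqrt_le_mono add_mono power_mono s dist_triangle2 sum_nonneg) auto
  also have "\<dots> \<le> dist X Z + dist Y Z"
    unfolding dist_junction_def by (rule real_sqrt_sum_squares_triangle_ineq)
  finally show "dist X Y \<le> dist X Z + dist Y Z" .
qed (simp_all add: uniformity_junction_def open_junction_def)
end

lemma dist_same_branch:
  assumes "0 \<le> r" "0 \<le> s"
  shows "(dist (branch_pt i x' r) (branch_pt i y' s))\<^sup>2 = (dist x' y')\<^sup>2 + \<bar>r - s\<bar>\<^sup>2"
proof -
  have "(\<Sum>k\<in>UNIV. \<bar>(if k = i then r else 0) - (if k = i then s else 0)\<bar>)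
      = (\<Sum>k\<in>UNIV. if k = i then \<bar>r - s\<bar> else 0)"
    by (rule sum.cong) auto
  then show ?thesis using assms by (simp add: dist_junction_def)
qed

lemma dist_other_branch:
  assumes "0 \<le> r" "0 \<le> s" "i \<noteq> j"
  shows "(dist (branch_pt i x' r) (branch_pt j y' s))\<^sup>2 = (dist x' y')\<^sup>2 + (r + s)\<^sup>2"
proof -
  have "(\<Sum>k\<in>UNIV. \<bar>(if k = i then r else 0) - (if k = j then s else 0)\<bar>)
      = (\<Sum>k\<in>UNIV. (if k = i then r else 0) + (if k = j then s else 0))"
    using assms by (intro sum.cong) auto
  then show ?thesis using assms by (simp add: dist_junction_def sum.distrib)
qed

section \<open>Test functions and their derivatives\<close>

definition JT :: "real \<Rightarrow> (real \<times> ('a, 'n) junction) set" where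
  "JT T = {0<..<T} \<times> UNIV"

text \<open>
  Used for the convex sets \<open>(0,T) \<times> \<real>\<^sup>d \<times> [0,\<infinity>)\<close>, which have nonempty interior; the
  derivative within such a set is unique and one-sided in the normal direction at the boundary.
\<close>

definition C1_on :: "'b::real_inner set \<Rightarrow> ('b \<Rightarrow> real) \<Rightarrow> bool" where
  "C1_on S f \<longleftrightarrow> (\<exists>G. continuous_on S G \<and>
     (\<forall>z\<in>S. (f has_derivative (\<lambda>h. G z \<bullet> h)) (at z within S)))"

definition C1_JT :: "real \<Rightarrow> (real \<times> ('a::finite_dim_inner, 'n::finite) junction \<Rightarrow> real) \<Rightarrow> bool"
  where
  "C1_JT T \<phi> \<longleftrightarrow> continuous_on (JT T) \<phi> \<and>
     (\<forall>i. C1_on ({0<..<T} \<times> UNIV \<times> {0..}) (\<lambda>(t, x', r). \<phi> (t, branch_pt i x' r)))"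

definition gradient :: "('a::real_inner \<Rightarrow> real) \<Rightarrow> 'a \<Rightarrow> 'a" where
  "gradient f x = (THE g. (f has_derivative (\<lambda>h. g \<bullet> h)) (at x))"

definition D_time :: "(real \<times> ('a, 'n) junction \<Rightarrow> real) \<Rightarrow> real \<Rightarrow> ('a, 'n) junction \<Rightarrow> real" where
  "D_time \<phi> t X = deriv (\<lambda>s. \<phi> (s, X)) t"

definition D_tang ::
  "(real \<times> ('a::real_inner, 'n) junction \<Rightarrow> real) \<Rightarrow> real \<Rightarrow> ('a, 'n) junction \<Rightarrow> 'a" where
  "D_tang \<phi> t X = gradient (\<lambda>y'. \<phi> (t, with_tang X y')) (tang X)"

text \<open>The derivative \<open>\<partial>\<^sub>i\<close>, for \<open>X \<in> J\<^sub>i\<close>; one-sided if \<open>X \<in> \<Gamma>\<close>.\<close>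

definition D_nrm ::
  "'n \<Rightarrow> (real \<times> ('a, 'n) junction \<Rightarrow> real) \<Rightarrow> real \<Rightarrow> ('a, 'n) junction \<Rightarrow> real" where
  "D_nrm i \<phi> t X =
     vector_derivative (\<lambda>r. \<phi> (t, branch_pt i (tang X) r)) (at (nrm X i) within {0..})"

section \<open>Hamiltonians\<close>

definition quasiconvex :: "('b::real_vector \<Rightarrow> real) \<Rightarrow> bool" where
  "quasiconvex f \<longleftrightarrow> (\<forall>c. convex {p. f p \<le> c})"

definition coercive :: "('b::real_normed_vector \<Rightarrow> real) \<Rightarrow> bool" where
  "coercive f \<longleftrightarrow> filterlim f at_top at_infinity"

text \<open>The infimum and the least minimizer are attained for continuous coercive \<open>H\<close>.\<close>

definition A_min :: "('a \<times> real \<Rightarrow> real) \<Rightarrow> 'a \<Rightarrow> real" where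
  "A_min H p' = (INF q. H (p', q))"

definition A0 :: "('n::finite \<Rightarrow> 'a \<times> real \<Rightarrow> real) \<Rightarrow> 'a \<Rightarrow> real" where
  "A0 H p' = (MAX i. A_min (H i) p')"

definition pi0 :: "('a \<times> real \<Rightarrow> real) \<Rightarrow> 'a \<Rightarrow> real" where
  "pi0 H p' = (LEAST q. is_arg_min (\<lambda>r. H (p', r)) (\<lambda>_. True) q)"

definition H_minus :: "('a \<times> real \<Rightarrow> real) \<Rightarrow> 'a \<Rightarrow> real \<Rightarrow> real" where
  "H_minus H p' q = (if q \<le> pi0 H p' then H (p', q) else H (p', pi0 H p'))"

definition F_lim ::
  "('n::finite \<Rightarrow> 'a \<times> real \<Rightarrow> real) \<Rightarrow> ('a \<Rightarrow> real) \<Rightarrow> 'a \<Rightarrow> ('n \<Rightarrow> real) \<Rightarrow> real" where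
  "F_lim H A p' p = max (A p') (MAX i. H_minus (H i) p' (p i))"

section \<open>Flux-limited solutions\<close>

definition dom0 :: "real \<Rightarrow> (real \<times> ('a, 'n) junction) set" where
  "dom0 T = {0..<T} \<times> UNIV"

definition locally_bounded_on :: "'b::topological_space set \<Rightarrow> ('b \<Rightarrow> real) \<Rightarrow> bool" where
  "locally_bounded_on S u \<longleftrightarrow> (\<forall>z\<in>S. \<exists>U. open U \<and> z \<in> U \<and> bounded (u ` (U \<inter> S)))"

text \<open>
  The semicontinuous envelopes relative to \<open>S\<close>.  As usual for envelopes, the limits do not
  exclude the point itself, so that \<open>lsc_env S u \<le> u \<le> usc_env S u\<close> on \<open>S\<close>.  The values are
  finite for locally bounded \<open>u\<close>.
\<close>

definition usc_env :: "'b::topological_space set \<Rightarrow> ('b \<Rightarrow> real) \<Rightarrow> 'b \<Rightarrow> ereal" where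
  "usc_env S u z = Limsup (inf (nhds z) (principal S)) (\<lambda>w. ereal (u w))"

definition lsc_env :: "'b::topological_space set \<Rightarrow> ('b \<Rightarrow> real) \<Rightarrow> 'b \<Rightarrow> ereal" where
  "lsc_env S u z = Liminf (inf (nhds z) (principal S)) (\<lambda>w. ereal (u w))"

lemma le_usc_env: "z \<in> S \<Longrightarrow> ereal (u z) \<le> usc_env S u z"
  unfolding usc_env_def Limsup_def
  by (rule INF_greatest) (auto simp: eventually_inf_principal dest: eventually_nhds_x_imp_x intro!: SUP_upper)

lemma lsc_env_le: "z \<in> S \<Longrightarrow> lsc_env S u z \<le> ereal (u z)"
  unfolding lsc_env_def Liminf_def
  by (rule SUP_least) (auto simp: eventually_inf_principal dest: eventually_nhds_x_imp_x intro!: INF_lower)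

text \<open>
  The notions below do not constrain \<open>u\<close> at \<open>t = 0\<close>: the function equal to 0 at \<open>t = 0\<close> and
  to 1 for \<open>t > 0\<close> is a subsolution for \<open>H\<^sub>i(p) = \<bar>p\<bar>\<close>, \<open>A(p') = \<bar>p'\<bar>\<close>, and 0 is a
  supersolution.  Initial data must therefore be prescribed for the envelopes
  \<open>u\<^sup>*(0,\<cdot>)\<close> and \<open>v\<^sub>*(0,\<cdot>)\<close> in a comparison principle.
\<close>

definition flux_limited_subsolution ::
  "('n \<Rightarrow> 'a \<times> real \<Rightarrow> real) \<Rightarrow> ('a \<Rightarrow> real) \<Rightarrow> real \<Rightarrow>
   (real \<times> ('a::finite_dim_inner, 'n::finite) junction \<Rightarrow> real) \<Rightarrow> bool" where
  "flux_limited_subsolution H A T u \<longleftrightarrow>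
     locally_bounded_on (dom0 T) u \<and>
     (\<forall>\<phi> t X. C1_JT T \<phi> \<and> (t, X) \<in> JT T \<and>
        (\<forall>\<^sub>F z in nhds (t, X). usc_env (dom0 T) u z \<le> ereal (\<phi> z)) \<and>
        usc_env (dom0 T) u (t, X) = ereal (\<phi> (t, X)) \<longrightarrow>
        (\<forall>i. X \<in> branch i - interface \<longrightarrow>
           D_time \<phi> t X + H i (D_tang \<phi> t X, D_nrm i \<phi> t X) \<le> 0) \<and>
        (X \<in> interface \<longrightarrow>
           D_time \<phi> t X + F_lim H A (D_tang \<phi> t X) (\<lambda>i. D_nrm i \<phi> t X) \<le> 0))"

definition flux_limited_supersolution ::
  "('n \<Rightarrow> 'a \<times> real \<Rightarrow> real) \<Rightarrow> ('a \<Rightarrow> real) \<Rightarrow> real \<Rightarrow>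
   (real \<times> ('a::finite_dim_inner, 'n::finite) junction \<Rightarrow> real) \<Rightarrow> bool" where
  "flux_limited_supersolution H A T v \<longleftrightarrow>
     locally_bounded_on (dom0 T) v \<and>
     (\<forall>\<phi> t X. C1_JT T \<phi> \<and> (t, X) \<in> JT T \<and>
        (\<forall>\<^sub>F z in nhds (t, X). ereal (\<phi> z) \<le> lsc_env (dom0 T) v z) \<and>
        lsc_env (dom0 T) v (t, X) = ereal (\<phi> (t, X)) \<longrightarrow>
        (\<forall>i. X \<in> branch i - interface \<longrightarrow>
           0 \<le> D_time \<phi> t X + H i (D_tang \<phi> t X, D_nrm i \<phi> t X)) \<and>
        (X \<in> interface \<longrightarrow>
           0 \<le> D_time \<phi> t X + F_lim H A (D_tang \<phi> t X) (\<lambda>i. D_nrm i \<phi> t X)))"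

end

theory Submission
  imports Defs
begin

text \<open>
  Time and the tangential variable are doubled, but the normal coordinate is shared, so that a
  maximum point of the penalized difference of the two envelopes lies on one branch. All test
  functions are separable in time, tangential and normal variables, the penalization at infinity
  is Lipschitz with a small constant, and the slopes on both sides then agree up to a small error.

  At an interior maximum the normal variable is doubled locally and coercivity bounds the slopes.
  At a maximum on the interface let \<open>q\<^sub>i\<close> be the smallest normal slope on \<open>J\<^sub>i\<close> that is almost
  admissible for the subsolution. Since no slope below \<open>q\<^sub>i\<close> is admissible, the subsolution leaves
  the interface along \<open>J\<^sub>i\<close> with slope at least \<open>q\<^sub>i\<close>, with a tangential displacement \<open>O(x\<^sub>i)\<close>. By
  maximality the supersolution does so too, the cross term of the quadratic penalization being
  \<open>o(x\<^sub>i)\<close>. Hence it may be tested with slopes slightly smaller than \<open>q\<^sub>i\<close>, where the flux-limited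
  Hamiltonian is too small.
\<close>

section \<open>Semicontinuity and compactness\<close>

text \<open>If the normal coordinate were doubled too, the two points could lie on different
  branches, where unrelated Hamiltonians with unrelated slopes would have to be compared. Sharing it
  removes this case, but a joint maximum on the interface then carries no information on normal
  slopes. What allows their recovery is \<open>A\<close> \<ge> \<open>A0\<close>: a maximum along
  the interface forces a + A(p') \<le> 0 for the time slope a and the tangential slope p' of the
  subsolution, so min H_i(p', .) \<le> -a on every branch, and an almost admissible slope q_i
  exists. Strictness comes from \<eta>/(T - t) and \<eta>/(T - s). They keep maxima away from the
  final time and separate the time slopes of the two functions by at least 8\<kappa>, while each
  error costs only a fixed multiple of \<kappa>. A modulus of continuity is needed only on {H_i
  \<le> \<Lambda>} and {A \<le> \<Lambda>}, because the doubling in time keeps the time slope above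
  -2aT up to a bounded error. As \<Lambda> does not involve the penalization at infinity, the
  coefficient \<alpha> can be chosen after all the others.\<close>

definition usc_on :: "'b::topological_space set \<Rightarrow> ('b \<Rightarrow> real) \<Rightarrow> bool" where
  "usc_on S f \<longleftrightarrow> (\<forall>z\<in>S. \<forall>c>f z. \<forall>\<^sub>F w in at z within S. f w < c)"

lemma usc_on_subset: "usc_on S f \<Longrightarrow> R \<subseteq> S \<Longrightarrow> usc_on R f"
  unfolding usc_on_def by (meson at_le filter_leD subsetD)

lemma usc_on_continuous: "continuous_on S f \<Longrightarrow> usc_on S f"
  unfolding usc_on_def continuous_on_def by (auto dest: order_tendstoD)

lemma usc_on_add:
  assumes "usc_on S f" "usc_on S g"
  shows "usc_on S (\<lambda>z. f z + g z)"
  unfolding usc_on_def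
proof (intro ballI allI impI)
  fix z c assume z: "z \<in> S" and c: "f z + g z < c"
  define e where "e = (c - (f z + g z)) / 2"
  have "f z < f z + e" "g z < g z + e" using c by (auto simp: e_def)
  then have "\<forall>\<^sub>F w in at z within S. f w < f z + e" "\<forall>\<^sub>F w in at z within S. g w < g z + e"
    using assms z unfolding usc_on_def by blast+
  then show "\<forall>\<^sub>F w in at z within S. f w + g w < c"
    by eventually_elim (auto simp: e_def field_simps)
qed

lemma usc_on_diff:
  assumes "usc_on S f" "continuous_on S g"
  shows "usc_on S (\<lambda>z. f z - g z)"
  using usc_on_add[OF assms(1) usc_on_continuous[OF continuous_on_minus[OF assms(2)]]] by simp

lemma usc_on_compose:
  assumes f: "usc_on R f" and h: "continuous_on S h" "h ` S \<subseteq> R"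
  shows "usc_on S (\<lambda>z. f (h z))"
  unfolding usc_on_def
proof (intro ballI allI impI)
  fix z c assume z: "z \<in> S" and c: "f (h z) < c"
  have "\<forall>\<^sub>F w in at (h z) within R. f w < c"
    using f h z c unfolding usc_on_def by blast
  then have "\<forall>\<^sub>F w in nhds (h z). w \<in> R \<longrightarrow> f w < c"
    using c by (auto simp: eventually_at_filter elim!: eventually_mono)
  moreover have "(h \<longlongrightarrow> h z) (at z within S)"
    using h z by (auto simp: continuous_on_def)
  ultimately have "\<forall>\<^sub>F w in at z within S. h w \<in> R \<longrightarrow> f (h w) < c"
    by (auto simp: filterlim_def le_filter_def eventually_filtermap)
  moreover have "\<forall>\<^sub>F w in at z within S. w \<in> S"
    by (simp add: eventually_at_filter)
  ultimately show "\<forall>\<^sub>F w in at z within S. f (h w) < c"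
    by eventually_elim (use h in auto)
qed

lemma usc_on_openD:
  assumes "usc_on S f" "z \<in> S" "f z < c"
  obtains U where "open U" "z \<in> U" "\<And>w. w \<in> U \<inter> S \<Longrightarrow> f w < c"
proof -
  have "\<forall>\<^sub>F w in at z within S. f w < c"
    using assms unfolding usc_on_def by blast
  then obtain U where "open U" "z \<in> U" "\<forall>w\<in>U. w \<noteq> z \<longrightarrow> w \<in> S \<longrightarrow> f w < c"
    by (auto simp: eventually_at_filter eventually_nhds)
  then show thesis using assms(3) by (intro that) auto
qed

text \<open>If every point z were beaten by some b z, semicontinuity would extend this to a
  neighbourhood of z. In a finite subcover the best of the finitely many competitors
  \<open>b d\<close> is itself beaten by another one.\<close>

lemma usc_on_attains_max:
  assumes K: "compact K" "K \<noteq> {}" and f: "usc_on K f"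
  shows "\<exists>z\<in>K. \<forall>w\<in>K. f w \<le> f z"
proof (rule ccontr)
  assume "\<not> ?thesis"
  then obtain b where b: "\<And>z. z \<in> K \<Longrightarrow> b z \<in> K" "\<And>z. z \<in> K \<Longrightarrow> f z < f (b z)"
    by (metis not_le)
  have "\<exists>U. open U \<and> z \<in> U \<and> (\<forall>w\<in>U \<inter> K. f w < f (b z))" if "z \<in> K" for z
    using usc_on_openD[OF f that b(2)[OF that]] by metis
  then obtain U where U: "\<And>z. z \<in> K \<Longrightarrow> open (U z) \<and> z \<in> U z \<and> (\<forall>w\<in>U z \<inter> K. f w < f (b z))"
    by metis
  then have "K \<subseteq> (\<Union>z\<in>K. U z)" by blast
  then obtain D where D: "D \<subseteq> K" "finite D" "K \<subseteq> (\<Union>z\<in>D. U z)"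
    using compactE_image[OF K(1), of K U] U by metis
  then have "D \<noteq> {}" using K(2) by auto
  then obtain d where d: "d \<in> D" "\<And>z. z \<in> D \<Longrightarrow> f (b z) \<le> f (b d)"
    using D(2) Max_in[of "(\<lambda>z. f (b z)) ` D"] Max_ge[of "(\<lambda>z. f (b z)) ` D"] by fastforce
  have "b d \<in> K" using b(1) d(1) D(1) by blast
  then obtain z where "z \<in> D" "b d \<in> U z" using D(3) by blast
  then have "f (b d) < f (b z)" using U D(1) \<open>b d \<in> K\<close> by blast
  then show False using d(2)[OF \<open>z \<in> D\<close>] by simp
qed

text \<open>Replaces the constraint N = 0 by a penalty. Near a zero of N the bound f < c persists
  and the penalty only helps; elsewhere N is locally bounded below and a large factor wins over max
  f. The result holds for every M \<ge> L, so that the factor may be enlarged for other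
  purposes.\<close>

lemma usc_on_penalization:
  assumes K: "compact K" and f: "usc_on K f" and N: "continuous_on K N"
    and pos: "\<And>z. z \<in> K \<Longrightarrow> 0 \<le> N z" and zero: "\<And>z. z \<in> K \<Longrightarrow> N z = 0 \<Longrightarrow> f z < c"
  shows "\<exists>L>0. \<forall>z\<in>K. \<forall>M\<ge>L. f z - M * N z < c"
proof (cases "K = {}")
  case True
  then show ?thesis by (intro exI[of _ 1]) auto
next
  case False
  then obtain z0 where z0: "\<And>w. w \<in> K \<Longrightarrow> f w \<le> f z0"
    using usc_on_attains_max[OF K _ f] by blast
  have "\<exists>U L. open U \<and> z \<in> U \<and> 0 < L \<and> (\<forall>w\<in>U \<inter> K. \<forall>M\<ge>L. f w - M * N w < c)" if z: "z \<in> K" for z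
  proof (cases "N z = 0")
    case True
    then have "f z < c" using zero z by blast
    then obtain U where "open U" "z \<in> U" "\<And>w. w \<in> U \<inter> K \<Longrightarrow> f w < c"
      using usc_on_openD[OF f z] by metis
    moreover have "f w - M * N w < c" if "w \<in> U \<inter> K" "1 \<le> M" for w M
    proof -
      have "0 \<le> M * N w" using pos[of w] that by simp
      then show ?thesis using calculation(3)[OF that(1)] by linarith
    qed
    ultimately show ?thesis by (intro exI[of _ U] exI[of _ 1]) auto
  next
    case False
    then have Nz: "0 < N z" using pos[OF z] by simp
    define L where "L = 2 * (\<bar>f z0 - c\<bar> + 1) / N z"
    have "usc_on K (\<lambda>w. - N w)"
      by (intro usc_on_continuous continuous_intros N)
    moreover have "- N z < - (N z / 2)" using Nz by simp
    ultimately obtain U where U: "open U" "z \<in> U" "\<And>w. w \<in> U \<inter> K \<Longrightarrow> - N w < - (N z / 2)"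
      using usc_on_openD z by metis
    have L: "0 < L" unfolding L_def
      using Nz by (intro divide_pos_pos mult_pos_pos add_nonneg_pos) auto
    have "f w - M * N w < c" if "w \<in> U \<inter> K" "L \<le> M" for w M
    proof -
      have "L * (N z / 2) \<le> M * N w"
        using that U(3)[OF that(1)] L Nz by (intro mult_mono) auto
      moreover have "L * (N z / 2) = \<bar>f z0 - c\<bar> + 1" using Nz by (simp add: L_def)
      moreover have "f w \<le> f z0" using z0 that by blast
      ultimately show ?thesis by linarith
    qed
    then show ?thesis using U L by blast
  qed
  then obtain U L where UL: "\<And>z. z \<in> K \<Longrightarrow> open (U z) \<and> z \<in> U z \<and> 0 < L z \<and>
      (\<forall>w\<in>U z \<inter> K. \<forall>M\<ge>L z. f w - M * N w < c)"
    by metis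
  then have "K \<subseteq> (\<Union>z\<in>K. U z)" by blast
  then obtain D where D: "D \<subseteq> K" "finite D" "K \<subseteq> (\<Union>z\<in>D. U z)"
    using compactE_image[OF K(1), of K U] UL by metis
  have "D \<noteq> {}" using False D by auto
  show ?thesis
  proof (intro exI[of _ "Max (L ` D)"] conjI ballI allI impI)
    obtain d where "d \<in> D" using \<open>D \<noteq> {}\<close> by blast
    then have "0 < L d" "L d \<le> Max (L ` D)" using D UL by auto
    then show "0 < Max (L ` D)" by linarith
    fix z M assume "z \<in> K" "Max (L ` D) \<le> M"
    then obtain d where "d \<in> D" "z \<in> U d" using D(3) by blast
    moreover have "L d \<le> M"
      using \<open>Max (L ` D) \<le> M\<close> D(2) calculation(1) by (meson Max_ge finite_imageI image_eqI order_trans)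
    ultimately show "f z - M * N z < c" using UL D(1) \<open>z \<in> K\<close> by blast
  qed
qed

section \<open>Compact balls in finite-dimensional inner product spaces\<close>

lemma compact_closed_subset: "compact K \<Longrightarrow> closed S \<Longrightarrow> S \<subseteq> K \<Longrightarrow> compact S"
  using compact_Int_closed[of K S] by (simp add: Int_absorb1)

text \<open>Gram-Schmidt and normalization turn the finite spanning set into an orthonormal one; the
  coefficients of x are then x \<bullet> e, bounded by norm x, and the ball is a closed subset of a
  compact box of coefficients.\<close>

lemma compact_cball_finite_dim:
  "compact {x :: 'a::finite_dim_inner. norm x \<le> R}"
proof -
  obtain B :: "'a set" where B: "finite B" "\<And>x. \<exists>c. x = (\<Sum>b\<in>B. c b *\<^sub>R b)"
    using ex_finite_spanning by metis
  obtain D :: "'a set" where D: "finite D" "span D = span B" "pairwise orthogonal D"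
    using basis_orthogonal[OF B(1)] by metis
  have span: "x \<in> span D" for x
  proof -
    obtain c where "x = (\<Sum>b\<in>B. c b *\<^sub>R b)" using B(2) by metis
    moreover have "(\<Sum>b\<in>B. c b *\<^sub>R b) \<in> span B" by (intro span_sum span_scale span_base)
    ultimately show ?thesis using D(2) by simp
  qed
  define E where "E = sgn ` (D - {0})"
  have E: "finite E" "\<And>e. e \<in> E \<Longrightarrow> norm e = 1"
    using D by (auto simp: E_def norm_sgn split: if_splits)
  have orth: "pairwise orthogonal E"
    unfolding pairwise_def
  proof (intro ballI impI)
    fix a b assume "a \<in> E" "b \<in> E" "a \<noteq> b"
    then obtain a' b' where "a' \<in> D" "b' \<in> D" "a = a' /\<^sub>R norm a'" "b = b' /\<^sub>R norm b'" "a' \<noteq> b'"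
      by (auto simp: E_def sgn_div_norm)
    then show "orthogonal a b" using D(3) by (auto simp: pairwise_def orthogonal_def)
  qed
  have "span D \<subseteq> span E"
  proof (rule span_minimal)
    show "D \<subseteq> span E"
    proof
      fix d assume d: "d \<in> D"
      show "d \<in> span E"
      proof (cases "d = 0")
        case False
        then have "sgn d \<in> span E" using d by (auto simp: E_def intro!: span_base)
        then have "norm d *\<^sub>R sgn d \<in> span E" by (rule span_scale)
        then show ?thesis using False by (simp add: sgn_div_norm)
      qed (simp add: span_zero)
    qed
  qed (simp add: subspace_span)
  then have spE: "x \<in> span E" for x using span by blast
  have rep: "x = (\<Sum>e\<in>E. (x \<bullet> e) *\<^sub>R e)" for x
  proof -
    obtain c where c: "x = (\<Sum>e\<in>E. c e *\<^sub>R e)"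
      using spE[of x] E(1) by (auto simp: span_finite)
    have "x \<bullet> e = c e" if e: "e \<in> E" for e
    proof -
      have "x \<bullet> e = (\<Sum>b\<in>E. c b * (b \<bullet> e))" by (subst c) (simp add: inner_sum_left)
      also have "\<dots> = (\<Sum>b\<in>E. if b = e then c e else 0)"
      proof (rule sum.cong[OF refl])
        fix b assume "b \<in> E"
        then show "c b * (b \<bullet> e) = (if b = e then c e else 0)"
          using orth E(2)[OF e] e by (auto simp: pairwise_def orthogonal_def dot_square_norm)
      qed
      finally show ?thesis using E(1) e by simp
    qed
    then show ?thesis by (subst c) simp
  qed
  \<comment> \<open>Each further basis vector makes the box a continuous image of an interval times
    the previous box.\<close>
  have comp: "compact {\<Sum>e\<in>G. c e *\<^sub>R e |c. \<forall>e\<in>G. \<bar>c e\<bar> \<le> R}" if "finite G" for G :: "'a set"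
    using that
  proof induction
    case empty
    then show ?case by simp
  next
    case (insert g G)
    let ?S = "{\<Sum>e\<in>G. c e *\<^sub>R e |c. \<forall>e\<in>G. \<bar>c e\<bar> \<le> R}"
    have "{\<Sum>e\<in>insert g G. c e *\<^sub>R e |c. \<forall>e\<in>insert g G. \<bar>c e\<bar> \<le> R}
        = (\<lambda>(r, s). r *\<^sub>R g + s) ` ({-R..R} \<times> ?S)" (is "?L = ?Rr")
    proof
      show "?L \<subseteq> ?Rr" using insert.hyps by (force simp: abs_le_iff)
      show "?Rr \<subseteq> ?L"
      proof
        fix x assume "x \<in> ?Rr"
        then obtain r c where rc: "\<bar>r\<bar> \<le> R" "\<forall>e\<in>G. \<bar>c e\<bar> \<le> R" "x = r *\<^sub>R g + (\<Sum>e\<in>G. c e *\<^sub>R e)"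
          by (fastforce simp: abs_le_iff)
        have "(\<Sum>e\<in>G. c e *\<^sub>R e) = (\<Sum>e\<in>G. (c(g := r)) e *\<^sub>R e)"
          using insert.hyps by (intro sum.cong) auto
        then have "x = (\<Sum>e\<in>insert g G. (c(g := r)) e *\<^sub>R e)" using insert.hyps rc by simp
        then show "x \<in> ?L" using rc by (intro CollectI exI[of _ "c(g := r)"]) auto
      qed
    qed
    moreover have "compact \<dots>"
      by (intro compact_continuous_image compact_Times insert.IH compact_Icc)
         (auto simp: case_prod_beta intro!: continuous_intros)
    ultimately show ?case by simp
  qed
  have "{x :: 'a. norm x \<le> R} \<subseteq> {\<Sum>e\<in>E. c e *\<^sub>R e |c. \<forall>e\<in>E. \<bar>c e\<bar> \<le> R}"
  proof
    fix x :: 'a assume x: "x \<in> {x. norm x \<le> R}"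
    have "\<bar>x \<bullet> e\<bar> \<le> R" if "e \<in> E" for e
      using Cauchy_Schwarz_ineq2[of x e] E(2)[OF that] x by simp
    then show "x \<in> {\<Sum>e\<in>E. c e *\<^sub>R e |c. \<forall>e\<in>E. \<bar>c e\<bar> \<le> R}"
      using rep[of x] by (intro CollectI exI[of _ "\<lambda>e. x \<bullet> e"]) auto
  qed
  moreover have "closed {x :: 'a. norm x \<le> R}"
    by (intro closed_Collect_le continuous_intros)
  ultimately show ?thesis
    using compact_closed_subset[OF comp[OF E(1)]] by blast
qed

section \<open>Coordinates, charts and compact boxes of the junction\<close>

lemma dist_tang_le: "dist (tang X) (tang Y) \<le> dist X Y"
  for X Y :: "('a::metric_space, 'n::finite) junction"
  unfolding dist_junction_def by (rule real_le_rsqrt) simp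

lemma sum_nrm_le_dist: "(\<Sum>i\<in>UNIV. \<bar>nrm X i - nrm Y i\<bar>) \<le> dist X Y"
  for X Y :: "('a::metric_space, 'n::finite) junction"
  unfolding dist_junction_def by (rule real_le_rsqrt) simp

lemma dist_nrm_le: "\<bar>nrm X i - nrm Y i\<bar> \<le> dist X Y"
  for X Y :: "('a::metric_space, 'n::finite) junction"
  using sum_nrm_le_dist[of X Y] member_le_sum[of i UNIV "\<lambda>i. \<bar>nrm X i - nrm Y i\<bar>"] by simp

lemma dist_junction_le:
  "dist X Y \<le> dist (tang X) (tang Y) + (\<Sum>i\<in>UNIV. \<bar>nrm X i - nrm Y i\<bar>)"
  for X Y :: "('a::metric_space, 'n::finite) junction"
  unfolding dist_junction_def by (rule sqrt_sum_squares_le_sum) (auto intro: sum_nonneg)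

lemma continuous_on_tang [continuous_intros]:
  fixes h :: "'b::topological_space \<Rightarrow> ('a::metric_space, 'n::finite) junction"
  assumes "continuous_on S h"
  shows "continuous_on S (\<lambda>z. tang (h z))"
proof -
  have "continuous_on UNIV (tang :: ('a, 'n) junction \<Rightarrow> 'a)"
    unfolding continuous_on_iff using dist_tang_le le_less_trans by blast
  from continuous_on_compose2[OF this assms] show ?thesis by simp
qed

lemma continuous_on_nrm [continuous_intros]:
  fixes h :: "'b::topological_space \<Rightarrow> ('a::metric_space, 'n::finite) junction"
  assumes "continuous_on S h"
  shows "continuous_on S (\<lambda>z. nrm (h z) i)"
proof -
  have "continuous_on UNIV (\<lambda>X :: ('a, 'n) junction. nrm X i)"
    unfolding continuous_on_iff dist_real_def using dist_nrm_le le_less_trans by blast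
  from continuous_on_compose2[OF this assms] show ?thesis by simp
qed

text \<open>The chart of a branch is an isometry of the half-space, by
  \<open>dist_same_branch\<close>.\<close>

lemma continuous_on_branch_pt:
  "continuous_on (UNIV \<times> {0..}) (\<lambda>z. branch_pt i (fst z) (snd z) :: ('a::metric_space, 'n::finite) junction)"
proof -
  have "dist (branch_pt i (fst w) (snd w) :: ('a, 'n) junction) (branch_pt i (fst z) (snd z)) = dist w z"
    if "w \<in> UNIV \<times> {0..}" "z \<in> UNIV \<times> {0..}" for w z :: "'a \<times> real"
  proof -
    have "(dist (branch_pt i (fst w) (snd w) :: ('a, 'n) junction) (branch_pt i (fst z) (snd z)))\<^sup>2
        = (dist w z)\<^sup>2"
      using that by (subst dist_same_branch) (auto simp: dist_prod_def dist_real_def)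
    then show ?thesis by (simp add: power2_eq_iff_nonneg)
  qed
  then show ?thesis unfolding continuous_on_iff by (auto simp del: split_paired_All intro!: exI)
qed

text \<open>The box is a closed subset of the union of finitely many chart images of compact sets,
  one for each branch.\<close>

lemma compact_junction_box:
  "compact {X :: ('a::finite_dim_inner, 'n::finite) junction. norm (tang X) \<le> R \<and> (\<forall>i. nrm X i \<le> R)}"
proof -
  have "{X :: ('a, 'n) junction. norm (tang X) \<le> R \<and> (\<forall>i. nrm X i \<le> R)}
    \<subseteq> (\<Union>i. (\<lambda>z. branch_pt i (fst z) (snd z)) ` ({x. norm x \<le> R} \<times> {0..R}))"
  proof
    fix X :: "('a, 'n) junction" assume X: "X \<in> {X. norm (tang X) \<le> R \<and> (\<forall>i. nrm X i \<le> R)}"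
    have "X \<in> (\<Union>i. branch i)" by (simp add: Union_branch)
    then obtain i where "X \<in> branch i" by auto
    then obtain x' r where Xe: "X = branch_pt i x' r" "0 \<le> r"
      unfolding branch_eq_range by auto
    then have "norm x' \<le> R" "r \<le> R" using X by (auto dest: spec[of _ i])
    then show "X \<in> (\<Union>i. (\<lambda>z. branch_pt i (fst z) (snd z)) ` ({x. norm x \<le> R} \<times> {0..R}))"
      using Xe by (intro UN_I[of i] image_eqI[of _ _ "(x', r)"]) auto
  qed
  moreover have "compact (\<Union>i. (\<lambda>z. branch_pt i (fst z) (snd z) :: ('a, 'n) junction) ` ({x. norm x \<le> R} \<times> {0..R}))"
    by (intro compact_UN finite compact_continuous_image compact_Times compact_cball_finite_dim
        compact_Icc continuous_on_subset[OF continuous_on_branch_pt]) auto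
  moreover have "closed {X :: ('a, 'n) junction. norm (tang X) \<le> R \<and> (\<forall>i. nrm X i \<le> R)}"
    by (intro closed_Collect_conj closed_Collect_all closed_Collect_le continuous_intros)
  ultimately show ?thesis using compact_closed_subset by blast
qed

lemma compact_junction_subset:
  fixes S :: "('a::finite_dim_inner, 'n::finite) junction set"
  assumes "closed S" "\<And>X. X \<in> S \<Longrightarrow> norm (tang X) \<le> R" "\<And>X i. X \<in> S \<Longrightarrow> nrm X i \<le> R"
  shows "compact S"
proof -
  have "S \<subseteq> {X. norm (tang X) \<le> R \<and> (\<forall>i. nrm X i \<le> R)}" using assms by blast
  then show ?thesis
    using compact_closed_subset[OF compact_junction_box assms(1)] by blast
qed

section \<open>Separable test functions\<close>

definition sep :: "(real \<Rightarrow> real) \<Rightarrow> ('a \<Rightarrow> real) \<Rightarrow> ('n::finite \<Rightarrow> real \<Rightarrow> real) \<Rightarrow>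
    real \<times> ('a, 'n) junction \<Rightarrow> real" where
  "sep \<tau> f g z = \<tau> (fst z) + f (tang (snd z)) + (\<Sum>i\<in>UNIV. g i (nrm (snd z) i))"

text \<open>Differentiability in time is asked only on (0,T), since the functions used blow up at T.
  The normal parts are differentiable on the whole line, so the one-sided derivative at the
  interface is a restriction.\<close>

definition sep_C1 :: "real \<Rightarrow> (real \<Rightarrow> real) \<Rightarrow> (real \<Rightarrow> real) \<Rightarrow> ('a::real_inner \<Rightarrow> real) \<Rightarrow> ('a \<Rightarrow> 'a) \<Rightarrow>
    ('n \<Rightarrow> real \<Rightarrow> real) \<Rightarrow> ('n \<Rightarrow> real \<Rightarrow> real) \<Rightarrow> bool" where
  "sep_C1 T \<tau> \<tau>' f f' g g' \<longleftrightarrow>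
     (\<forall>t\<in>{0<..<T}. (\<tau> has_real_derivative \<tau>' t) (at t)) \<and> continuous_on {0<..<T} \<tau>' \<and>
     (\<forall>x. (f has_derivative (\<lambda>h. f' x \<bullet> h)) (at x)) \<and> continuous_on UNIV f' \<and>
     (\<forall>i r. (g i has_real_derivative g' i r) (at r)) \<and> (\<forall>i. continuous_on UNIV (g' i))"

lemma sep_C1_continuous_on:
  assumes "sep_C1 T \<tau> \<tau>' f f' g g'"
  shows "continuous_on {0<..<T} \<tau>" "continuous_on UNIV f" "continuous_on UNIV (g i)"
proof -
  have "\<forall>t\<in>{0<..<T}. isCont \<tau> t" using assms unfolding sep_C1_def by (blast intro: DERIV_isCont)
  then show "continuous_on {0<..<T} \<tau>" by (simp add: continuous_at_imp_continuous_on)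
  have "\<forall>x. isCont f x" using assms unfolding sep_C1_def by (blast intro: has_derivative_continuous)
  then show "continuous_on UNIV f" by (simp add: continuous_at_imp_continuous_on)
  have "\<forall>r. isCont (g i) r" using assms unfolding sep_C1_def by (blast intro: DERIV_isCont)
  then show "continuous_on UNIV (g i)" by (simp add: continuous_at_imp_continuous_on)
qed

lemma sum_nrm_branch_pt:
  fixes g :: "'n::finite \<Rightarrow> real \<Rightarrow> real"
  assumes "0 \<le> r"
  shows "(\<Sum>j\<in>UNIV. g j (nrm (branch_pt i x' r :: ('a, 'n) junction) j)) = g i r + (\<Sum>j\<in>UNIV - {i}. g j 0)"
  using assms by (subst sum.remove[of _ i]) (auto intro!: sum.cong)

lemma continuous_on_sep:
  fixes g :: "'n::finite \<Rightarrow> real \<Rightarrow> real" and f :: "'a::finite_dim_inner \<Rightarrow> real"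
  assumes "continuous_on S \<tau>" "continuous_on UNIV f" "\<And>i. continuous_on UNIV (g i)"
  shows "continuous_on (S \<times> UNIV) (sep \<tau> f g)"
proof -
  have "continuous_on (S \<times> UNIV) (\<lambda>z :: real \<times> ('a, 'n) junction. \<tau> (fst z))"
    by (rule continuous_on_compose2[OF assms(1)]) (auto intro: continuous_intros)
  moreover have "continuous_on (S \<times> UNIV) (\<lambda>z :: real \<times> ('a, 'n) junction. f (tang (snd z)))"
    by (rule continuous_on_compose2[OF assms(2)]) (auto intro!: continuous_intros)
  moreover have "continuous_on (S \<times> UNIV) (\<lambda>z :: real \<times> ('a, 'n) junction. g i (nrm (snd z) i))" for i
    by (rule continuous_on_compose2[OF assms(3)]) (auto intro!: continuous_intros)
  ultimately show ?thesis
    unfolding sep_def by (intro continuous_intros) auto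
qed

lemma C1_JT_sep:
  fixes g :: "'n::finite \<Rightarrow> real \<Rightarrow> real" and f :: "'a::finite_dim_inner \<Rightarrow> real"
  assumes C1: "sep_C1 T \<tau> \<tau>' f f' g g'"
  shows "C1_JT T (sep \<tau> f g)"
  unfolding C1_JT_def
proof (intro conjI allI)
  show "continuous_on (JT T) (sep \<tau> f g)"
    unfolding JT_def using sep_C1_continuous_on[OF C1] by (intro continuous_on_sep)
  fix i :: 'n
  let ?S = "{0<..<T} \<times> (UNIV :: 'a set) \<times> {0::real..}"
  show "C1_on ?S (\<lambda>(t, x', r). sep \<tau> f g (t, branch_pt i x' r))"
    unfolding C1_on_def
  proof (intro exI[of _ "\<lambda>z. (\<tau>' (fst z), f' (fst (snd z)), g' i (snd (snd z)))"] conjI ballI)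
    have "continuous_on ?S (\<lambda>z. \<tau>' (fst z))"
      by (rule continuous_on_compose2[of "{0<..<T}" \<tau>'])
         (use C1 in \<open>auto simp: sep_C1_def intro!: continuous_intros\<close>)
    moreover have "continuous_on ?S (\<lambda>z. f' (fst (snd z)))"
      by (rule continuous_on_compose2[of UNIV f'])
         (use C1 in \<open>auto simp: sep_C1_def intro!: continuous_intros\<close>)
    moreover have "continuous_on ?S (\<lambda>z. g' i (snd (snd z)))"
      by (rule continuous_on_compose2[of UNIV "g' i"])
         (use C1 in \<open>auto simp: sep_C1_def intro!: continuous_intros\<close>)
    ultimately show "continuous_on ?S (\<lambda>z. (\<tau>' (fst z), f' (fst (snd z)), g' i (snd (snd z))))"
      by (intro continuous_intros)
    fix z assume z: "z \<in> ?S"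
    \<comment> \<open>On J_i the other branches contribute only this constant, because their normal
      coordinates vanish there.\<close>
    let ?c = "\<Sum>j\<in>UNIV - {i}. g j 0"
    have 1: "((\<lambda>z. \<tau> (fst z)) has_derivative (\<lambda>h. \<tau>' (fst z) * fst h)) (at z within ?S)"
      by (rule has_derivative_compose[of fst fst z ?S \<tau> "\<lambda>h. \<tau>' (fst z) * h"])
         (use C1 z in \<open>auto simp: sep_C1_def has_field_derivative_def
            intro!: derivative_eq_intros\<close>)
    have 2: "((\<lambda>z. f (fst (snd z))) has_derivative (\<lambda>h. f' (fst (snd z)) \<bullet> fst (snd h))) (at z within ?S)"
      by (rule has_derivative_compose[of "\<lambda>z. fst (snd z)" "\<lambda>z. fst (snd z)" z ?S f "\<lambda>h. f' (fst (snd z)) \<bullet> h"])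
         (use C1 z in \<open>auto simp: sep_C1_def intro!: derivative_eq_intros\<close>)
    have 3: "((\<lambda>z. g i (snd (snd z))) has_derivative (\<lambda>h. g' i (snd (snd z)) * snd (snd h))) (at z within ?S)"
      by (rule has_derivative_compose[of "\<lambda>z. snd (snd z)" "\<lambda>z. snd (snd z)" z ?S "g i" "\<lambda>h. g' i (snd (snd z)) * h"])
         (use C1 z in \<open>auto simp: sep_C1_def has_field_derivative_def
            intro!: derivative_eq_intros\<close>)
    have "((\<lambda>z. \<tau> (fst z) + f (fst (snd z)) + g i (snd (snd z)) + ?c) has_derivative
        (\<lambda>h. \<tau>' (fst z) * fst h + f' (fst (snd z)) \<bullet> fst (snd h) + g' i (snd (snd z)) * snd (snd h) + 0))
        (at z within ?S)"
      using has_derivative_add[OF has_derivative_add[OF has_derivative_add[OF 1 2] 3]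
          has_derivative_const[of ?c]] .
    moreover have "(\<lambda>h. \<tau>' (fst z) * fst h + f' (fst (snd z)) \<bullet> fst (snd h) + g' i (snd (snd z)) * snd (snd h) + 0)
        = (\<lambda>h. (\<tau>' (fst z), f' (fst (snd z)), g' i (snd (snd z))) \<bullet> h)"
      by (auto simp: fun_eq_iff inner_prod_def)
    ultimately have "((\<lambda>z. \<tau> (fst z) + f (fst (snd z)) + g i (snd (snd z)) + ?c) has_derivative
        (\<lambda>h. (\<tau>' (fst z), f' (fst (snd z)), g' i (snd (snd z))) \<bullet> h)) (at z within ?S)"
      by (simp only:)
    then show "((\<lambda>(t, x', r). sep \<tau> f g (t, branch_pt i x' r)) has_derivative
        (\<lambda>h. (\<tau>' (fst z), f' (fst (snd z)), g' i (snd (snd z))) \<bullet> h)) (at z within ?S)"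
      by (rule has_derivative_transform[OF z, rotated])
         (auto simp: sep_def sum_nrm_branch_pt simp del: branch_pt_sel(2))
  qed
qed

lemma D_time_sep:
  assumes "sep_C1 T \<tau> \<tau>' f f' g g'" "0 < t" "t < T"
  shows "D_time (sep \<tau> f g) t X = \<tau>' t"
  unfolding D_time_def sep_def
  by (rule DERIV_imp_deriv) (use assms in \<open>auto simp: sep_C1_def intro!: derivative_eq_intros\<close>)

lemma gradient_eqI:
  assumes "(f has_derivative (\<lambda>h. g \<bullet> h)) (at x)"
  shows "gradient f x = g"
  unfolding gradient_def
proof (rule the_equality, rule assms)
  fix k assume "(f has_derivative (\<lambda>h. k \<bullet> h)) (at x)"
  then have "(\<lambda>h. k \<bullet> h) = (\<lambda>h. g \<bullet> h)" using assms by (rule has_derivative_unique)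
  then show "k = g" by (metis vector_eq_rdot)
qed

lemma D_tang_sep:
  assumes "sep_C1 T \<tau> \<tau>' f f' g g'"
  shows "D_tang (sep \<tau> f g) t X = f' (tang X)"
  unfolding D_tang_def sep_def
proof (rule gradient_eqI)
  have "(f has_derivative (\<lambda>h. f' (tang X) \<bullet> h)) (at (tang X))"
    using assms by (simp add: sep_C1_def)
  then show "((\<lambda>y'. \<tau> (fst (t, with_tang X y')) + f (tang (snd (t, with_tang X y'))) +
      (\<Sum>i\<in>UNIV. g i (nrm (snd (t, with_tang X y')) i))) has_derivative (\<lambda>h. f' (tang X) \<bullet> h)) (at (tang X))"
    by (auto intro!: derivative_eq_intros)
qed

lemma D_nrm_sep:
  assumes "sep_C1 T \<tau> \<tau>' f f' g g'"
  shows "D_nrm i (sep \<tau> f g) t X = g' i (nrm X i)"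
  unfolding D_nrm_def
proof (rule vector_derivative_within)
  \<comment> \<open>Points to the right are always available in the half-line, also at 0, so the
    derivative within it is unique.\<close>
  have "at_right (nrm X i) \<le> at (nrm X i) within {0..}"
    using nrm_nonneg[of X i] by (intro at_le) auto
  then show "at (nrm X i) within {0..} \<noteq> bot"
    by (metis bot.extremum_uniqueI trivial_limit_at_right_real)
  let ?c = "\<tau> t + f (tang X) + (\<Sum>j\<in>UNIV - {i}. g j 0)"
  have "(g i has_real_derivative g' i (nrm X i)) (at (nrm X i) within {0..})"
    using assms by (simp add: sep_C1_def has_field_derivative_at_within)
  from DERIV_add[OF this DERIV_const[of ?c]]
  have "((\<lambda>r. g i r + ?c) has_vector_derivative g' i (nrm X i)) (at (nrm X i) within {0..})"
    by (simp add: has_real_derivative_iff_has_vector_derivative)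
  then show "((\<lambda>r. sep \<tau> f g (t, branch_pt i (tang X) r)) has_vector_derivative g' i (nrm X i))
      (at (nrm X i) within {0..})"
    by (rule has_vector_derivative_transform[rotated 2])
       (auto simp: sep_def sum_nrm_branch_pt nrm_nonneg simp del: branch_pt_sel(2))
qed

section \<open>Semicontinuous envelopes\<close>

text \<open>Real-valued upper envelope, faithful on S for locally bounded u. The lower envelope of v
  is treated as minus the upper envelope of -v, so that one theory of maxima serves both
  functions.\<close>

definition usc_real :: "'b::topological_space set \<Rightarrow> ('b \<Rightarrow> real) \<Rightarrow> 'b \<Rightarrow> real" where
  "usc_real S u z = real_of_ereal (usc_env S u z)"

lemma usc_env_le:
  assumes "open U" "z \<in> U" "\<And>w. w \<in> U \<inter> S \<Longrightarrow> u w \<le> c"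
  shows "usc_env S u z \<le> ereal c"
  unfolding usc_env_def
proof (rule Limsup_bounded)
  have "\<forall>\<^sub>F w in nhds z. w \<in> U" using assms by (simp add: eventually_nhds_in_open)
  then show "\<forall>\<^sub>F w in inf (nhds z) (principal S). ereal (u w) \<le> ereal c"
    by (auto simp: eventually_inf_principal assms elim!: eventually_mono)
qed

lemma usc_env_real:
  assumes "locally_bounded_on S u" "z \<in> S"
  shows "usc_env S u z = ereal (usc_real S u z)"
proof -
  obtain U where U: "open U" "z \<in> U" "bounded (u ` (U \<inter> S))"
    using assms unfolding locally_bounded_on_def by blast
  then obtain B where "\<And>w. w \<in> U \<inter> S \<Longrightarrow> \<bar>u w\<bar> \<le> B"
    unfolding bounded_iff by auto
  then have "u w \<le> B" if "w \<in> U \<inter> S" for w using that by fastforce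
  then have "usc_env S u z \<le> ereal B" using usc_env_le[OF U(1,2)] by blast
  moreover have "ereal (u z) \<le> usc_env S u z" using le_usc_env[OF assms(2)] .
  ultimately show ?thesis unfolding usc_real_def by (cases "usc_env S u z") auto
qed

lemma le_usc_real: "locally_bounded_on S u \<Longrightarrow> z \<in> S \<Longrightarrow> u z \<le> usc_real S u z"
  by (metis le_usc_env usc_env_real ereal_less_eq(3))

text \<open>Growth bounds survive the passage to the envelope because the bounding function is
  continuous.\<close>

lemma usc_real_le:
  assumes u: "locally_bounded_on S u" and z: "z \<in> S" and b: "continuous_on S b" "\<And>w. w \<in> S \<Longrightarrow> u w \<le> b w"
  shows "usc_real S u z \<le> b z"
proof (rule field_le_epsilon)
  fix e :: real assume "0 < e"
  then have "b z < b z + e" by simp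
  then obtain U where U: "open U" "z \<in> U" "\<And>w. w \<in> U \<inter> S \<Longrightarrow> b w < b z + e"
    using usc_on_openD[OF usc_on_continuous[OF b(1)] z] by metis
  have "u w \<le> b z + e" if "w \<in> U \<inter> S" for w
    using U(3)[OF that] b(2)[of w] that by auto
  then show "usc_real S u z \<le> b z + e"
    using usc_env_le[OF U(1,2), of S u "b z + e"] unfolding usc_env_real[OF u z] ereal_less_eq by blast
qed

lemma usc_on_usc_real:
  assumes u: "locally_bounded_on S u"
  shows "usc_on S (usc_real S u)"
  unfolding usc_on_def
proof (intro ballI allI impI)
  fix z c assume z: "z \<in> S" and c: "usc_real S u z < c"
  \<comment> \<open>The strict bound u < c' near z gives only \<le> c' for the envelope; the
    intermediate level restores strictness.\<close>
  then obtain c' where c': "usc_real S u z < c'" "c' < c" using dense by blast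
  then have "usc_env S u z < ereal c'" by (simp add: usc_env_real[OF u z])
  then have "\<forall>\<^sub>F w in inf (nhds z) (principal S). ereal (u w) < ereal c'"
    unfolding usc_env_def by (rule Limsup_lessD)
  then obtain U where U: "open U" "z \<in> U" "\<And>w. w \<in> U \<Longrightarrow> w \<in> S \<Longrightarrow> u w < c'"
    by (auto simp: eventually_inf_principal eventually_nhds)
  have "usc_real S u w < c" if "w \<in> U" "w \<in> S" for w
    using usc_env_le[OF U(1) that(1), of S u c'] U(3) c'(2) by (auto simp: usc_env_real[OF u that(2)] less_imp_le)
  moreover have "\<forall>\<^sub>F w in nhds z. w \<in> U" using U by (simp add: eventually_nhds_in_open)
  ultimately show "\<forall>\<^sub>F w in at z within S. usc_real S u w < c"
    by (auto simp: eventually_at_filter elim!: eventually_mono)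
qed

lemma lsc_env_eq: "lsc_env S v z = - usc_env S (\<lambda>w. - v w) z"
proof -
  have "(\<lambda>w. ereal (- v w)) = (\<lambda>w. - ereal (v w))" by simp
  then show ?thesis
    unfolding lsc_env_def usc_env_def by (simp only: ereal_Limsup_uminus ereal_uminus_uminus)
qed

lemma locally_bounded_on_uminus: "locally_bounded_on S v \<Longrightarrow> locally_bounded_on S (\<lambda>w. - v w)"
  unfolding locally_bounded_on_def bounded_iff by simp

section \<open>Viscosity inequalities for separable test functions\<close>

definition loc_max :: "('b::topological_space \<Rightarrow> real) \<Rightarrow> 'b \<Rightarrow> bool" where
  "loc_max F z \<longleftrightarrow> (\<forall>\<^sub>F w in nhds z. F w \<le> F z)"

text \<open>Touching is relaxed to a local maximum of the difference, and derivatives are given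
  explicitly. On the interface every normal coordinate is 0, hence the slopes \<open>g' i 0\<close>
  on all branches at once.\<close>

definition sub_sep ::
  "('n \<Rightarrow> 'a \<times> real \<Rightarrow> real) \<Rightarrow> ('a \<Rightarrow> real) \<Rightarrow> real \<Rightarrow>
   (real \<times> ('a::finite_dim_inner, 'n::finite) junction \<Rightarrow> real) \<Rightarrow> bool" where
  "sub_sep H A T U \<longleftrightarrow> (\<forall>\<tau> \<tau>' f f' g g' t X. sep_C1 T \<tau> \<tau>' f f' g g' \<and> 0 < t \<and> t < T \<and>
      loc_max (\<lambda>z. U z - sep \<tau> f g z) (t, X) \<longrightarrow>
      (\<forall>i. X \<in> branch i - interface \<longrightarrow> \<tau>' t + H i (f' (tang X), g' i (nrm X i)) \<le> 0) \<and>
      (X \<in> interface \<longrightarrow> \<tau>' t + F_lim H A (f' (tang X)) (\<lambda>i. g' i 0) \<le> 0))"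

definition super_sep ::
  "('n \<Rightarrow> 'a \<times> real \<Rightarrow> real) \<Rightarrow> ('a \<Rightarrow> real) \<Rightarrow> real \<Rightarrow>
   (real \<times> ('a::finite_dim_inner, 'n::finite) junction \<Rightarrow> real) \<Rightarrow> bool" where
  "super_sep H A T V \<longleftrightarrow> (\<forall>\<tau> \<tau>' f f' g g' t X. sep_C1 T \<tau> \<tau>' f f' g g' \<and> 0 < t \<and> t < T \<and>
      loc_max (\<lambda>z. sep \<tau> f g z - V z) (t, X) \<longrightarrow>
      (\<forall>i. X \<in> branch i - interface \<longrightarrow> 0 \<le> \<tau>' t + H i (f' (tang X), g' i (nrm X i))) \<and>
      (X \<in> interface \<longrightarrow> 0 \<le> \<tau>' t + F_lim H A (f' (tang X)) (\<lambda>i. g' i 0)))"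

lemma open_JT: "open (JT T :: (real \<times> ('a::metric_space, 'n::finite) junction) set)"
  unfolding JT_def by (intro open_Times open_greaterThanLessThan open_UNIV)

lemma eventually_nhds_dom0:
  fixes X :: "('a::metric_space, 'n::finite) junction"
  assumes "0 < t" "t < T"
  shows "\<forall>\<^sub>F z in nhds (t, X). z \<in> dom0 T"
proof -
  have "\<forall>\<^sub>F z in nhds (t, X). z \<in> JT T"
    by (intro eventually_nhds_in_open open_JT) (use assms in \<open>auto simp: JT_def\<close>)
  then show ?thesis by eventually_elim (auto simp: JT_def dom0_def)
qed

lemma sep_C1_shift:
  "sep_C1 T \<tau> \<tau>' f f' g g' \<Longrightarrow> sep_C1 T (\<lambda>t. \<tau> t + c) \<tau>' f f' g g'"
  unfolding sep_C1_def by (auto intro!: derivative_eq_intros)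

lemma interface_nrm: "X \<in> interface \<longleftrightarrow> (\<forall>i. nrm X i = 0)"
  by (simp add: interface_def)

text \<open>Adding the maximal value of the difference to the time part makes the test function
  touch the envelope and changes no derivative. Points near (t,X) stay in the domain, where the
  extended real envelope is finite.\<close>

lemma sub_sep_usc_real:
  assumes u: "flux_limited_subsolution H A T u"
  shows "sub_sep H A T (usc_real (dom0 T) u)"
  unfolding sub_sep_def
proof (intro allI impI, elim conjE)
  let ?U = "usc_real (dom0 T) u"
  fix \<tau> \<tau>' f f' g g' t X
  assume C1: "sep_C1 T \<tau> \<tau>' f f' g g'" and t: "0 < t" "t < T"
    and max: "loc_max (\<lambda>z. ?U z - sep \<tau> f g z) (t, X)"
  define c where "c = ?U (t, X) - sep \<tau> f g (t, X)"
  let ?\<phi> = "sep (\<lambda>t. \<tau> t + c) f g"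
  have lb: "locally_bounded_on (dom0 T) u" using u unfolding flux_limited_subsolution_def by (rule conjunct1)
  have tX: "(t, X) \<in> dom0 T" "(t, X) \<in> JT T" using t by (auto simp: dom0_def JT_def)
  have C1': "sep_C1 T (\<lambda>t. \<tau> t + c) \<tau>' f f' g g'" by (rule sep_C1_shift[OF C1])
  have "\<forall>\<^sub>F z in nhds (t, X). usc_env (dom0 T) u z \<le> ereal (?\<phi> z)"
    using max eventually_nhds_dom0[OF t] unfolding loc_max_def
    by eventually_elim (auto simp: usc_env_real[OF lb] c_def sep_def)
  moreover have "usc_env (dom0 T) u (t, X) = ereal (?\<phi> (t, X))"
    using usc_env_real[OF lb tX(1)] by (simp add: c_def sep_def)
  ultimately have "(\<forall>i. X \<in> branch i - interface \<longrightarrow>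
           D_time ?\<phi> t X + H i (D_tang ?\<phi> t X, D_nrm i ?\<phi> t X) \<le> 0) \<and>
        (X \<in> interface \<longrightarrow>
           D_time ?\<phi> t X + F_lim H A (D_tang ?\<phi> t X) (\<lambda>i. D_nrm i ?\<phi> t X) \<le> 0)"
    using u C1_JT_sep[OF C1'] tX(2) unfolding flux_limited_subsolution_def by blast
  then show "(\<forall>i. X \<in> branch i - interface \<longrightarrow> \<tau>' t + H i (f' (tang X), g' i (nrm X i)) \<le> 0) \<and>
      (X \<in> interface \<longrightarrow> \<tau>' t + F_lim H A (f' (tang X)) (\<lambda>i. g' i 0) \<le> 0)"
    by (simp add: D_time_sep[OF C1' t] D_tang_sep[OF C1'] D_nrm_sep[OF C1'] interface_nrm)
qed

lemma super_sep_usc_real: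
  assumes v: "flux_limited_supersolution H A T v"
  shows "super_sep H A T (\<lambda>z. - usc_real (dom0 T) (\<lambda>w. - v w) z)"
  unfolding super_sep_def
proof (intro allI impI, elim conjE)
  let ?V = "\<lambda>z. - usc_real (dom0 T) (\<lambda>w. - v w) z"
  fix \<tau> \<tau>' f f' g g' t X
  assume C1: "sep_C1 T \<tau> \<tau>' f f' g g'" and t: "0 < t" "t < T"
    and max: "loc_max (\<lambda>z. sep \<tau> f g z - ?V z) (t, X)"
  define c where "c = ?V (t, X) - sep \<tau> f g (t, X)"
  let ?\<phi> = "sep (\<lambda>t. \<tau> t + c) f g"
  have "locally_bounded_on (dom0 T) v" using v unfolding flux_limited_supersolution_def by (rule conjunct1)
  then have lb: "locally_bounded_on (dom0 T) (\<lambda>w. - v w)" by (rule locally_bounded_on_uminus)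
  have lsc: "lsc_env (dom0 T) v z = ereal (?V z)" if "z \<in> dom0 T" for z
    unfolding lsc_env_eq usc_env_real[OF lb that] by simp
  have tX: "(t, X) \<in> dom0 T" "(t, X) \<in> JT T" using t by (auto simp: dom0_def JT_def)
  have C1': "sep_C1 T (\<lambda>t. \<tau> t + c) \<tau>' f f' g g'" by (rule sep_C1_shift[OF C1])
  have "\<forall>\<^sub>F z in nhds (t, X). ereal (?\<phi> z) \<le> lsc_env (dom0 T) v z"
    using max eventually_nhds_dom0[OF t] unfolding loc_max_def
    by eventually_elim (auto simp: lsc c_def sep_def)
  moreover have "lsc_env (dom0 T) v (t, X) = ereal (?\<phi> (t, X))"
    using lsc[OF tX(1)] by (simp add: c_def sep_def)
  ultimately have "(\<forall>i. X \<in> branch i - interface \<longrightarrow>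
           0 \<le> D_time ?\<phi> t X + H i (D_tang ?\<phi> t X, D_nrm i ?\<phi> t X)) \<and>
        (X \<in> interface \<longrightarrow>
           0 \<le> D_time ?\<phi> t X + F_lim H A (D_tang ?\<phi> t X) (\<lambda>i. D_nrm i ?\<phi> t X))"
    using v C1_JT_sep[OF C1'] tX(2) unfolding flux_limited_supersolution_def by blast
  then show "(\<forall>i. X \<in> branch i - interface \<longrightarrow> 0 \<le> \<tau>' t + H i (f' (tang X), g' i (nrm X i))) \<and>
      (X \<in> interface \<longrightarrow> 0 \<le> \<tau>' t + F_lim H A (f' (tang X)) (\<lambda>i. g' i 0))"
    by (simp add: D_time_sep[OF C1' t] D_tang_sep[OF C1'] D_nrm_sep[OF C1'] interface_nrm)
qed

section \<open>Bounds for the Hamiltonians\<close>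

lemma coercive_bound:
  fixes H :: "'b::real_normed_vector \<Rightarrow> real"
  assumes "coercive H"
  obtains B where "0 < B" "\<And>p. B \<le> norm p \<Longrightarrow> c < H p"
proof -
  have "\<forall>\<^sub>F p in at_infinity. c < H p"
    using assms unfolding coercive_def filterlim_at_top_dense by blast
  then obtain b where "\<And>p. b \<le> norm p \<Longrightarrow> c < H p"
    unfolding eventually_at_infinity by blast
  then show thesis by (intro that[of "max b 1"]) auto
qed

lemma abs_snd_le: "\<bar>q\<bar> \<le> norm (p', q :: real)"
  using norm_snd_le[of q p'] by simp

lemma continuous_on_slice:
  assumes "continuous_on UNIV (H :: 'a::topological_space \<times> real \<Rightarrow> real)"
  shows "continuous_on S (\<lambda>q. H (p', q))"
  by (rule continuous_on_compose2[OF assms]) (auto intro!: continuous_intros)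

text \<open>Coercivity confines the minimizers to a bounded interval; they form a nonempty compact
  set, so its least element exists and the \<open>LEAST\<close> in \<open>pi0\<close> is
  attained.\<close>

lemma pi0_le:
  assumes H: "continuous_on UNIV (H :: 'a::real_normed_vector \<times> real \<Rightarrow> real)" "coercive H"
  shows "H (p', pi0 H p') \<le> H (p', r)"
proof -
  obtain B where B: "0 < B" "\<And>p. B \<le> norm p \<Longrightarrow> H (p', 0) < H p"
    using coercive_bound[OF H(2)] by metis
  have out: "\<bar>q\<bar> < B" if "H (p', q) \<le> H (p', 0)" for q
  proof (rule ccontr)
    assume "\<not> \<bar>q\<bar> < B"
    then have "B \<le> norm (p', q)" using abs_snd_le[of q p'] by linarith
    then show False using B(2) that by fastforce
  qed
  obtain m where m: "m \<in> {-B..B}" "\<And>q. q \<in> {-B..B} \<Longrightarrow> H (p', m) \<le> H (p', q)"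
    using continuous_attains_inf[of "{-B..B}" "\<lambda>q. H (p', q)"] B(1) continuous_on_slice[OF H(1)] by auto
  have m_min: "H (p', m) \<le> H (p', q)" for q
  proof (cases "q \<in> {-B..B}")
    case False
    then have "H (p', 0) < H (p', q)" using out[of q] by force
    moreover have "H (p', m) \<le> H (p', 0)" using m(2)[of 0] B(1) by simp
    ultimately show ?thesis by simp
  qed (rule m(2))
  let ?M = "{q \<in> {-B..B}. H (p', q) \<le> H (p', m)}"
  have "closed {q \<in> {-B..B}. H (p', q) \<le> H (p', m)}"
    by (intro continuous_on_closed_Collect_le continuous_on_slice[OF H(1)] continuous_intros closed_atLeastAtMost)
  then have "compact ?M" by (rule compact_closed_subset[OF compact_Icc]) auto
  moreover have "?M \<noteq> {}" using m by auto
  ultimately obtain l where l: "l \<in> ?M" "\<And>q. q \<in> ?M \<Longrightarrow> l \<le> q"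
    using compact_attains_inf[of ?M] by blast
  have "pi0 H p' = l"
    unfolding pi0_def
  proof (rule Least_equality)
    show "is_arg_min (\<lambda>r. H (p', r)) (\<lambda>_. True) l"
      using l(1) m_min unfolding is_arg_min_def by (auto simp: not_less intro: order_trans)
    fix q assume "is_arg_min (\<lambda>r. H (p', r)) (\<lambda>_. True) q"
    then have q: "H (p', q) \<le> H (p', r)" for r unfolding is_arg_min_def by (auto simp: not_less)
    then have "q \<in> ?M" using out[OF q[of 0]] by auto
    then show "l \<le> q" by (rule l(2))
  qed
  then show ?thesis using l(1) m_min[of r] by auto
qed

lemma H_minus_le:
  assumes "continuous_on UNIV (H :: 'a::real_normed_vector \<times> real \<Rightarrow> real)" "coercive H"
  shows "H_minus H p' q \<le> H (p', q)"
  unfolding H_minus_def using pi0_le[OF assms] by auto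

text \<open>Carries a lower bound valid for H at every slope up to q over to the truncated
  Hamiltonian at q.\<close>

lemma H_minus_eq: "\<exists>r\<le>q. H_minus H p' q = H (p', r)"
  unfolding H_minus_def by (auto intro: exI[of _ q] exI[of _ "pi0 H p'"])

lemma A_le_F_lim: "A p' \<le> F_lim H A p' p"
  by (simp add: F_lim_def)

lemma H_minus_le_F_lim: "H_minus (H i) p' (p i) \<le> F_lim H A p' p"
  unfolding F_lim_def by (intro max.coboundedI2 Max_ge) auto

lemma F_lim_less:
  fixes H :: "'n::finite \<Rightarrow> 'a::real_normed_vector \<times> real \<Rightarrow> real"
  assumes "\<And>i. continuous_on UNIV (H i)" "\<And>i. coercive (H i)" "A p' < c" "\<And>i. H i (p', p i) < c"
  shows "F_lim H A p' p < c"
proof -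
  have "H_minus (H i) p' (p i) < c" for i
    using H_minus_le[OF assms(1,2)[of i], of p' "p i"] assms(4)[of i] by (rule le_less_trans)
  then show ?thesis unfolding F_lim_def using assms(3) by (subst max_less_iff_conj) auto
qed

section \<open>Time derivatives at points of touching\<close>

text \<open>K depends on L alone, not on the test function or the point of contact. The form with
  maxima applies to a subsolution and to minus a supersolution alike.\<close>

definition time_bound :: "real \<Rightarrow> (real \<times> ('a::real_inner, 'n::finite) junction \<Rightarrow> real) \<Rightarrow> bool" where
  "time_bound T W \<longleftrightarrow> (\<forall>L. \<exists>K. \<forall>\<tau> \<tau>' f f' g g' t X. sep_C1 T \<tau> \<tau>' f f' g g' \<and> 0 < t \<and> t < T \<and>
     loc_max (\<lambda>z. W z - sep \<tau> f g z) (t, X) \<and> norm (f' (tang X)) \<le> L \<and> (\<forall>i. \<bar>g' i (nrm X i)\<bar> \<le> L)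
     \<longrightarrow> \<tau>' t \<le> K)"

lemma compact_slopes: "compact {p :: 'a::finite_dim_inner \<times> real. norm (fst p) \<le> L \<and> \<bar>snd p\<bar> \<le> L}"
proof -
  have "{p :: 'a \<times> real. norm (fst p) \<le> L \<and> \<bar>snd p\<bar> \<le> L} = {p. norm p \<le> L} \<times> {-L..L}"
    by (auto simp: abs_le_iff)
  then show ?thesis by (simp add: compact_Times compact_cball_finite_dim)
qed

lemma slope_bound:
  fixes H :: "'n::finite \<Rightarrow> 'a::finite_dim_inner \<times> real \<Rightarrow> real" and A :: "'a \<Rightarrow> real"
  assumes "\<And>i. continuous_on UNIV (H i)" "continuous_on UNIV A"
  shows "\<exists>K. (\<forall>i p q. norm p \<le> L \<longrightarrow> \<bar>q\<bar> \<le> L \<longrightarrow> \<bar>H i (p, q)\<bar> < K) \<and>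
    (\<forall>p. norm p \<le> L \<longrightarrow> \<bar>A p\<bar> < K)"
proof -
  let ?S = "{p :: 'a \<times> real. norm (fst p) \<le> L \<and> \<bar>snd p\<bar> \<le> L}"
  have "continuous_on ?S (H i)" for i using assms(1) continuous_on_subset by blast
  then have "bounded (H i ` ?S)" for i
    by (intro compact_imp_bounded compact_continuous_image compact_slopes)
  then have "bounded (\<Union>i. H i ` ?S)" by (intro bounded_UN) auto
  then obtain K1 where K1: "\<forall>x\<in>(\<Union>i. H i ` ?S). norm x \<le> K1"
    unfolding bounded_iff ..
  have "continuous_on {p. norm p \<le> L} A" using assms(2) continuous_on_subset by blast
  then have "bounded (A ` {p. norm p \<le> L})"
    by (intro compact_imp_bounded compact_continuous_image compact_cball_finite_dim)
  then obtain K2 where K2: "\<forall>x\<in>A ` {p. norm p \<le> L}. norm x \<le> K2"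
    unfolding bounded_iff ..
  show ?thesis
  proof (intro exI[of _ "max K1 K2 + 1"] conjI allI impI)
    fix i and p :: 'a and q :: real assume "norm p \<le> L" "\<bar>q\<bar> \<le> L"
    then have "H i (p, q) \<in> (\<Union>i. H i ` ?S)" by (intro UN_I[of i] imageI) auto
    from K1[rule_format, OF this] show "\<bar>H i (p, q)\<bar> < max K1 K2 + 1" by auto
  next
    fix p :: 'a assume "norm p \<le> L"
    then have "A p \<in> A ` {p. norm p \<le> L}" by auto
    from K2[rule_format, OF this] show "\<bar>A p\<bar> < max K1 K2 + 1" by auto
  qed
qed

lemma branch_cases:
  obtains "X \<in> interface" | i where "X \<in> branch i - interface"
proof -
  have "X \<in> (\<Union>i. branch i)" by (simp add: Union_branch)
  then show thesis using that by auto
qed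

text \<open>On the interface the lower bound of the flux-limited Hamiltonian by A suffices; on the
  open branches a bound for H_i on bounded sets does.\<close>

lemma time_bound_sub:
  fixes H :: "'n::finite \<Rightarrow> 'a::finite_dim_inner \<times> real \<Rightarrow> real"
  assumes H: "\<And>i. continuous_on UNIV (H i)" and A: "continuous_on UNIV A" and U: "sub_sep H A T U"
  shows "time_bound T U"
  unfolding time_bound_def
proof
  fix L
  obtain K where K: "\<forall>i p q. norm p \<le> L \<longrightarrow> \<bar>q\<bar> \<le> L \<longrightarrow> \<bar>H i (p, q)\<bar> < K"
    "\<forall>p. norm p \<le> L \<longrightarrow> \<bar>A p\<bar> < K"
    using slope_bound[where H = H and L = L, OF H A] by (elim exE conjE)
  show "\<exists>K. \<forall>\<tau> \<tau>' f f' g g' t X. sep_C1 T \<tau> \<tau>' f f' g g' \<and> 0 < t \<and> t < T \<and>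
     loc_max (\<lambda>z. U z - sep \<tau> f g z) (t, X) \<and> norm (f' (tang X)) \<le> L \<and> (\<forall>i. \<bar>g' i (nrm X i)\<bar> \<le> L)
     \<longrightarrow> \<tau>' t \<le> K"
  proof (intro exI[of _ K] allI impI, elim conjE)
    fix \<tau> \<tau>' f f' g g' t X
    assume "sep_C1 T \<tau> \<tau>' f f' g g'" "0 < t" "t < T" "loc_max (\<lambda>z. U z - sep \<tau> f g z) (t, X)"
      and L: "norm (f' (tang X)) \<le> L" "\<forall>i. \<bar>g' i (nrm X i)\<bar> \<le> L"
    then have *: "(\<forall>i. X \<in> branch i - interface \<longrightarrow> \<tau>' t + H i (f' (tang X), g' i (nrm X i)) \<le> 0) \<and>
      (X \<in> interface \<longrightarrow> \<tau>' t + F_lim H A (f' (tang X)) (\<lambda>i. g' i 0) \<le> 0)"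
      using U unfolding sub_sep_def by blast
    show "\<tau>' t \<le> K"
    proof (cases rule: branch_cases[of X])
      case 1
      then have "\<tau>' t + A (f' (tang X)) \<le> 0"
        using * A_le_F_lim[of A "f' (tang X)" H "\<lambda>i. g' i 0"] by linarith
      then show ?thesis using K(2)[rule_format, OF L(1)] by linarith
    next
      case (2 i)
      then have "\<tau>' t + H i (f' (tang X), g' i (nrm X i)) \<le> 0" using * by blast
      then show ?thesis using K(1)[rule_format, OF L(1) L(2)[rule_format, of i], of i] by linarith
    qed
  qed
qed

lemma sep_C1_uminus:
  "sep_C1 T \<tau> \<tau>' f f' g g' \<Longrightarrow>
   sep_C1 T (\<lambda>t. - \<tau> t) (\<lambda>t. - \<tau>' t) (\<lambda>x. - f x) (\<lambda>x. - f' x) (\<lambda>i r. - g i r) (\<lambda>i r. - g' i r)"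
  unfolding sep_C1_def inner_minus_left
  by (intro conjI ballI allI DERIV_minus has_derivative_minus continuous_on_minus) blast+

lemma sep_uminus: "sep (\<lambda>t. - \<tau> t) (\<lambda>x. - f x) (\<lambda>i r. - g i r) z = - sep \<tau> f g z"
  by (simp add: sep_def sum_negf)

text \<open>The supersolution is tested with the negated test function. On the interface the
  flux-limited Hamiltonian is below any common strict bound for A and the full H_i, since H_i^-
  \<le> H_i.\<close>

lemma time_bound_super:
  fixes H :: "'n::finite \<Rightarrow> 'a::finite_dim_inner \<times> real \<Rightarrow> real"
  assumes H: "\<And>i. continuous_on UNIV (H i)" "\<And>i. coercive (H i)" and A: "continuous_on UNIV A"
    and V: "super_sep H A T V"
  shows "time_bound T (\<lambda>z. - V z)"
  unfolding time_bound_def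
proof
  fix L
  obtain K where K: "\<forall>i p q. norm p \<le> L \<longrightarrow> \<bar>q\<bar> \<le> L \<longrightarrow> \<bar>H i (p, q)\<bar> < K"
    "\<forall>p. norm p \<le> L \<longrightarrow> \<bar>A p\<bar> < K"
    using slope_bound[where H = H and L = L, OF H(1) A] by (elim exE conjE)
  show "\<exists>K. \<forall>\<tau> \<tau>' f f' g g' t X. sep_C1 T \<tau> \<tau>' f f' g g' \<and> 0 < t \<and> t < T \<and>
     loc_max (\<lambda>z. - V z - sep \<tau> f g z) (t, X) \<and> norm (f' (tang X)) \<le> L \<and> (\<forall>i. \<bar>g' i (nrm X i)\<bar> \<le> L)
     \<longrightarrow> \<tau>' t \<le> K"
  proof (intro exI[of _ K] allI impI, elim conjE)
    fix \<tau> \<tau>' f f' g g' t X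
    assume C1: "sep_C1 T \<tau> \<tau>' f f' g g'" and t: "0 < t" "t < T"
      and max: "loc_max (\<lambda>z. - V z - sep \<tau> f g z) (t, X)"
      and L: "norm (f' (tang X)) \<le> L" "\<forall>i. \<bar>g' i (nrm X i)\<bar> \<le> L"
    have L': "norm (- f' (tang X)) \<le> L" "\<bar>- g' i (nrm X i)\<bar> \<le> L" for i using L by auto
    have "loc_max (\<lambda>z. sep (\<lambda>t. - \<tau> t) (\<lambda>x. - f x) (\<lambda>i r. - g i r) z - V z) (t, X)"
      using max unfolding sep_uminus loc_max_def by (simp add: algebra_simps)
    then have *: "(\<forall>i. X \<in> branch i - interface \<longrightarrow> 0 \<le> - \<tau>' t + H i (- f' (tang X), - g' i (nrm X i))) \<and>
      (X \<in> interface \<longrightarrow> 0 \<le> - \<tau>' t + F_lim H A (- f' (tang X)) (\<lambda>i. - g' i 0))"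
      using V sep_C1_uminus[OF C1] t unfolding super_sep_def by blast
    show "\<tau>' t \<le> K"
    proof (cases rule: branch_cases[of X])
      case 1
      have "H i (- f' (tang X), - g' i 0) < K" for i
        using K(1)[rule_format, OF L', of i i] 1 by (simp add: interface_nrm abs_less_iff)
      then have "F_lim H A (- f' (tang X)) (\<lambda>i. - g' i 0) < K"
        using K(2)[rule_format, OF L'(1)] by (intro F_lim_less H) auto
      moreover have "0 \<le> - \<tau>' t + F_lim H A (- f' (tang X)) (\<lambda>i. - g' i 0)" using * 1 by blast
      ultimately show ?thesis by linarith
    next
      case (2 i)
      then have "0 \<le> - \<tau>' t + H i (- f' (tang X), - g' i (nrm X i))" using * by blast
      then show ?thesis using K(1)[rule_format, OF L', of i i] by linarith
    qed
  qed
qed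

section \<open>A smooth substitute for the norm\<close>

text \<open>For c > 0 a differentiable function above the norm, exceeding it by at most sqrt c, with
  gradient of length at most 1.\<close>

definition smooth_norm :: "real \<Rightarrow> 'a::real_inner \<Rightarrow> real" where
  "smooth_norm c x = sqrt (c + (norm x)\<^sup>2)"

definition smooth_norm_grad :: "real \<Rightarrow> 'a::real_inner \<Rightarrow> 'a" where
  "smooth_norm_grad c x = x /\<^sub>R smooth_norm c x"

lemma smooth_norm_pos: "0 < c \<Longrightarrow> 0 < smooth_norm c x"
  unfolding smooth_norm_def by (simp add: add_pos_nonneg)

lemma norm_le_smooth_norm: "0 < c \<Longrightarrow> norm x \<le> smooth_norm c x"
  unfolding smooth_norm_def by (rule real_le_rsqrt) simp

lemma norm_smooth_norm_grad_le:
  assumes "0 < c"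
  shows "norm (smooth_norm_grad c x) \<le> 1"
proof -
  have "inverse (smooth_norm c x) * norm x \<le> inverse (smooth_norm c x) * smooth_norm c x"
    using norm_le_smooth_norm[OF assms, of x] smooth_norm_pos[OF assms, of x]
    by (intro mult_left_mono) auto
  then show ?thesis
    unfolding smooth_norm_grad_def using smooth_norm_pos[OF assms, of x] by simp
qed

lemma has_derivative_smooth_norm:
  assumes "0 < c"
  shows "((\<lambda>x. smooth_norm c (x - y)) has_derivative (\<lambda>h. smooth_norm_grad c (x - y) \<bullet> h)) (at x)"
proof -
  have pos: "0 < c + (x - y) \<bullet> (x - y)" using assms by (simp add: add_pos_nonneg)
  have "((\<lambda>x. sqrt (c + (x - y) \<bullet> (x - y))) has_derivative
      (\<lambda>h. ((x - y) \<bullet> h + h \<bullet> (x - y)) * (inverse (sqrt (c + (x - y) \<bullet> (x - y))) / 2))) (at x)"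
    using pos by (auto intro!: derivative_eq_intros)
  moreover have "((x - y) \<bullet> h + h \<bullet> (x - y)) * (inverse (sqrt (c + (x - y) \<bullet> (x - y))) / 2)
      = smooth_norm_grad c (x - y) \<bullet> h" for h
    by (simp add: smooth_norm_grad_def smooth_norm_def power2_norm_eq_inner inner_commute)
  ultimately show ?thesis unfolding smooth_norm_def power2_norm_eq_inner by simp
qed

lemma has_real_derivative_smooth_norm:
  assumes "0 < c"
  shows "((\<lambda>r. smooth_norm c (r - y)) has_real_derivative smooth_norm_grad c (r - y)) (at r)"
  using has_derivative_smooth_norm[OF assms, of y r] unfolding has_field_derivative_def by (simp add: inner_real_def[abs_def])

lemma continuous_on_smooth_norm [continuous_intros]:
  "continuous_on S h \<Longrightarrow> continuous_on S (\<lambda>z. smooth_norm c (h z))"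
  unfolding smooth_norm_def by (intro continuous_intros)

lemma continuous_on_smooth_norm_grad:
  assumes "0 < c" "continuous_on S h"
  shows "continuous_on S (\<lambda>z. smooth_norm_grad c (h z))"
  unfolding smooth_norm_grad_def
  by (intro continuous_intros assms ballI less_imp_neq[symmetric] smooth_norm_pos)

section \<open>Uniformly continuous functions on the junction\<close>

text \<open>Cut the path into pieces shorter than \<delta>; each costs e, and at most l/\<delta> + 1
  pieces are needed.\<close>

lemma uniform_step_bound:
  fixes w :: "'b::metric_space \<Rightarrow> real" and \<gamma> :: "real \<Rightarrow> 'b"
  assumes \<delta>: "0 < \<delta>" "\<And>x y. dist x y < \<delta> \<Longrightarrow> w x - w y \<le> e" and "0 < e"
    and \<gamma>: "\<And>a b. a \<in> {0..1} \<Longrightarrow> b \<in> {0..1} \<Longrightarrow> dist (\<gamma> a) (\<gamma> b) \<le> \<bar>a - b\<bar> * l" and "0 \<le> l"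
  shows "w (\<gamma> 0) - w (\<gamma> 1) \<le> e + e / \<delta> * l"
proof -
  define n where "n = Suc (nat \<lfloor>l / \<delta>\<rfloor>)"
  have n0: "0 < real n" by (simp add: n_def)
  have n1: "real n \<le> l / \<delta> + 1" "l / \<delta> < real n"
    using \<delta>(1) \<open>0 \<le> l\<close> by (auto simp: n_def) linarith+
  have step: "w (\<gamma> 0) - w (\<gamma> (real k / real n)) \<le> real k * e" if "k \<le> n" for k
    using that
  proof (induction k)
    case (Suc k)
    let ?a = "real k / real n" and ?b = "real (Suc k) / real n"
    have ab: "\<bar>?a - ?b\<bar> = 1 / real n" using n0 by (simp add: field_simps)
    have "dist (\<gamma> ?a) (\<gamma> ?b) \<le> 1 / real n * l"
      using \<gamma>[of ?a ?b] Suc.prems n0 unfolding ab by simp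
    also have "\<dots> < \<delta>" using n1(2) n0 \<delta>(1) by (simp add: field_simps)
    finally have "w (\<gamma> ?a) - w (\<gamma> ?b) \<le> e" by (rule \<delta>(2))
    then show ?case using Suc by (simp add: algebra_simps)
  qed simp
  have "w (\<gamma> 0) - w (\<gamma> 1) \<le> real n * e" using step[of n] n0 by simp
  also have "\<dots> \<le> (l / \<delta> + 1) * e" using n1(1) \<open>0 < e\<close> by (intro mult_right_mono) auto
  finally show ?thesis by (simp add: field_simps)
qed

lemma branch_pt_nrm: "X \<in> branch i \<Longrightarrow> branch_pt i (tang X) (nrm X i) = X"
  by (intro junction_eqI) (auto simp: nrm_nonneg branch_def)

text \<open>A branch is a convex half-space, so the straight segment between the two points stays in
  it and has length \<open>dist X Y\<close>.\<close>

lemma uniform_bound_branch: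
  fixes w :: "('a::real_normed_vector, 'n::finite) junction \<Rightarrow> real"
  assumes \<delta>: "0 < \<delta>" "\<And>x y. dist x y < \<delta> \<Longrightarrow> w x - w y \<le> e" and "0 < e"
    and X: "X \<in> branch i" and Y: "Y \<in> branch i"
  shows "w X - w Y \<le> e + e / \<delta> * dist X Y"
proof -
  define \<gamma> :: "real \<Rightarrow> ('a, 'n) junction" where
    "\<gamma> a = branch_pt i ((1 - a) *\<^sub>R tang X + a *\<^sub>R tang Y) ((1 - a) * nrm X i + a * nrm Y i)" for a
  have D: "(dist X Y)\<^sup>2 = (dist (tang X) (tang Y))\<^sup>2 + \<bar>nrm X i - nrm Y i\<bar>\<^sup>2"
    using dist_same_branch[OF nrm_nonneg[of X i] nrm_nonneg[of Y i], of i "tang X" "tang Y"]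
    by (simp add: branch_pt_nrm X Y)
  have "dist (\<gamma> a) (\<gamma> b) \<le> \<bar>a - b\<bar> * dist X Y" if "a \<in> {0..1}" "b \<in> {0..1}" for a b
  proof (rule power2_le_imp_le)
    have pos: "0 \<le> (1 - a) * nrm X i + a * nrm Y i" "0 \<le> (1 - b) * nrm X i + b * nrm Y i"
      using that by (auto intro!: add_nonneg_nonneg mult_nonneg_nonneg nrm_nonneg)
    have 1: "((1 - a) *\<^sub>R tang X + a *\<^sub>R tang Y) - ((1 - b) *\<^sub>R tang X + b *\<^sub>R tang Y) = (b - a) *\<^sub>R (tang X - tang Y)"
      by (simp add: algebra_simps)
    have 2: "((1 - a) * nrm X i + a * nrm Y i) - ((1 - b) * nrm X i + b * nrm Y i) = (b - a) * (nrm X i - nrm Y i)"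
      by (simp add: algebra_simps)
    show "(dist (\<gamma> a) (\<gamma> b))\<^sup>2 \<le> (\<bar>a - b\<bar> * dist X Y)\<^sup>2"
      unfolding \<gamma>_def dist_same_branch[OF pos] power_mult_distrib D unfolding dist_norm 1 2
      by (simp add: power_mult_distrib distrib_left power2_commute[of b a])
  qed simp
  from uniform_step_bound[OF \<delta> \<open>0 < e\<close> this] show ?thesis
    by (simp add: \<gamma>_def branch_pt_nrm X Y)
qed

lemma uniformly_continuous_junction_bound:
  fixes w :: "('a::real_normed_vector, 'n::finite) junction \<Rightarrow> real"
  assumes w: "uniformly_continuous_on UNIV w" and "0 < \<theta>"
  obtains L where "0 \<le> L"
    "\<And>X Y. w X - w Y \<le> \<theta> + L * (dist (tang X) (tang Y) + (\<Sum>i\<in>UNIV. \<bar>nrm X i - nrm Y i\<bar>))"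
proof -
  \<comment> \<open>Half of \<theta>, because a route between different branches consists of two
    segments, each with additive cost e.\<close>
  define e where "e = \<theta> / 2"
  have e: "0 < e" using assms(2) by (simp add: e_def)
  obtain \<delta> where \<delta>: "0 < \<delta>" "\<And>X Y. dist X Y < \<delta> \<Longrightarrow> dist (w X) (w Y) < e"
    using w e unfolding uniformly_continuous_on_def by (metis UNIV_I dist_commute)
  have \<delta>': "w X - w Y \<le> e" if "dist X Y < \<delta>" for X Y
    using \<delta>(2)[OF that] by (simp add: dist_real_def)
  let ?d = "\<lambda>X Y :: ('a, 'n) junction. dist (tang X) (tang Y) + (\<Sum>i\<in>UNIV. \<bar>nrm X i - nrm Y i\<bar>)"
  show thesis
  proof (rule that[of "e / \<delta>"])
    show "0 \<le> e / \<delta>" using e \<delta> by simp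
    fix X Y :: "('a, 'n) junction"
    have "X \<in> (\<Union>i. branch i)" "Y \<in> (\<Union>i. branch i)" by (simp_all add: Union_branch)
    then obtain i j where ij: "X \<in> branch i" "Y \<in> branch j" by auto
    show "w X - w Y \<le> \<theta> + e / \<delta> * ?d X Y"
    proof (cases "i = j")
      case True
      then have "w X - w Y \<le> e + e / \<delta> * dist X Y"
        using uniform_bound_branch[where w = w, OF \<delta>(1) \<delta>' e] ij by blast
      also have "\<dots> \<le> \<theta> + e / \<delta> * ?d X Y"
        using e \<delta>(1) dist_junction_le[of X Y]
        by (intro add_mono mult_left_mono) (auto simp: e_def)
      finally show ?thesis .
    next
      case False
      \<comment> \<open>The foot of X on the interface belongs to both branches. For different
        branches the sum of normal differences is x_i + y_j, so the detour through P is no longer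
        than the distance in the claim.\<close>
      define P :: "('a, 'n) junction" where "P = branch_pt i (tang X) 0"
      have P: "tang P = tang X" "nrm P = (\<lambda>_. 0)" by (auto simp: P_def)
      have "w X - w P \<le> e + e / \<delta> * dist X P" "w P - w Y \<le> e + e / \<delta> * dist P Y"
        using uniform_bound_branch[where w = w, OF \<delta>(1) \<delta>' e] ij P by (auto simp: branch_def)
      then have *: "w X - w Y \<le> \<theta> + e / \<delta> * (dist X P + dist P Y)"
        unfolding distrib_left using e_def by linarith
      have "dist X P + dist P Y \<le> (\<Sum>k\<in>UNIV. \<bar>nrm X k\<bar>) + (dist (tang X) (tang Y) + (\<Sum>k\<in>UNIV. \<bar>nrm Y k\<bar>))"
        using dist_junction_le[of X P] dist_junction_le[of P Y] by (simp add: P)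
      also have "\<dots> = dist (tang X) (tang Y) + (\<Sum>k\<in>UNIV. \<bar>nrm X k\<bar> + \<bar>nrm Y k\<bar>)"
        by (simp add: sum.distrib)
      also have "(\<Sum>k\<in>UNIV. \<bar>nrm X k\<bar> + \<bar>nrm Y k\<bar>) = (\<Sum>k\<in>UNIV. \<bar>nrm X k - nrm Y k\<bar>)"
      proof (rule sum.cong[OF refl])
        fix k
        have "nrm X k = 0 \<or> nrm Y k = 0" using False ij unfolding branch_def by (cases "k = i") auto
        then show "\<bar>nrm X k\<bar> + \<bar>nrm Y k\<bar> = \<bar>nrm X k - nrm Y k\<bar>" by auto
      qed
      finally have "e / \<delta> * (dist X P + dist P Y) \<le> e / \<delta> * ?d X Y"
        using e \<delta>(1) by (intro mult_left_mono) auto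
      then show ?thesis using * by linarith
    qed
  qed
qed

section \<open>Linear growth in time\<close>

lemma loc_max_dom0:
  fixes F :: "real \<times> ('a::metric_space, 'n::finite) junction \<Rightarrow> real"
  assumes "0 < t" "t < T" "\<And>z. z \<in> dom0 T \<Longrightarrow> F z \<le> F (t, X)"
  shows "loc_max F (t, X)"
  unfolding loc_max_def using eventually_nhds_dom0[OF assms(1,2), of X]
  by eventually_elim (rule assms(3))

lemma has_real_derivative_blowup:
  assumes "t \<noteq> T"
  shows "((\<lambda>t. \<eta> / (T - t)) has_real_derivative \<eta> / (T - t)\<^sup>2) (at (t :: real))"
  using assms by (auto intro!: derivative_eq_intros simp: power2_eq_square)

lemma usc_on_diff_sep:
  fixes W :: "real \<times> ('a::finite_dim_inner, 'n::finite) junction \<Rightarrow> real"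
  assumes "usc_on S W" "S \<subseteq> I \<times> UNIV" "continuous_on I \<tau>" "continuous_on UNIV f" "\<And>i. continuous_on UNIV (g i)"
  shows "usc_on S (\<lambda>z. W z - sep \<tau> f g z)"
  using usc_on_diff[OF assms(1) continuous_on_subset[OF continuous_on_sep[OF assms(3-5)] assms(2)]] .

text \<open>
  The barriers are smoothed cones with vertex \<open>Y\<close>, evaluated at \<open>Y\<close>. Their slopes do not depend
  on \<open>Y\<close>, hence neither does \<open>K\<close>.
\<close>

lemma linear_time_growth:
  fixes W :: "real \<times> ('a::finite_dim_inner, 'n::finite) junction \<Rightarrow> real"
  assumes W: "usc_on (dom0 T) W" "\<And>t X. (t, X) \<in> dom0 T \<Longrightarrow> W (t, X) \<le> C * (1 + dist X0 X)"
    and "0 < C" and tb: "time_bound T W"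
    and w0: "\<And>X. W (0, X) \<le> w X" "uniformly_continuous_on UNIV w" and \<theta>: "0 < \<theta>"
  obtains K where "0 \<le> K" "\<And>t X. (t, X) \<in> dom0 T \<Longrightarrow> W (t, X) \<le> w X + \<theta> + K * t"
proof -
  let ?d = "\<lambda>X Y :: ('a, 'n) junction. dist (tang X) (tang Y) + (\<Sum>i\<in>UNIV. \<bar>nrm X i - nrm Y i\<bar>)"
  have "0 < \<theta> / 3" using \<theta> by simp
  then obtain L0 where L0: "0 \<le> L0" "\<And>X Y. w X - w Y \<le> \<theta> / 3 + L0 * ?d X Y"
    using uniformly_continuous_junction_bound[OF w0(2)] by metis
  \<comment> \<open>The slope L0 makes the cone dominate w at time 0; the slope C + 1 makes it
    outgrow W at infinity.\<close>
  define L where "L = max L0 (C + 1)"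
  have L: "L0 \<le> L" "C + 1 \<le> L" "0 < L" using \<open>0 < C\<close> by (auto simp: L_def)
  have d0: "0 \<le> ?d X Y" for X Y by (intro add_nonneg_nonneg sum_nonneg) auto
  obtain K' where K': "\<forall>\<tau> \<tau>' f f' g g' t X. sep_C1 T \<tau> \<tau>' f f' g g' \<and> 0 < t \<and> t < T \<and>
     loc_max (\<lambda>z. W z - sep \<tau> f g z) (t, X) \<and> norm (f' (tang X)) \<le> L \<and> (\<forall>i. \<bar>g' i (nrm X i)\<bar> \<le> L)
     \<longrightarrow> \<tau>' t \<le> K'"
    using tb unfolding time_bound_def by (elim allE[of _ L] exE)
  define K where "K = max K' 0"
  \<comment> \<open>The number of smoothed norms in the barrier, one tangential and one for each
    branch. At the vertex each contributes L sqrt c, and c makes the total equal to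
    \<theta>/3.\<close>
  define m where "m = 1 + real CARD('n)"
  have m: "0 < m" by (simp add: m_def)
  define c where "c = (\<theta> / (3 * L * m))\<^sup>2"
  have c: "0 < c" "sqrt c = \<theta> / (3 * L * m)" using \<theta> L m by (auto simp: c_def)
  have main: "W (t0, Y) \<le> w Y + 2 * \<theta> / 3 + K * t0 + \<eta> / (T - t0)"
    if z0: "(t0, Y) \<in> dom0 T" and \<eta>: "0 < \<eta>" for t0 Y \<eta>
  proof -
    define \<tau> where "\<tau> t = w Y + \<theta> / 3 + K * t + \<eta> / (T - t)" for t
    define \<tau>' where "\<tau>' t = K + \<eta> / (T - t)\<^sup>2" for t
    define f where "f x = L * smooth_norm c (x - tang Y)" for x
    define f' where "f' x = L *\<^sub>R smooth_norm_grad c (x - tang Y)" for x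
    define g where "g i r = L * smooth_norm c (r - nrm Y i)" for i r
    define g' where "g' i r = L * smooth_norm_grad c (r - nrm Y i)" for i r
    have C1: "sep_C1 T \<tau> \<tau>' f f' g g'"
      unfolding sep_C1_def
    proof (intro conjI ballI allI)
      show "(\<tau> has_real_derivative \<tau>' t) (at t)" if "t \<in> {0<..<T}" for t
        using DERIV_add[OF DERIV_add[OF DERIV_const[of "w Y + \<theta> / 3"] DERIV_cmult_Id[of K]]
            has_real_derivative_blowup[of t T \<eta>]] that
        by (simp add: \<tau>_def[abs_def] \<tau>'_def)
      show "continuous_on {0<..<T} \<tau>'" unfolding \<tau>'_def by (intro continuous_intros) auto
      show "(f has_derivative (\<lambda>h. f' x \<bullet> h)) (at x)" for x
        unfolding f_def[abs_def] f'_def inner_scaleR_left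
        by (intro has_derivative_mult_right has_derivative_smooth_norm c)
      show "continuous_on UNIV f'" unfolding f'_def
        by (intro continuous_intros continuous_on_smooth_norm_grad c)
      show "(g i has_real_derivative g' i r) (at r)" for i r
        unfolding g_def[abs_def] g'_def by (intro DERIV_cmult has_real_derivative_smooth_norm c)
      show "continuous_on UNIV (g' i)" for i unfolding g'_def
        by (intro continuous_intros continuous_on_smooth_norm_grad c)
    qed
    have sep_ge: "w Y + \<theta> / 3 + K * t + \<eta> / (T - t) + L * ?d X Y \<le> sep \<tau> f g (t, X)" for t X
    proof -
      have "\<bar>nrm X i - nrm Y i\<bar> \<le> smooth_norm c (nrm X i - nrm Y i)" for i
        using norm_le_smooth_norm[OF c(1), of "nrm X i - nrm Y i"] by simp
      then have "L * ?d X Y \<le> L * (smooth_norm c (tang X - tang Y) + (\<Sum>i\<in>UNIV. smooth_norm c (nrm X i - nrm Y i)))"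
        using L(3) norm_le_smooth_norm[OF c(1), of "tang X - tang Y"]
        by (intro mult_left_mono add_mono sum_mono) (auto simp: dist_norm)
      then show ?thesis by (simp add: sep_def \<tau>_def f_def g_def distrib_left sum_distrib_left)
    qed
    have sep_Y: "sep \<tau> f g (t, Y) = w Y + 2 * \<theta> / 3 + K * t + \<eta> / (T - t)" for t
    proof -
      have "L * (m * sqrt c) = \<theta> / 3" using L m c(2) by (simp add: field_simps)
      then show ?thesis
        by (simp add: sep_def \<tau>_def f_def g_def smooth_norm_def m_def algebra_simps)
    qed
    define F where "F z = W z - sep \<tau> f g z" for z
    have "F z \<le> 0" if z: "z \<in> dom0 T" for z
    proof (rule ccontr)
      assume "\<not> F z \<le> 0"
      then have Fz: "0 < F z" by simp
      define B where "B = C + C * dist X0 Y - w Y"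
      \<comment> \<open>The set where W exceeds the barrier is bounded and stays away from T: the
        surplus slope 1 over C controls the distance to Y, and the blow-up term controls T -
        t.\<close>
      have far: "?d X Y + \<eta> / (T - t) \<le> B" if tX: "(t, X) \<in> dom0 T" and "0 \<le> F (t, X)" for t X
      proof -
        have "dist X0 X \<le> dist X0 Y + ?d X Y"
          using dist_triangle[of X0 X Y] dist_junction_le[of X Y] by (simp add: dist_commute)
        then have "C * dist X0 X \<le> C * dist X0 Y + C * ?d X Y"
          using \<open>0 < C\<close> by (metis distrib_left less_imp_le mult_left_mono)
        then have "W (t, X) \<le> C + C * dist X0 Y + C * ?d X Y"
          using W(2)[OF tX] unfolding distrib_left by linarith
        moreover have "sep \<tau> f g (t, X) \<le> W (t, X)" using that(2) by (simp add: F_def)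
        moreover have "0 \<le> K * t" using tX by (simp add: K_def dom0_def)
        moreover have "(C + 1) * ?d X Y \<le> L * ?d X Y" by (intro mult_right_mono L d0)
        ultimately show ?thesis using sep_ge[of t X] \<theta> unfolding B_def by (simp add: distrib_right)
      qed
      obtain t1 X1 where z1: "z = (t1, X1)" by (cases z)
      have tT: "t1 < T" using z z1 by (simp add: dom0_def)
      have B: "0 < B"
      proof -
        have "0 < \<eta> / (T - t1)" using \<eta> tT by simp
        then show ?thesis using far[of t1 X1] z Fz d0[of X1 Y] unfolding z1 by linarith
      qed
      define T1 where "T1 = T - \<eta> / B"
      have T1: "T1 < T" using \<eta> B by (simp add: T1_def)
      let ?X = "{X. ?d X Y \<le> B}"
      have "compact ?X"
      proof (rule compact_junction_subset)
        show "closed ?X" by (intro closed_Collect_le continuous_intros)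
        show "norm (tang X) \<le> B + norm (tang Y) + (\<Sum>i\<in>UNIV. nrm Y i)" if "X \<in> ?X" for X
        proof -
          have "0 \<le> (\<Sum>i\<in>UNIV. \<bar>nrm X i - nrm Y i\<bar>)" "0 \<le> (\<Sum>i\<in>UNIV. nrm Y i)"
            by (intro sum_nonneg; simp add: nrm_nonneg)+
          moreover have "norm (tang X) \<le> dist (tang X) (tang Y) + norm (tang Y)"
            using norm_triangle_ineq2[of "tang X" "tang Y"] by (simp add: dist_norm)
          ultimately show ?thesis using that unfolding mem_Collect_eq by linarith
        qed
        show "nrm X i \<le> B + norm (tang Y) + (\<Sum>i\<in>UNIV. nrm Y i)" if "X \<in> ?X" for X i
        proof -
          have "\<bar>nrm X i - nrm Y i\<bar> \<le> (\<Sum>i\<in>UNIV. \<bar>nrm X i - nrm Y i\<bar>)" "nrm Y i \<le> (\<Sum>i\<in>UNIV. nrm Y i)"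
            by (intro member_le_sum; simp add: nrm_nonneg)+
          moreover have "0 \<le> dist (tang X) (tang Y)" "0 \<le> norm (tang Y)" by simp_all
          ultimately show ?thesis using that unfolding mem_Collect_eq by linarith
        qed
      qed
      then have cK: "compact ({0..T1} \<times> ?X)" by (intro compact_Times compact_Icc)
      have sub: "{0..T1} \<times> ?X \<subseteq> dom0 T" using T1 by (auto simp: dom0_def)
      have inK: "y \<in> {0..T1} \<times> ?X" if y: "y \<in> dom0 T" and "0 \<le> F y" for y
      proof -
        obtain t X where tX: "y = (t, X)" by (cases y)
        have t: "0 \<le> t" "t < T" using y tX by (auto simp: dom0_def)
        have f: "?d X Y + \<eta> / (T - t) \<le> B" using far that tX by blast
        moreover have "0 < \<eta> / (T - t)" using \<eta> t by simp
        ultimately have "?d X Y \<le> B" "\<eta> / (T - t) \<le> B" using d0[of X Y] by linarith+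
        moreover have "t \<le> T1"
          using calculation(2) t B by (simp add: T1_def field_simps)
        ultimately show ?thesis using t tX by simp
      qed
      have "usc_on (dom0 T) F"
        unfolding F_def
      proof (rule usc_on_diff_sep[OF W(1)])
        show "dom0 T \<subseteq> {0..<T} \<times> UNIV" by (simp add: dom0_def)
        show "continuous_on {0..<T} \<tau>" unfolding \<tau>_def by (intro continuous_intros) auto
      qed (use sep_C1_continuous_on[OF C1] in auto)
      then have usc: "usc_on ({0..T1} \<times> ?X) F" using sub by (rule usc_on_subset)
      have "{0..T1} \<times> ?X \<noteq> {}" using inK[OF z] Fz by auto
      from usc_on_attains_max[OF cK this usc]
      obtain y where y: "y \<in> {0..T1} \<times> ?X" "\<forall>x\<in>{0..T1} \<times> ?X. F x \<le> F y" ..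
      have Fy: "0 < F y" using y(2)[rule_format, OF inK[OF z]] Fz by simp
      have ymax: "F x \<le> F y" if "x \<in> dom0 T" for x
        using y(2) inK[OF that] Fy by (cases "0 \<le> F x") auto
      obtain t X where tX: "y = (t, X)" by (cases y)
      have t: "0 \<le> t" "t < T" using y(1) T1 tX by auto
      \<comment> \<open>At time 0 the modulus of w already places the barrier above W.\<close>
      have "t \<noteq> 0"
      proof
        assume "t = 0"
        have "0 < \<eta> / (T - t)" using \<eta> t by simp
        moreover have "L0 * ?d X Y \<le> L * ?d X Y" by (intro mult_right_mono L d0)
        ultimately have "W (0, X) \<le> sep \<tau> f g (t, X)"
          using sep_ge[of t X] w0(1)[of X] L0(2)[of X Y] \<open>t = 0\<close> by simp
        then show False using Fy \<open>t = 0\<close> tX by (simp add: F_def)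
      qed
      then have "0 < t" using t by simp
      have "loc_max (\<lambda>z. W z - sep \<tau> f g z) (t, X)"
        using loc_max_dom0[OF \<open>0 < t\<close> t(2), of F X] ymax unfolding tX F_def by blast
      moreover have "norm (f' (tang X)) \<le> L"
        using norm_smooth_norm_grad_le[OF c(1), of "tang X - tang Y"] L(3) by (simp add: f'_def mult_le_cancel_left1)
      moreover have "\<bar>g' i (nrm X i)\<bar> \<le> L" for i
        using norm_smooth_norm_grad_le[OF c(1), of "nrm X i - nrm Y i"] L(3)
        by (simp add: g'_def abs_mult mult_le_cancel_left1)
      ultimately have "\<tau>' t \<le> K'" using K' C1 \<open>0 < t\<close> t(2) by blast
      \<comment> \<open>The blow-up term makes the time slope strictly larger than K, hence than the
        bound K' for all touching functions of slope at most L.\<close>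
      moreover have "0 < \<eta> / (T - t)\<^sup>2" using \<eta> t by simp
      ultimately show False by (simp add: \<tau>'_def K_def)
    qed
    from this[OF z0] show ?thesis by (simp add: F_def sep_Y)
  qed
  show thesis
  proof (rule that[of K])
    show "0 \<le> K" by (simp add: K_def)
    fix t and X :: "('a, 'n) junction" assume tX: "(t, X) \<in> dom0 T"
    then have "0 < T - t" by (simp add: dom0_def)
    \<comment> \<open>With \<eta> = \<theta>/3 (T - t) the blow-up term equals \<theta>/3 at the
      time considered, which completes the budget \<theta>.\<close>
    then have "0 < \<theta> / 3 * (T - t)" "\<theta> / 3 * (T - t) / (T - t) = \<theta> / 3"
      using \<theta> by (auto intro!: nonzero_mult_div_cancel_right simp del: times_divide_eq_left)
    then show "W (t, X) \<le> w X + \<theta> + K * t" using main[OF tX, of "\<theta> / 3 * (T - t)"] by linarith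
  qed
qed

section \<open>Local analysis at the interface\<close>

definition height :: "('a, 'n::finite) junction \<Rightarrow> real" where
  "height X = (\<Sum>i\<in>UNIV. nrm X i)"

lemma height_nonneg: "0 \<le> height X"
  unfolding height_def by (intro sum_nonneg nrm_nonneg)

lemma nrm_le_height: "nrm X i \<le> height X"
  unfolding height_def by (rule member_le_sum) (auto simp: nrm_nonneg)

lemma sum_branch:
  fixes g :: "'n::finite \<Rightarrow> real"
  assumes "X \<in> branch i"
  shows "(\<Sum>j\<in>UNIV. g j * nrm X j) = g i * nrm X i"
proof -
  have "(\<Sum>j\<in>UNIV. g j * nrm X j) = (\<Sum>j\<in>{i}. g j * nrm X j)"
    by (rule sum.mono_neutral_right) (use assms in \<open>auto simp: branch_def\<close>)
  then show ?thesis by simp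
qed

lemma height_branch: "X \<in> branch i \<Longrightarrow> height X = nrm X i"
  using sum_branch[of X i "\<lambda>_. 1"] by (simp add: height_def)

lemma height_eq_0_iff: "height X = 0 \<longleftrightarrow> X \<in> interface"
  unfolding height_def interface_nrm by (subst sum_nonneg_eq_0_iff) (auto simp: nrm_nonneg)

lemma continuous_on_height [continuous_intros]:
  fixes h :: "'b::topological_space \<Rightarrow> ('a::metric_space, 'n::finite) junction"
  shows "continuous_on S h \<Longrightarrow> continuous_on S (\<lambda>z. height (h z))"
  unfolding height_def by (intro continuous_intros)

text \<open>The height has its own bound, because \<open>lower_slope\<close> needs cylinders of
  height y and radius proportional to y.\<close>

definition cyl :: "real \<Rightarrow> 'a \<Rightarrow> real \<Rightarrow> real \<Rightarrow> (real \<times> ('a::real_normed_vector, 'n::finite) junction) set" where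
  "cyl t0 x0 R \<rho> = {z. \<bar>fst z - t0\<bar> \<le> R \<and> norm (tang (snd z) - x0) \<le> R \<and> height (snd z) \<le> \<rho>}"

lemma compact_cyl:
  fixes x0 :: "'a::finite_dim_inner"
  shows "compact (cyl t0 x0 R \<rho> :: (real \<times> ('a, 'n::finite) junction) set)"
proof -
  let ?X = "{X :: ('a, 'n) junction. norm (tang X - x0) \<le> R \<and> height X \<le> \<rho>}"
  have "compact ?X"
  proof (rule compact_junction_subset)
    show "closed ?X" by (intro closed_Collect_conj closed_Collect_le continuous_intros)
    show "norm (tang X) \<le> R + norm x0 + \<bar>\<rho>\<bar>" if "X \<in> ?X" for X
    proof -
      have "norm (tang X) - norm x0 \<le> norm (tang X - x0)" by (rule norm_triangle_ineq2)
      then show ?thesis using that unfolding mem_Collect_eq by linarith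
    qed
    show "nrm X i \<le> R + norm x0 + \<bar>\<rho>\<bar>" if "X \<in> ?X" for X i
    proof -
      have "0 \<le> norm (tang X - x0)" "0 \<le> norm x0" by simp_all
      then show ?thesis using that nrm_le_height[of X i] unfolding mem_Collect_eq by linarith
    qed
  qed
  then have "compact ({t0 - R..t0 + R} \<times> ?X)" by (intro compact_Times compact_Icc)
  moreover have "cyl t0 x0 R \<rho> = {t0 - R..t0 + R} \<times> ?X"
    by (auto simp: cyl_def abs_le_iff)
  ultimately show ?thesis by simp
qed

lemma loc_max_cyl:
  fixes x0 :: "'a::finite_dim_inner" and F :: "real \<times> ('a, 'n::finite) junction \<Rightarrow> real"
  assumes max: "\<And>z. z \<in> cyl t0 x0 R \<rho> \<Longrightarrow> F z \<le> F (t, X)"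
    and inside: "\<bar>t - t0\<bar> < R" "norm (tang X - x0) < R" "height X < \<rho>"
  shows "loc_max F (t, X)"
proof -
  let ?S = "{z :: real \<times> ('a, 'n) junction. \<bar>fst z - t0\<bar> < R \<and> norm (tang (snd z) - x0) < R \<and> height (snd z) < \<rho>}"
  have "open ?S" by (intro open_Collect_conj open_Collect_less continuous_intros)
  then have "\<forall>\<^sub>F z in nhds (t, X). z \<in> ?S" using inside by (intro eventually_nhds_in_open) auto
  then show ?thesis unfolding loc_max_def
    by eventually_elim (intro max, auto simp: cyl_def)
qed

lemma cyl_subset:
  assumes "R < t0" "R < T - t0"
  shows "cyl t0 x0 R \<rho> \<subseteq> {0<..<T} \<times> UNIV"
  using assms by (auto simp: cyl_def)

lemma JT_subset_dom0: "{0<..<T} \<times> UNIV \<subseteq> dom0 T"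
  by (auto simp: dom0_def)

lemma has_derivative_square_norm:
  "((\<lambda>x :: 'a::real_inner. c * (norm (x - b))\<^sup>2) has_derivative (\<lambda>h. ((2 * c) *\<^sub>R (x - b)) \<bullet> h)) (at x)"
  unfolding power2_norm_eq_inner
  by (auto intro!: derivative_eq_intros simp: inner_commute algebra_simps)

text \<open>Localization by quadratic terms in time and tangential position, together with a freely
  prescribed constant normal slope on every branch.\<close>

lemma sep_C1_perturb:
  assumes "sep_C1 T \<tau> \<tau>' f f' g g'"
  shows "sep_C1 T (\<lambda>t. \<tau> t + c * (t - a)\<^sup>2) (\<lambda>t. \<tau>' t + 2 * c * (t - a))
    (\<lambda>x. f x + c * (norm (x - b))\<^sup>2) (\<lambda>x. f' x + (2 * c) *\<^sub>R (x - b)) (\<lambda>i r. q i * r) (\<lambda>i r. q i)"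
  unfolding sep_C1_def
proof (intro conjI ballI allI)
  show "((\<lambda>t. \<tau> t + c * (t - a)\<^sup>2) has_real_derivative \<tau>' t + 2 * c * (t - a)) (at t)" if "t \<in> {0<..<T}" for t
  proof -
    have "(\<tau> has_real_derivative \<tau>' t) (at t)" using assms that by (simp add: sep_C1_def)
    then show ?thesis by (auto intro!: derivative_eq_intros)
  qed
  show "((\<lambda>x. f x + c * (norm (x - b))\<^sup>2) has_derivative (\<lambda>h. (f' x + (2 * c) *\<^sub>R (x - b)) \<bullet> h)) (at x)" for x
  proof -
    have "(f has_derivative (\<lambda>h. f' x \<bullet> h)) (at x)" using assms by (simp add: sep_C1_def)
    from has_derivative_add[OF this has_derivative_square_norm] show ?thesis
      by (simp add: inner_add_left)
  qed
  show "((\<lambda>r. q i * r) has_real_derivative q i) (at r)" for i r by (rule DERIV_cmult_Id)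
qed (use assms in \<open>auto simp: sep_C1_def intro!: continuous_intros\<close>)

lemma coercive_bound_uniform:
  fixes H :: "'n::finite \<Rightarrow> 'b::real_normed_vector \<Rightarrow> real"
  assumes "\<And>i. coercive (H i)"
  shows "\<exists>B>0. \<forall>i p. B \<le> norm p \<longrightarrow> c < H i p"
proof -
  have "\<exists>B>0. \<forall>p. B \<le> norm p \<longrightarrow> c < H i p" for i
    using coercive_bound[OF assms[of i], of c] by metis
  then obtain B where B: "\<And>i. 0 < B i" "\<And>i p. B i \<le> norm p \<Longrightarrow> c < H i p" by metis
  have le: "B i \<le> (\<Sum>i\<in>UNIV. B i)" for i
    by (rule member_le_sum) (auto intro: less_imp_le B(1))
  have "0 < (\<Sum>i\<in>UNIV. B i)" by (rule sum_pos) (auto intro: B(1))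
  moreover have "c < H i p" if "(\<Sum>i\<in>UNIV. B i) \<le> norm p" for i p
    using le[of i] that by (intro B(2)) linarith
  ultimately show ?thesis by blast
qed

text \<open>
  Steep normal slopes are inadmissible by coercivity, so a penalized maximum is on the interface.
\<close>

lemma upper_cone:
  fixes U :: "real \<times> ('a::finite_dim_inner, 'n::finite) junction \<Rightarrow> real"
  assumes usc: "usc_on (dom0 T) U" and U: "sub_sep H A T U" and coer: "\<And>i. coercive (H i)"
    and C1: "sep_C1 T \<tau> \<tau>' f f' (\<lambda>(i :: 'n) _. 0) (\<lambda>_ _. 0)"
    and t0: "0 < t0" "t0 < T" and X0: "X0 \<in> interface"
    and max: "\<And>t X. (t, X) \<in> dom0 T \<Longrightarrow> X \<in> interface \<Longrightarrow>
       U (t, X) - \<tau> t - f (tang X) \<le> U (t0, X0) - \<tau> t0 - f (tang X0)"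
  shows "\<exists>L>0. \<exists>r>0. r < t0 \<and> r < T - t0 \<and> (\<forall>(t, X)\<in>cyl t0 (tang X0) r r. U (t, X) - \<tau> t - f (tang X)
      \<le> U (t0, X0) - \<tau> t0 - f (tang X0) + (t - t0)\<^sup>2 + (norm (tang X - tang X0))\<^sup>2 + L * height X)"
proof -
  define r where "r = min t0 (T - t0) / 2"
  have r: "0 < r" "r < t0" "r < T - t0" using t0 by (auto simp: r_def)
  let ?K = "cyl t0 (tang X0) r r :: (real \<times> ('a, 'n) junction) set"
  let ?\<tau> = "\<lambda>t. \<tau> t + 1 * (t - t0)\<^sup>2" and ?\<tau>' = "\<lambda>t. \<tau>' t + 2 * 1 * (t - t0)"
  let ?f = "\<lambda>x. f x + 1 * (norm (x - tang X0))\<^sup>2"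
    and ?f' = "\<lambda>x. f' x + (2 * 1) *\<^sub>R (x - tang X0)"
  define G where "G z = U z - sep ?\<tau> ?f (\<lambda>(i :: 'n) r. 0 * r) z" for z
  define bar where "bar = U (t0, X0) - \<tau> t0 - f (tang X0)"
  have C1': "sep_C1 T ?\<tau> ?\<tau>' ?f ?f' (\<lambda>(i :: 'n) r. M * r) (\<lambda>i r. M)" for M
    by (rule sep_C1_perturb[OF C1])
  have G: "G (t, X) = U (t, X) - \<tau> t - f (tang X) - (t - t0)\<^sup>2 - (norm (tang X - tang X0))\<^sup>2" for t X
    by (simp add: G_def sep_def)
  have sepM: "U z - sep ?\<tau> ?f (\<lambda>(i :: 'n) r. M * r) z = G z - M * height (snd z)" for M z
    by (simp add: G_def sep_def height_def sum_distrib_left)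
  have KJ: "?K \<subseteq> {0<..<T} \<times> UNIV" using r by (intro cyl_subset)
  have Kd: "?K \<subseteq> dom0 T" using KJ JT_subset_dom0 by (rule order_trans)
  have uscG: "usc_on ?K G"
    unfolding G_def
    by (rule usc_on_diff_sep[OF usc_on_subset[OF usc Kd] KJ]) (use sep_C1_continuous_on[OF C1'[of 0]] in auto)
  define m where "m z = max (max \<bar>fst z - t0\<bar> (norm (tang (snd z) - tang X0))) (height (snd z))"
    for z :: "real \<times> ('a, 'n) junction"
  \<comment> \<open>The lateral boundary and the lid of the cylinder.\<close>
  let ?E = "{z \<in> ?K. r \<le> m z}"
  have "closed {z. r \<le> m z}" unfolding m_def by (intro closed_Collect_le continuous_intros)
  then have "compact (?K \<inter> {z. r \<le> m z})" by (rule compact_Int_closed[OF compact_cyl])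
  moreover have "?K \<inter> {z. r \<le> m z} = ?E" by auto
  ultimately have cE: "compact ?E" by simp
  \<comment> \<open>On the interface part of the boundary the quadratic terms are positive, which
    makes the maximality strict; elsewhere on the boundary the height is positive and can be
    penalized.\<close>
  have "G z < bar" if z: "z \<in> ?E" "height (snd z) = 0" for z
  proof -
    obtain t X where tX: "z = (t, X)" by (cases z)
    have "r \<le> \<bar>t - t0\<bar> \<or> r \<le> norm (tang X - tang X0)"
      using z r by (auto simp: m_def tX)
    then have "r\<^sup>2 \<le> \<bar>t - t0\<bar>\<^sup>2 \<or> r\<^sup>2 \<le> (norm (tang X - tang X0))\<^sup>2"
      using r power_mono[of r "\<bar>t - t0\<bar>" 2] power_mono[of r "norm (tang X - tang X0)" 2] by auto
    then have "0 < (t - t0)\<^sup>2 + (norm (tang X - tang X0))\<^sup>2"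
      using r zero_less_power[of r 2] zero_le_power2[of "t - t0"] zero_le_power2[of "norm (tang X - tang X0)"]
      unfolding power2_abs by linarith
    moreover have "U (t, X) - \<tau> t - f (tang X) \<le> bar"
      unfolding bar_def using z Kd tX by (intro max) (auto simp: height_eq_0_iff)
    ultimately show ?thesis unfolding tX G by linarith
  qed
  moreover have "usc_on ?E G" using uscG by (rule usc_on_subset) auto
  moreover have "continuous_on ?E (\<lambda>z. height (snd z))" by (intro continuous_intros)
  ultimately have "\<exists>L1>0. \<forall>z\<in>?E. \<forall>M\<ge>L1. G z - M * height (snd z) < bar"
    using usc_on_penalization[OF cE, of G "\<lambda>z. height (snd z)" bar] height_nonneg by blast
  then obtain L1 where L1: "L1 > 0" "\<forall>z\<in>?E. \<forall>M\<ge>L1. G z - M * height (snd z) < bar"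
    by (elim exE conjE)
  have "continuous_on {0<..<T} ?\<tau>'" using C1'[of 0] unfolding sep_C1_def by blast
  then have "continuous_on {t0 - r..t0 + r} ?\<tau>'" by (rule continuous_on_subset) (use r in auto)
  then have "bounded (?\<tau>' ` {t0 - r..t0 + r})"
    by (intro compact_imp_bounded compact_continuous_image compact_Icc)
  then obtain c where c: "\<forall>x\<in>?\<tau>' ` {t0 - r..t0 + r}. norm x \<le> c" unfolding bounded_iff ..
  obtain B where B: "B > 0" "\<forall>i p. B \<le> norm p \<longrightarrow> c < H i p"
    using coercive_bound_uniform[of H c, OF coer] by blast
  \<comment> \<open>L1 keeps the boundary values below \<open>bar\<close>; B makes H_i at normal
    slope L exceed c, which bounds the absolute time slope on the cylinder, so a maximum on an open
    branch is impossible.\<close>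
  define L where "L = max L1 B"
  have L: "L1 \<le> L" "B \<le> L" "0 < L" using L1(1) by (auto simp: L_def)
  let ?\<Phi> = "\<lambda>z. G z - L * height (snd z)"
  have "usc_on ?K ?\<Phi>" by (intro usc_on_diff uscG continuous_intros)
  moreover have "(t0, X0) \<in> ?K" using r X0 by (auto simp: cyl_def height_eq_0_iff[symmetric])
  ultimately obtain z where z: "z \<in> ?K" "\<forall>w\<in>?K. ?\<Phi> w \<le> ?\<Phi> z"
    using usc_on_attains_max[OF compact_cyl, of t0 "tang X0" r r ?\<Phi>] by blast
  obtain t X where tX: "z = (t, X)" by (cases z)
  have "?\<Phi> z \<le> bar"
  proof (cases "z \<in> ?E")
    case True
    from L1(2)[rule_format, OF this L(1)] show ?thesis by simp
  next
    case False
    then have ins: "\<bar>t - t0\<bar> < r" "norm (tang X - tang X0) < r" "height X < r"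
      using z(1) by (auto simp: m_def tX)
    show ?thesis
    proof (cases rule: branch_cases[of X])
      case 1
      then have "U (t, X) - \<tau> t - f (tang X) \<le> bar"
        unfolding bar_def using z Kd tX by (intro max) auto
      moreover have h0: "height X = 0" using 1 by (simp add: height_eq_0_iff)
      ultimately show ?thesis
        using zero_le_power2[of "t - t0"] zero_le_power2[of "norm (tang X - tang X0)"]
        unfolding tX G snd_conv h0 by linarith
    next
      case (2 i)
      have "loc_max ?\<Phi> (t, X)"
        by (rule loc_max_cyl[of t0 "tang X0" r r]) (use z(2) tX ins in auto)
      then have "loc_max (\<lambda>z. U z - sep ?\<tau> ?f (\<lambda>(i :: 'n) r. L * r) z) (t, X)"
        by (simp only: sepM)
      moreover have "0 < t" "t < T" using z(1) KJ tX by auto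
      ultimately have "?\<tau>' t + H i (?f' (tang X), L) \<le> 0"
        using U C1'[of L] 2 unfolding sub_sep_def by blast
      moreover have "c < H i (?f' (tang X), L)"
        using B(2) L(2) abs_snd_le[of L "?f' (tang X)"] by fastforce
      moreover have "- ?\<tau>' t \<le> c"
        using c ins(1) by (auto simp: abs_le_iff abs_less_iff dest!: bspec[of _ _ "?\<tau>' t"])
      ultimately show ?thesis by linarith
    qed
  qed
  then have fin: "G (t, X) - L * height X \<le> bar" if "(t, X) \<in> ?K" for t X
    using z(2) that by fastforce
  show ?thesis
    using L(3) r fin unfolding G bar_def by (intro exI[of _ L] exI[of _ r] conjI) (auto simp: algebra_simps)
qed

text \<open>Maximality along the interface alone suffices: the cone of \<open>upper_cone\<close>
  turns it into a full local maximum, and whatever its slope is, the flux-limited Hamiltonian is at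
  least A.\<close>

lemma limiter_bound:
  fixes U :: "real \<times> ('a::finite_dim_inner, 'n::finite) junction \<Rightarrow> real"
  assumes usc: "usc_on (dom0 T) U" and U: "sub_sep H A T U" and coer: "\<And>i. coercive (H i)"
    and C1: "sep_C1 T \<tau> \<tau>' f f' (\<lambda>(i :: 'n) _. 0) (\<lambda>_ _. 0)"
    and t0: "0 < t0" "t0 < T" and X0: "X0 \<in> interface"
    and max: "\<And>t X. (t, X) \<in> dom0 T \<Longrightarrow> X \<in> interface \<Longrightarrow>
       U (t, X) - \<tau> t - f (tang X) \<le> U (t0, X0) - \<tau> t0 - f (tang X0)"
  shows "\<tau>' t0 + A (f' (tang X0)) \<le> 0"
proof -
  obtain L r where L: "0 < r" and cone: "\<forall>(t, X)\<in>cyl t0 (tang X0) r r. U (t, X) - \<tau> t - f (tang X)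
      \<le> U (t0, X0) - \<tau> t0 - f (tang X0) + (t - t0)\<^sup>2 + (norm (tang X - tang X0))\<^sup>2 + L * height X"
    using upper_cone[OF usc U coer C1 t0 X0 max] by blast
  let ?\<tau> = "\<lambda>t. \<tau> t + 1 * (t - t0)\<^sup>2" and ?\<tau>' = "\<lambda>t. \<tau>' t + 2 * 1 * (t - t0)"
  let ?f = "\<lambda>x. f x + 1 * (norm (x - tang X0))\<^sup>2"
    and ?f' = "\<lambda>x. f' x + (2 * 1) *\<^sub>R (x - tang X0)"
  have C1': "sep_C1 T ?\<tau> ?\<tau>' ?f ?f' (\<lambda>(i :: 'n) r. L * r) (\<lambda>i r. L)"
    by (rule sep_C1_perturb[OF C1])
  have h0: "height X0 = 0" using X0 by (simp add: height_eq_0_iff)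
  have "loc_max (\<lambda>z. U z - sep ?\<tau> ?f (\<lambda>(i :: 'n) r. L * r) z) (t0, X0)"
  proof (rule loc_max_cyl[of t0 "tang X0" r r])
    fix z :: "real \<times> ('a, 'n) junction" assume "z \<in> cyl t0 (tang X0) r r"
    moreover obtain t X where tX: "z = (t, X)" by (cases z)
    moreover have "(\<Sum>i\<in>UNIV. L * nrm X i) = L * height X" "(\<Sum>i\<in>UNIV. L * nrm X0 i) = 0"
      using h0 by (simp_all add: height_def flip: sum_distrib_left)
    ultimately show "U z - sep ?\<tau> ?f (\<lambda>i. (*) L) z \<le> U (t0, X0) - sep ?\<tau> ?f (\<lambda>i. (*) L) (t0, X0)"
      using cone by (auto simp: sep_def)
  qed (use L h0 in auto)
  then have "?\<tau>' t0 + F_lim H A (?f' (tang X0)) (\<lambda>i. L) \<le> 0"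
    using U C1' t0 X0 unfolding sub_sep_def by blast
  then show ?thesis using A_le_F_lim[of A "f' (tang X0)" H "\<lambda>i. L"] by simp
qed

text \<open>Inadmissibility of the whole half-line r \<le> q survives small changes of the time and
  tangential slopes: coercivity settles very negative r, uniform continuity on a compact set the
  rest.\<close>

lemma slope_nbhd:
  fixes H :: "'a::finite_dim_inner \<times> real \<Rightarrow> real"
  assumes H: "continuous_on UNIV H" "coercive H" and pos: "\<And>r. r \<le> q \<Longrightarrow> 0 < H (p0, r) + a0"
  shows "\<exists>\<sigma>>0. \<forall>a p r. \<bar>a - a0\<bar> \<le> \<sigma> \<longrightarrow> norm (p - p0) \<le> \<sigma> \<longrightarrow> r \<le> q \<longrightarrow> 0 < H (p, r) + a"
proof -
  obtain B where B: "0 < B" "\<And>p. B \<le> norm p \<Longrightarrow> 1 - a0 < H p"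
    using coercive_bound[OF H(2)] by metis
  let ?P = "{p :: 'a. norm (p - p0) \<le> 1}" and ?I = "{-B - \<bar>q\<bar>..q}"
  have "norm p \<le> 1 + norm p0" if "norm (p - p0) \<le> 1" for p
    using norm_triangle_ineq2[of p p0] that by linarith
  then have "?P \<subseteq> {p. norm p \<le> 1 + norm p0}" by blast
  moreover have "closed ?P" by (intro closed_Collect_le continuous_intros)
  ultimately have cP: "compact (?P \<times> ?I)"
    using compact_closed_subset[OF compact_cball_finite_dim] by (intro compact_Times compact_Icc) blast
  have "continuous_on (?P \<times> ?I) H" using H(1) continuous_on_subset by blast
  then have uc: "uniformly_continuous_on (?P \<times> ?I) H" using cP by (rule compact_uniformly_continuous)
  have "?I \<noteq> {}" using B(1) by (auto simp: abs_if)
  then obtain m where m: "m \<in> ?I" "\<forall>r\<in>?I. H (p0, m) \<le> H (p0, r)"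
    using continuous_attains_inf[OF compact_Icc _ continuous_on_slice[OF H(1), of ?I p0]] by blast
  define \<mu> where "\<mu> = H (p0, m) + a0"
  have \<mu>: "0 < \<mu>" using m(1) pos by (auto simp: \<mu>_def)
  then obtain d where d: "0 < d" "\<forall>x\<in>?P \<times> ?I. \<forall>x'\<in>?P \<times> ?I. dist x' x < d \<longrightarrow> dist (H x') (H x) < \<mu> / 2"
    using uc unfolding uniformly_continuous_on_def by (metis half_gt_zero)
  \<comment> \<open>The minimum \<mu> is split into one half for the change of H and one for the
    change of a. The bound 1/2 stays below the margin 1 that coercivity provides for very negative
    r.\<close>
  define \<sigma> where "\<sigma> = min (min (1/2) (\<mu> / 2)) (d / 2)"
  have \<sigma>: "0 < \<sigma>" "\<sigma> \<le> 1/2" "\<sigma> \<le> \<mu> / 2" "\<sigma> < d" using \<mu> d(1) by (auto simp: \<sigma>_def)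
  have "0 < H (p, r) + a" if a: "\<bar>a - a0\<bar> \<le> \<sigma>" and p: "norm (p - p0) \<le> \<sigma>" and r: "r \<le> q" for a p r
  proof (cases "r \<in> ?I")
    case True
    have "(p, r) \<in> ?P \<times> ?I" "(p0, r) \<in> ?P \<times> ?I" using True p \<sigma> by auto
    moreover have "dist (p, r) (p0, r) < d" using p \<sigma> by (simp add: dist_prod_def dist_norm)
    ultimately have "dist (H (p, r)) (H (p0, r)) < \<mu> / 2" using d(2) by blast
    moreover have "H (p0, m) \<le> H (p0, r)" using m(2) True by blast
    ultimately show ?thesis using a \<sigma>(3) \<mu>_def unfolding dist_real_def abs_less_iff abs_le_iff
      by (elim conjE) linarith
  next
    case False
    then have "B \<le> norm (p, r)" using r abs_snd_le[of r p] unfolding atLeastAtMost_iff by linarith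
    then have "1 - a0 < H (p, r)" by (rule B(2))
    then show ?thesis using a \<sigma> by linarith
  qed
  then show ?thesis using \<sigma>(1) by blast
qed

text \<open>
  The tangential displacement is at most proportional to the distance from the interface, which
  keeps the cross term of the quadratic penalization negligible in \<open>no_interface_max\<close>.
\<close>

lemma lower_slope:
  fixes U :: "real \<times> ('a::finite_dim_inner, 'n::finite) junction \<Rightarrow> real"
  assumes usc: "usc_on (dom0 T) U" and U: "sub_sep H A T U"
    and H: "\<And>i. continuous_on UNIV (H i)" "\<And>i. coercive (H i)"
    and C1: "sep_C1 T \<tau> \<tau>' f f' (\<lambda>(i :: 'n) _. 0) (\<lambda>_ _. 0)"
    and t0: "0 < t0" "t0 < T" and X0: "X0 \<in> interface"
    and max: "\<And>t X. (t, X) \<in> dom0 T \<Longrightarrow> X \<in> interface \<Longrightarrow>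
       U (t, X) - \<tau> t - f (tang X) \<le> U (t0, X0) - \<tau> t0 - f (tang X0)"
    and q: "\<And>r. r \<le> q \<Longrightarrow> 0 < H i (f' (tang X0), r) + \<tau>' t0"
  shows "\<exists>K>0. \<exists>y1>0. \<forall>y. 0 < y \<and> y \<le> y1 \<longrightarrow> (\<exists>t X. (t, X) \<in> dom0 T \<and> X \<in> branch i \<and> nrm X i = y \<and>
     \<bar>t - t0\<bar> \<le> K * y \<and> norm (tang X - tang X0) \<le> K * y \<and>
     U (t0, X0) - \<tau> t0 - f (tang X0) + q * y \<le> U (t, X) - \<tau> t - f (tang X))"
proof -
  define a0 where "a0 = \<tau>' t0"
  define x0 where "x0 = tang X0"
  define p0 where "p0 = f' x0"
  define bar where "bar = U (t0, X0) - \<tau> t0 - f x0"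
  obtain L r where L: "0 < L" "0 < r" "r < t0" "r < T - t0" and
    cone: "\<forall>(t, X)\<in>cyl t0 x0 r r. U (t, X) - \<tau> t - f (tang X)
      \<le> bar + (t - t0)\<^sup>2 + (norm (tang X - x0))\<^sup>2 + L * height X"
    using upper_cone[OF usc U H(2) C1 t0 X0 max] unfolding bar_def x0_def by blast
  obtain \<sigma>0 where \<sigma>0: "0 < \<sigma>0"
    "\<forall>a p r. \<bar>a - a0\<bar> \<le> \<sigma>0 \<longrightarrow> norm (p - p0) \<le> \<sigma>0 \<longrightarrow> r \<le> q \<longrightarrow> 0 < H i (p, r) + a"
    using slope_nbhd[OF H, of q i p0 a0] q unfolding a0_def p0_def x0_def by blast
  obtain B where B: "0 < B" "\<forall>j p. B \<le> norm p \<longrightarrow> 1 - a0 < H j p"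
    using coercive_bound_uniform[of H "1 - a0", OF H(2)] by blast
  \<comment> \<open>Slope used on the other branches: above the cone slope L, so that their lids are
    not reached, and so steep that coercivity excludes maxima at their interior points.\<close>
  define M where "M = max (L + 1) B"
  have M: "L + 1 \<le> M" "B \<le> M" "0 < M" using L(1) by (auto simp: M_def)
  define \<sigma> where "\<sigma> = min \<sigma>0 (1/2)"
  have \<sigma>: "0 < \<sigma>" "\<sigma> \<le> \<sigma>0" "\<sigma> \<le> 1/2" using \<sigma>0 by (auto simp: \<sigma>_def)
  define D where "D = L + \<bar>q\<bar> + M + 2"
  have D: "0 < D" using L M by (simp add: D_def)
  define K where "K = 4 * D / \<sigma>"
  have K: "0 < K" using D \<sigma> by (simp add: K_def)
  define \<rho> where "\<rho> = D / K\<^sup>2"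
  have \<rho>: "0 < \<rho>" "\<rho> * K\<^sup>2 = D" using D K by (auto simp: \<rho>_def)
  have \<rho>K: "2 * \<rho> * K = \<sigma> / 2"
  proof -
    have "2 * \<rho> * K = 2 * D / K" using K by (simp add: \<rho>_def power2_eq_square field_simps)
    also have "\<dots> = \<sigma> / 2" using D \<sigma> by (simp add: K_def)
    finally show ?thesis .
  qed
  have "continuous_on {0<..<T} \<tau>'" using C1 by (simp add: sep_C1_def)
  then have "isCont \<tau>' t0" using t0 by (simp add: continuous_on_eq_continuous_at)
  then obtain d1 where d1: "0 < d1" "\<And>t. \<bar>t - t0\<bar> < d1 \<Longrightarrow> \<bar>\<tau>' t - a0\<bar> < \<sigma> / 2"
    using \<sigma>(1) unfolding continuous_at_eps_delta a0_def by (metis half_gt_zero dist_real_def)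
  have "continuous_on UNIV f'" using C1 by (simp add: sep_C1_def)
  then have "isCont f' x0" by (simp add: continuous_on_eq_continuous_at)
  then obtain d2 where d2: "0 < d2" "\<And>x. norm (x - x0) < d2 \<Longrightarrow> norm (f' x - p0) < \<sigma> / 2"
    using \<sigma>(1) unfolding continuous_at_eps_delta p0_def by (metis half_gt_zero dist_norm)
  \<comment> \<open>Keeps the cylinder inside that of the cone estimate and inside the ranges where
    \<tau>' and f' vary by less than \<sigma>/2. The last entry makes the quadratic remainder of the
    cone at most y/2.\<close>
  define y1 where "y1 = min (min (r / K) r) (min (min (d1 / (2 * K)) (d2 / (2 * K))) (1 / (4 * K\<^sup>2)))"
  have y1: "0 < y1" using L K d1 d2 by (simp add: y1_def)
  have "\<exists>t X. (t, X) \<in> dom0 T \<and> X \<in> branch i \<and> nrm X i = y \<and>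
     \<bar>t - t0\<bar> \<le> K * y \<and> norm (tang X - x0) \<le> K * y \<and> bar + q * y \<le> U (t, X) - \<tau> t - f (tang X)"
    if y: "0 < y" "y \<le> y1" for y
  proof (rule ccontr)
    assume none: "\<not> ?thesis"
    have yb: "K * y \<le> r" "y \<le> r" "K * y < d1" "K * y < d2" "4 * K\<^sup>2 * y \<le> 1"
    proof -
      have "y \<le> r / K" "y \<le> r" "y \<le> d1 / (2 * K)" "y \<le> d2 / (2 * K)" "y \<le> 1 / (4 * K\<^sup>2)"
        using y(2) by (auto simp: y1_def)
      then have "K * y \<le> r" "y \<le> r" "2 * (K * y) \<le> d1" "2 * (K * y) \<le> d2" "4 * K\<^sup>2 * y \<le> 1"
        using K by (auto simp: field_simps)
      moreover have "0 < K * y" using K y by simp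
      ultimately show "K * y \<le> r" "y \<le> r" "K * y < d1" "K * y < d2" "4 * K\<^sup>2 * y \<le> 1"
        by linarith+
    qed
    let ?K = "cyl t0 x0 (K * y) y :: (real \<times> ('a, 'n) junction) set"
    have Kcyl: "?K \<subseteq> cyl t0 x0 r r" using yb by (auto simp: cyl_def)
    have KJ: "?K \<subseteq> {0<..<T} \<times> UNIV" using yb L by (intro cyl_subset) auto
    have Kd: "?K \<subseteq> dom0 T" using KJ JT_subset_dom0 by (rule order_trans)
    define c where "c = \<rho> / y"
    have c: "0 < c" "c * y = \<rho>" using \<rho> y by (auto simp: c_def)
    let ?\<tau> = "\<lambda>t. \<tau> t + c * (t - t0)\<^sup>2" and ?\<tau>' = "\<lambda>t. \<tau>' t + 2 * c * (t - t0)"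
    let ?f = "\<lambda>x. f x + c * (norm (x - x0))\<^sup>2" and ?f' = "\<lambda>x. f' x + (2 * c) *\<^sub>R (x - x0)"
    \<comment> \<open>The candidate slope q is tried on J_i, with steep slopes elsewhere. If no
      point at height y satisfied the claim, the resulting maximum would be inside the
      cylinder.\<close>
    define S where "S j = (if j = i then q else M)" for j
    have C1': "sep_C1 T ?\<tau> ?\<tau>' ?f ?f' (\<lambda>j r. S j * r) (\<lambda>j r. S j)"
      by (rule sep_C1_perturb[OF C1])
    define \<Psi> where "\<Psi> z = U z - sep ?\<tau> ?f (\<lambda>j r. S j * r) z" for z
    have \<Psi>: "\<Psi> (t, X) = U (t, X) - \<tau> t - f (tang X) - c * ((t - t0)\<^sup>2 + (norm (tang X - x0))\<^sup>2) - S j * nrm X j"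
      if "X \<in> branch j" for t X j
      using sum_branch[OF that, of S] by (simp add: \<Psi>_def sep_def algebra_simps)
    have \<Psi>0: "\<Psi> (t0, X0) = bar"
      using \<Psi>[of X0 i t0] X0 by (simp add: bar_def x0_def interface_nrm branch_def)
    have "usc_on ?K \<Psi>"
      unfolding \<Psi>_def
      by (rule usc_on_diff_sep[OF usc_on_subset[OF usc Kd] KJ]) (use sep_C1_continuous_on[OF C1'] in auto)
    moreover have z0: "(t0, X0) \<in> ?K"
    proof -
      have "height X0 = 0" using X0 by (simp add: height_eq_0_iff)
      then show ?thesis using K y by (simp add: cyl_def x0_def)
    qed
    ultimately obtain z where z: "z \<in> ?K" "\<forall>w\<in>?K. \<Psi> w \<le> \<Psi> z"
      using usc_on_attains_max[OF compact_cyl, of t0 x0 "K * y" y \<Psi>] by blast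
    obtain t X where tX: "z = (t, X)" by (cases z)
    have ge: "bar \<le> \<Psi> (t, X)" using z(2) z0 \<Psi>0 tX by force
    have "X \<in> (\<Union>j. branch j)" by (simp add: Union_branch)
    then obtain j where j: "X \<in> branch j" by auto
    define h where "h = nrm X j"
    have h: "0 \<le> h" "h \<le> y" "height X = h"
      using z(1) tX height_branch[OF j] by (auto simp: h_def nrm_nonneg cyl_def)
    define s where "s = (t - t0)\<^sup>2 + (norm (tang X - x0))\<^sup>2"
    have box: "\<bar>t - t0\<bar> \<le> K * y" "norm (tang X - x0) \<le> K * y" using z(1) tX by (auto simp: cyl_def)
    have "(t - t0)\<^sup>2 \<le> (K * y)\<^sup>2" "(norm (tang X - x0))\<^sup>2 \<le> (K * y)\<^sup>2"
      using power_mono[OF box(1), of 2] power_mono[OF box(2), of 2] by auto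
    then have "s \<le> 2 * (K * y)\<^sup>2" by (simp add: s_def)
    also have "\<dots> = (4 * K\<^sup>2 * y) * y / 2" by (simp add: power2_eq_square)
    also have "\<dots> \<le> y / 2" using mult_right_mono[OF yb(5), of y] y by linarith
    finally have s: "s \<le> y / 2" "0 \<le> s" by (simp_all add: s_def)
    have Uc: "U (t, X) - \<tau> t - f (tang X) \<le> bar + s + L * h"
      using cone z(1) Kcyl tX h(3) unfolding s_def by fastforce
    have \<Psi>z: "\<Psi> (t, X) = U (t, X) - \<tau> t - f (tang X) - c * s - S j * h"
      using \<Psi>[OF j] by (simp add: s_def h_def)
    \<comment> \<open>On the lateral boundary the penalty is at least D y, more than the cone
      allows.\<close>
    have ins: "\<bar>t - t0\<bar> < K * y \<and> norm (tang X - x0) < K * y"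
    proof (rule ccontr)
      assume "\<not> ?thesis"
      then have "(K * y)\<^sup>2 = (t - t0)\<^sup>2 \<or> (K * y)\<^sup>2 = (norm (tang X - x0))\<^sup>2"
        using box by (auto simp: not_less intro: arg_cong[of _ _ "\<lambda>x. x\<^sup>2"] power2_abs)
      then have "(K * y)\<^sup>2 \<le> s" by (auto simp: s_def)
      then have "c * (K * y)\<^sup>2 \<le> c * s" using c by (intro mult_left_mono) auto
      moreover have "c * (K * y)\<^sup>2 = (c * y) * K\<^sup>2 * y" by (simp add: power2_eq_square)
      ultimately have "D * y \<le> c * s" using c(2) \<rho>(2) by simp
      moreover have "- S j * h \<le> (\<bar>q\<bar> + M) * y"
      proof -
        have "- S j * h \<le> (\<bar>q\<bar> + M) * h" using h(1) M(3) by (intro mult_right_mono) (auto simp: S_def)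
        also have "\<dots> \<le> (\<bar>q\<bar> + M) * y" using h(2) M(3) by (intro mult_left_mono) auto
        finally show ?thesis .
      qed
      moreover have "L * h \<le> L * y" using h(2) L(1) by simp
      ultimately show False using ge Uc \<Psi>z s(1) y(1) by (simp add: D_def algebra_simps)
    qed
    \<comment> \<open>The lid is excluded on J_i by the assumption that the claim fails, and on the
      other branches by M > L.\<close>
    have "h \<noteq> y"
    proof
      assume hy: "h = y"
      have cs: "0 \<le> c * s" using c s by simp
      show False
      proof (cases "j = i")
        case True
        have "\<not> bar + q * y \<le> U (t, X) - \<tau> t - f (tang X)"
          using none j box Kd z(1) tX hy True unfolding h_def by blast
        then show False using ge \<Psi>z cs hy True by (simp add: S_def)
      next
        case False
        have "(L + 1) * y \<le> M * y" using M y by (intro mult_right_mono) auto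
        then show False using ge \<Psi>z Uc cs hy False s(1) y(1) by (simp add: S_def algebra_simps)
      qed
    qed
    then have "height X < y" using h by simp
    then have "loc_max \<Psi> (t, X)"
      using z(2) tX ins by (intro loc_max_cyl[of t0 x0 "K * y" y]) auto
    then have lm: "loc_max (\<lambda>z. U z - sep ?\<tau> ?f (\<lambda>j r. S j * r) z) (t, X)"
      by (simp add: \<Psi>_def[abs_def])
    have tT: "0 < t" "t < T" using z(1) KJ tX by auto
    have cy: "2 * c * (K * y) = \<sigma> / 2"
      using \<rho>K c(2) by (simp add: mult.assoc mult.left_commute)
    have "\<bar>2 * c * (t - t0)\<bar> \<le> 2 * c * (K * y)"
      unfolding abs_mult using c(1) box(1) by simp
    moreover have "\<bar>\<tau>' t - a0\<bar> < \<sigma> / 2" using d1(2) box(1) yb(3) by simp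
    ultimately have a: "\<bar>?\<tau>' t - a0\<bar> \<le> \<sigma>" using cy by linarith
    have "norm ((2 * c) *\<^sub>R (tang X - x0)) \<le> 2 * c * (K * y)" using c(1) box(2) by simp
    moreover have "norm (f' (tang X) - p0) < \<sigma> / 2" using d2(2) box(2) yb(4) by simp
    ultimately have p: "norm (?f' (tang X) - p0) \<le> \<sigma>"
      using norm_triangle_ineq[of "f' (tang X) - p0" "(2 * c) *\<^sub>R (tang X - x0)"] cy
      by (simp add: algebra_simps)
    have *: "(\<forall>k. X \<in> branch k - interface \<longrightarrow> ?\<tau>' t + H k (?f' (tang X), S k) \<le> 0) \<and>
      (X \<in> interface \<longrightarrow> ?\<tau>' t + F_lim H A (?f' (tang X)) S \<le> 0)"
      using U C1' tT lm unfolding sub_sep_def by blast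
    \<comment> \<open>Total slope error at most \<sigma>, so every slope up to q remains
      inadmissible. This excludes J_i, and also the interface, because H_i^- at q is a value of H_i
      at such a slope.\<close>
    have Hi: "0 < H i (?f' (tang X), r) + ?\<tau>' t" if "r \<le> q" for r
      using \<sigma>0(2)[rule_format, OF order_trans[OF a \<sigma>(2)] order_trans[OF p \<sigma>(2)] that] .
    show False
    proof (cases rule: branch_cases[of X])
      case 1
      from H_minus_eq[of q "H i" "?f' (tang X)"]
      obtain r where "r \<le> q" "H_minus (H i) (?f' (tang X)) q = H i (?f' (tang X), r)"
        by (elim exE conjE)
      then have "0 < H_minus (H i) (?f' (tang X)) (S i) + ?\<tau>' t" using Hi by (simp add: S_def)
      then show False
        using * 1 H_minus_le_F_lim[of H i "?f' (tang X)" S A] by linarith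
    next
      case (2 k)
      show False
      proof (cases "k = i")
        case True
        then show False using * 2 Hi[of q] by (auto simp: S_def)
      next
        case False
        have "1 - a0 < H k (?f' (tang X), M)"
          using B(2)[rule_format, of "(?f' (tang X), M)" k] M(2,3) abs_snd_le[of M "?f' (tang X)"] by linarith
        moreover have "?\<tau>' t + H k (?f' (tang X), M) \<le> 0" using * 2 False by (auto simp: S_def)
        ultimately show False using a \<sigma>(3) by linarith
      qed
    qed
  qed
  then show ?thesis using K y1 unfolding bar_def x0_def by blast
qed

section \<open>Doubling the tangential variables\<close>

text \<open>One template for the test functions of the doubling argument: two quadratic terms
  (coupling to the other point and localization), blow-up at T, growth at infinity and a linear
  normal part. Instances set absent coefficients to 0 and reverse signs for the
  supersolution.\<close>

lemma sep_C1_pen: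
  fixes j1 j2 j3 j4 :: "'n::finite \<Rightarrow> real" and x0 x1 :: "'a::finite_dim_inner"
  shows "sep_C1 T (\<lambda>t. k1 * (t - t1)\<^sup>2 + k2 / (T - t) + k3 * (t - t0)\<^sup>2)
    (\<lambda>t. 2 * k1 * (t - t1) + k2 / (T - t)\<^sup>2 + 2 * k3 * (t - t0))
    (\<lambda>x. m1 * (norm (x - x1))\<^sup>2 + m2 * smooth_norm 1 x + m3 * (norm (x - x0))\<^sup>2)
    (\<lambda>x. (2 * m1) *\<^sub>R (x - x1) + m2 *\<^sub>R smooth_norm_grad 1 x + (2 * m3) *\<^sub>R (x - x0))
    (\<lambda>i r. j1 i * smooth_norm 1 r + j2 i * (r - r1)\<^sup>2 + j3 i * (r - r0)\<^sup>2 + j4 i * r)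
    (\<lambda>i r. j1 i * smooth_norm_grad 1 r + 2 * j2 i * (r - r1) + 2 * j3 i * (r - r0) + j4 i)"
  unfolding sep_C1_def
proof (intro conjI ballI allI)
  have sq: "((\<lambda>t. k * (t - c)\<^sup>2) has_real_derivative 2 * k * (t - c)) (at t)" for k c t :: real
    by (auto intro!: derivative_eq_intros)
  show "((\<lambda>t. k1 * (t - t1)\<^sup>2 + k2 / (T - t) + k3 * (t - t0)\<^sup>2) has_real_derivative
      2 * k1 * (t - t1) + k2 / (T - t)\<^sup>2 + 2 * k3 * (t - t0)) (at t)" if "t \<in> {0<..<T}" for t
    by (intro DERIV_add sq has_real_derivative_blowup) (use that in auto)
  show "continuous_on {0<..<T} (\<lambda>t. 2 * k1 * (t - t1) + k2 / (T - t)\<^sup>2 + 2 * k3 * (t - t0))"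
    by (intro continuous_intros) auto
  show "((\<lambda>x. m1 * (norm (x - x1))\<^sup>2 + m2 * smooth_norm 1 x + m3 * (norm (x - x0))\<^sup>2) has_derivative
      (\<lambda>h. ((2 * m1) *\<^sub>R (x - x1) + m2 *\<^sub>R smooth_norm_grad 1 x + (2 * m3) *\<^sub>R (x - x0)) \<bullet> h)) (at x)" for x
  proof -
    have "((\<lambda>x :: 'a. smooth_norm 1 x) has_derivative (\<lambda>h. smooth_norm_grad 1 x \<bullet> h)) (at x)"
      using has_derivative_smooth_norm[of 1 0 x] by simp
    then have "((\<lambda>x. m2 * smooth_norm 1 x) has_derivative (\<lambda>h. (m2 *\<^sub>R smooth_norm_grad 1 x) \<bullet> h)) (at x)"
      unfolding inner_scaleR_left by (rule has_derivative_mult_right)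
    from has_derivative_add[OF has_derivative_add[OF has_derivative_square_norm[of m1 x1 x] this]
        has_derivative_square_norm[of m3 x0 x]]
    show ?thesis unfolding inner_add_left .
  qed
  show "continuous_on UNIV (\<lambda>x. (2 * m1) *\<^sub>R (x - x1) + m2 *\<^sub>R smooth_norm_grad 1 x + (2 * m3) *\<^sub>R (x - x0))"
    by (intro continuous_intros continuous_on_smooth_norm_grad) simp
  show "((\<lambda>r. j1 i * smooth_norm 1 r + j2 i * (r - r1)\<^sup>2 + j3 i * (r - r0)\<^sup>2 + j4 i * r) has_real_derivative
      j1 i * smooth_norm_grad 1 r + 2 * j2 i * (r - r1) + 2 * j3 i * (r - r0) + j4 i) (at r)" for i r
    using has_real_derivative_smooth_norm[of 1 0 r]
    by (intro DERIV_add sq DERIV_cmult_Id DERIV_cmult) simp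
  show "continuous_on UNIV (\<lambda>r. j1 i * smooth_norm_grad 1 r + 2 * j2 i * (r - r1) + 2 * j3 i * (r - r0) + j4 i)" for i
    by (intro continuous_intros continuous_on_smooth_norm_grad) simp
qed

text \<open>q is the least element of {r. H (p, r) \<le> c}, nonempty as c exceeds the minimum and
  bounded below by coercivity. Continuity excludes H (p, q) < c, so even q itself stays above
  c'.\<close>

lemma critical_slope:
  fixes H :: "'a::real_normed_vector \<times> real \<Rightarrow> real"
  assumes H: "continuous_on UNIV H" "coercive H" and c: "A_min H p < c" "c' < c"
  shows "\<exists>q. (\<forall>r\<le>q. c' < H (p, r)) \<and> H (p, q) \<le> c"
proof -
  let ?M = "{r. H (p, r) \<le> c}"
  obtain B where B: "0 < B" "\<And>p. B \<le> norm p \<Longrightarrow> c < H p"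
    using coercive_bound[OF H(2)] by metis
  have "\<exists>x\<in>range (\<lambda>q. H (p, q)). x < c" using c(1) unfolding A_min_def by (intro cInf_lessD) auto
  then have ne: "?M \<noteq> {}" by (auto intro: less_imp_le)
  have "- B \<le> r" if "r \<in> ?M" for r
    using B(2)[of "(p, r)"] abs_snd_le[of r p] that by (cases "B \<le> norm (p, r)") auto
  then have bdd: "bdd_below ?M" by (intro bdd_belowI) auto
  have cl: "closed ?M" by (intro closed_Collect_le continuous_on_slice H continuous_intros)
  define q where "q = Inf ?M"
  have q: "q \<in> ?M" unfolding q_def by (rule closed_contains_Inf[OF ne bdd cl])
  have less: "c < H (p, r)" if "r < q" for r
    using cInf_lower[OF _ bdd, of r] that unfolding q_def by (cases "H (p, r) \<le> c") auto
  have "c' < H (p, q)"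
  proof (rule ccontr)
    assume "\<not> ?thesis"
    then have "H (p, q) < c" using c(2) by simp
    moreover have "isCont (\<lambda>r. H (p, r)) q"
      using continuous_on_slice[OF H(1), of UNIV p] by (simp add: continuous_on_eq_continuous_at)
    ultimately obtain d where d: "0 < d" "\<forall>x'. dist x' q < d \<longrightarrow> dist (H (p, x')) (H (p, q)) < c - H (p, q)"
      unfolding continuous_at_eps_delta by (metis diff_gt_0_iff_gt)
    then have "dist (H (p, q - d / 2)) (H (p, q)) < c - H (p, q)" by (simp add: dist_real_def)
    then have "H (p, q - d / 2) < c" by (simp add: dist_real_def)
    then show False using less[of "q - d / 2"] d(1) by simp
  qed
  then have "\<forall>r\<le>q. c' < H (p, r)" using less c(2) by (metis less_trans order_le_less)
  then show ?thesis using q by blast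
qed

text \<open>The penalization has zero slope at 0, so leaving the interface changes it only to second
  order.\<close>

lemma smooth_norm_1_le: "smooth_norm 1 r \<le> 1 + (r :: real)\<^sup>2"
proof -
  have "1 + r\<^sup>2 \<le> (1 + r\<^sup>2)\<^sup>2" using self_le_power[of "1 + r\<^sup>2" 2] by simp
  then show ?thesis unfolding smooth_norm_def by (intro real_le_lsqrt) auto
qed

section \<open>Points and boxes inside one branch\<close>

lemma branch_nrm_eqI:
  assumes "X \<in> branch i" "Y \<in> branch i" "nrm X i = nrm Y i"
  shows "nrm X = nrm Y"
proof
  show "nrm X j = nrm Y j" for j using assms by (cases "j = i") (auto simp: branch_def)
qed

lemma sum_single:
  fixes G :: "'n::finite \<Rightarrow> real"
  assumes "\<And>j. j \<noteq> i \<Longrightarrow> G j = 0"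
  shows "(\<Sum>j\<in>UNIV. G j) = G i"
proof -
  have "(\<Sum>j\<in>UNIV. G j) = (\<Sum>j\<in>{i}. G j)" by (rule sum.mono_neutral_right) (use assms in auto)
  then show ?thesis by simp
qed

lemma pos_nrm_branch:
  assumes "0 < nrm X i"
  shows "X \<in> branch i - interface"
proof -
  have "nrm X j = 0" if "j \<noteq> i" for j using nrm_unique[of X i j] assms that by auto
  then have "X \<in> branch i" by (simp add: branch_def)
  moreover have "X \<notin> interface" using assms by (metis interface_nrm less_irrefl)
  ultimately show ?thesis by blast
qed

text \<open>The condition r < h0 keeps the i-th normal coordinate positive, so the box lies in J_i
  and its height is that coordinate.\<close>

lemma compact_side_box:
  fixes x0 :: "'a::finite_dim_inner" and i :: "'n::finite"
  assumes "r < h0"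
  shows "compact {z :: real \<times> ('a, 'n) junction. \<bar>fst z - t0\<bar> \<le> r \<and> norm (tang (snd z) - x0) \<le> r \<and> \<bar>nrm (snd z) i - h0\<bar> \<le> r}"
    (is "compact ?Q")
proof (rule compact_closed_subset[OF compact_cyl[of t0 x0 r "h0 + r"]])
  show "closed ?Q" by (intro closed_Collect_conj closed_Collect_le continuous_intros)
  show "?Q \<subseteq> cyl t0 x0 r (h0 + r)"
  proof
    fix z assume z: "z \<in> ?Q"
    then have "nrm (snd z) i \<noteq> 0" using assms by auto
    then have "snd z \<in> branch i" by (auto simp: branch_def dest: nrm_unique)
    then have "height (snd z) \<le> h0 + r" using z by (auto simp: height_branch)
    then show "z \<in> cyl t0 x0 r (h0 + r)" using z by (simp add: cyl_def)
  qed
qed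

text \<open>a and b weigh the coupling in time and in tangential position, \<eta> the blow-up at T,
  \<alpha> the growth at infinity. The condition on \<kappa> makes each blow-up term contribute at
  least 4\<kappa> to the time slopes. The condition on \<Lambda> guarantees that the slopes at a
  maximum lie in the sublevel sets on which the modulus \<sigma> is available.\<close>

locale doubling =
  fixes H :: "'n::finite \<Rightarrow> 'a::finite_dim_inner \<times> real \<Rightarrow> real" and A :: "'a \<Rightarrow> real"
    and U V :: "real \<times> ('a, 'n) junction \<Rightarrow> real"
    and T a b \<eta> \<alpha> \<sigma> \<kappa> \<Lambda> :: real
  assumes H: "\<And>i. continuous_on UNIV (H i)" "\<And>i. coercive (H i)"
    and A_min: "\<And>i p. A_min (H i) p \<le> A p"
    and U: "usc_on (dom0 T) U" "sub_sep H A T U"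
    and V: "usc_on (dom0 T) (\<lambda>z. - V z)" "super_sep H A T V"
    and pos: "0 < T" "0 < a" "0 < b" "0 < \<eta>" "0 \<le> \<alpha>" "0 < \<sigma>" "0 < \<kappa>"
    and \<alpha>: "2 * \<alpha> \<le> \<sigma>" and \<kappa>: "4 * \<kappa> \<le> \<eta> / T\<^sup>2" and \<Lambda>: "2 * a * T + 1 + \<kappa> \<le> \<Lambda>"
    and H_uc: "\<And>i p q p' q'. H i (p, q) \<le> \<Lambda> \<Longrightarrow> norm (p - p') \<le> \<sigma> \<Longrightarrow> \<bar>q - q'\<bar> \<le> \<sigma> \<Longrightarrow>
       H i (p', q') \<le> H i (p, q) + \<kappa>"
    and A_uc: "\<And>p p'. A p \<le> \<Lambda> \<Longrightarrow> norm (p - p') \<le> \<sigma> \<Longrightarrow> A p' \<le> A p + \<kappa>"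
begin

text \<open>Only X is penalized at infinity: Y has the same normal coordinates when
  \<open>dbl_pen\<close> is maximized, and its tangential part is tied to that of X by the
  b-term.\<close>

definition dbl :: "real \<Rightarrow> ('a, 'n) junction \<Rightarrow> real \<Rightarrow> ('a, 'n) junction \<Rightarrow> real" where
  "dbl t X s Y = U (t, X) - V (s, Y) - a * (t - s)\<^sup>2 - b * (norm (tang X - tang Y))\<^sup>2
     - \<eta> / (T - t) - \<eta> / (T - s) - \<alpha> * smooth_norm 1 (tang X)"

definition dbl_pen :: "real \<Rightarrow> ('a, 'n) junction \<Rightarrow> real \<Rightarrow> ('a, 'n) junction \<Rightarrow> real" where
  "dbl_pen t X s Y = dbl t X s Y - \<alpha> * (\<Sum>i\<in>UNIV. smooth_norm 1 (nrm X i))"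

lemma blowup_deriv_ge: "0 < t \<Longrightarrow> t < T \<Longrightarrow> 4 * \<kappa> \<le> \<eta> / (T - t)\<^sup>2"
proof -
  assume t: "0 < t" "t < T"
  then have "\<eta> / T\<^sup>2 \<le> \<eta> / (T - t)\<^sup>2"
    using pos by (intro divide_left_mono power_mono mult_pos_pos zero_less_power) auto
  then show ?thesis using \<kappa> by simp
qed

lemma time_slope_ge:
  assumes "0 < t" "t < T" "0 < s" "s < T"
  shows "- (2 * a * T) \<le> 2 * a * (t - s)"
  using mult_left_mono[of "- T" "t - s" "2 * a"] assms pos by simp

text \<open>The supersolution is tested at Y0 with normal slopes slightly below the critical slopes
  of the subsolution. A and every H_i are then smaller than minus the time slope: A by
  \<open>limiter_bound\<close>, H_i by the choice of slopes, both after the passage from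
  \<open>pu\<close> to \<open>pv\<close>.\<close>

lemma no_interface_max:
  assumes t0: "0 < t0" "t0 < T" and s0: "0 < s0" "s0 < T" and X0: "X0 \<in> interface" and Y0: "Y0 \<in> interface"
    and max: "\<And>t X s Y. (t, X) \<in> dom0 T \<Longrightarrow> (s, Y) \<in> dom0 T \<Longrightarrow> nrm X = nrm Y \<Longrightarrow>
       dbl_pen t X s Y \<le> dbl_pen t0 X0 s0 Y0"
  shows False
proof -
  define x0 where "x0 = tang X0"
  define y0 where "y0 = tang Y0"
  \<comment> \<open>Removes the normal penalization at a cost quadratic in the distance from the
    interface.\<close>
  have max': "dbl t X s Y \<le> dbl t0 X0 s0 Y0 + \<alpha> * (nrm X i)\<^sup>2"
    if "(t, X) \<in> dom0 T" "(s, Y) \<in> dom0 T" "X \<in> branch i" "nrm X = nrm Y" for t X s Y i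
  proof -
    have "(\<Sum>j\<in>UNIV. smooth_norm 1 (nrm X j)) \<le> (\<Sum>j\<in>UNIV. smooth_norm 1 (nrm X0 j) + (if j = i then (nrm X i)\<^sup>2 else 0))"
    proof (rule sum_mono)
      fix j
      show "smooth_norm 1 (nrm X j) \<le> smooth_norm 1 (nrm X0 j) + (if j = i then (nrm X i)\<^sup>2 else 0)"
        using X0 that(3) smooth_norm_1_le[of "nrm X i"] by (auto simp: interface_nrm branch_def smooth_norm_def)
    qed
    also have "\<dots> = (\<Sum>j\<in>UNIV. smooth_norm 1 (nrm X0 j)) + (nrm X i)\<^sup>2" by (simp add: sum.distrib)
    finally have "\<alpha> * (\<Sum>j\<in>UNIV. smooth_norm 1 (nrm X j)) \<le> \<alpha> * ((\<Sum>j\<in>UNIV. smooth_norm 1 (nrm X0 j)) + (nrm X i)\<^sup>2)"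
      using pos(5) by (rule mult_left_mono)
    then show ?thesis
      using max[OF that(1,2,4)] by (simp add: dbl_pen_def distrib_left)
  qed
  have dom: "(t0, X0) \<in> dom0 T" "(s0, Y0) \<in> dom0 T" using t0 s0 by (auto simp: dom0_def)
  define au where "au = 2 * a * (t0 - s0) + \<eta> / (T - t0)\<^sup>2"
  define av where "av = 2 * a * (t0 - s0) - \<eta> / (T - s0)\<^sup>2"
  define pv where "pv = (2 * b) *\<^sub>R (x0 - y0)"
  define pu where "pu = pv + \<alpha> *\<^sub>R smooth_norm_grad 1 x0"
  have au_av: "av + 8 * \<kappa> \<le> au"
    using blowup_deriv_ge[OF t0] blowup_deriv_ge[OF s0] by (simp add: au_def av_def)
  have "- (2 * a * T) \<le> au"
    using time_slope_ge[OF t0 s0] blowup_deriv_ge[OF t0] pos(7) unfolding au_def by linarith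
  then have au\<Lambda>: "\<kappa> - au \<le> \<Lambda>" using \<Lambda> by linarith
  have pu_pv: "norm (pu - pv) \<le> \<sigma>"
  proof -
    have "norm (pu - pv) = \<alpha> * norm (smooth_norm_grad 1 x0)" using pos(5) by (simp add: pu_def)
    also have "\<dots> \<le> \<alpha> * 1" using pos(5) norm_smooth_norm_grad_le[of 1 x0] by (intro mult_left_mono) auto
    finally show ?thesis using \<alpha> pos(6) pos(5) by linarith
  qed
  define \<tau> where "\<tau> = (\<lambda>t. a * (t - s0)\<^sup>2 + \<eta> / (T - t) + 0 * (t - 0)\<^sup>2)"
  define \<tau>' where "\<tau>' = (\<lambda>t. 2 * a * (t - s0) + \<eta> / (T - t)\<^sup>2 + 2 * 0 * (t - 0))"
  define f where "f = (\<lambda>x. b * (norm (x - y0))\<^sup>2 + \<alpha> * smooth_norm 1 x + 0 * (norm (x - y0))\<^sup>2)"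
  define f' where "f' = (\<lambda>x. (2 * b) *\<^sub>R (x - y0) + \<alpha> *\<^sub>R smooth_norm_grad 1 x + (2 * 0) *\<^sub>R (x - y0))"
  \<comment> \<open>Test function for the subsolution along the interface, with the second point
    frozen at (s0, Y0).\<close>
  have C1: "sep_C1 T \<tau> \<tau>' f f' (\<lambda>(i :: 'n) _. 0) (\<lambda>_ _. 0)"
    using sep_C1_pen[of T a s0 \<eta> 0 0 b y0 \<alpha> 0 y0 "\<lambda>i :: 'n. 0" "\<lambda>i. 0" 0 "\<lambda>i. 0" 0 "\<lambda>i. 0"]
    unfolding \<tau>_def \<tau>'_def f_def f'_def by simp
  have \<tau>'0: "\<tau>' t0 = au" and f'0: "f' x0 = pu" by (simp_all add: \<tau>'_def au_def f'_def pu_def pv_def)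
  have maxU: "U (t, X) - \<tau> t - f (tang X) \<le> U (t0, X0) - \<tau> t0 - f (tang X0)"
    if "(t, X) \<in> dom0 T" "X \<in> interface" for t X
  proof -
    obtain i :: 'n where True by blast
    have "nrm X = nrm Y0" "X \<in> branch i" "nrm X i = 0"
      using that(2) Y0 by (auto simp: interface_nrm branch_def)
    then have "dbl t X s0 Y0 \<le> dbl t0 X0 s0 Y0"
      using max'[OF that(1) dom(2), of i] by simp
    then show ?thesis by (simp add: dbl_def \<tau>_def f_def y0_def)
  qed
  have A_pu: "au + A pu \<le> 0"
    using limiter_bound[OF U H(2) C1 t0 X0 maxU] by (simp add: \<tau>'0 f'0 flip: x0_def)
  have A_pv: "A pv < - av"
  proof -
    have "A pu \<le> \<Lambda>" using A_pu au\<Lambda> pos(7) by linarith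
    then have "A pv \<le> A pu + \<kappa>" using pu_pv by (rule A_uc)
    then show ?thesis using A_pu au_av pos(7) by linarith
  qed
  \<comment> \<open>q is critical for H_i at \<open>pu\<close>. At \<open>pv\<close> it is still
    strictly below -av thanks to the 8\<kappa> gap, so continuity leaves room for a smaller q'; the
    difference q - q' will absorb the errors linear in the height.\<close>
  have "\<exists>q q'. (\<forall>r\<le>q. 0 < H i (pu, r) + au) \<and> q' < q \<and> H i (pv, q') < - av" for i
  proof -
    have "A_min (H i) pu < \<kappa> - au" using A_min[of i pu] A_pu pos(7) by linarith
    then obtain q where q: "\<forall>r\<le>q. - au < H i (pu, r)" "H i (pu, q) \<le> \<kappa> - au"
      using critical_slope[OF H, of i pu "\<kappa> - au" "- au"] pos(7) by auto
    have "H i (pv, q) \<le> H i (pu, q) + \<kappa>" using q(2) au\<Lambda> pu_pv pos(6) by (intro H_uc) auto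
    then have "H i (pv, q) < - av" using q(2) au_av pos(7) by linarith
    moreover have "isCont (\<lambda>r. H i (pv, r)) q"
      using continuous_on_slice[OF H(1), of UNIV i pv] by (simp add: continuous_on_eq_continuous_at)
    ultimately obtain d where d: "0 < d"
      "\<forall>x'. dist x' q < d \<longrightarrow> dist (H i (pv, x')) (H i (pv, q)) < - av - H i (pv, q)"
      unfolding continuous_at_eps_delta by (metis diff_gt_0_iff_gt)
    then have "dist (H i (pv, q - d / 2)) (H i (pv, q)) < - av - H i (pv, q)" by (simp add: dist_real_def)
    then have "H i (pv, q - d / 2) < - av" by (simp add: dist_real_def)
    moreover have "0 < H i (pu, r) + au" if "r \<le> q" for r
      using q(1)[rule_format, OF that] by linarith
    ultimately show ?thesis using d(1) by (intro exI[of _ q] exI[of _ "q - d / 2"]) simp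
  qed
  then obtain q q' where q: "\<And>i r. r \<le> q i \<Longrightarrow> 0 < H i (pu, r) + au" "\<And>i. q' i < q i" "\<And>i. H i (pv, q' i) < - av"
    by metis
  define \<tau>v where "\<tau>v = (\<lambda>s. (- a) * (s - t0)\<^sup>2 + (- \<eta>) / (T - s) + 0 * (s - 0)\<^sup>2)"
  define \<tau>v' where "\<tau>v' = (\<lambda>s. 2 * (- a) * (s - t0) + (- \<eta>) / (T - s)\<^sup>2 + 2 * 0 * (s - 0))"
  define fv where "fv = (\<lambda>y. (- b) * (norm (y - x0))\<^sup>2 + 0 * smooth_norm 1 y + 0 * (norm (y - x0))\<^sup>2)"
  define fv' where "fv' = (\<lambda>y. (2 * (- b)) *\<^sub>R (y - x0) + 0 *\<^sub>R smooth_norm_grad 1 y + (2 * 0) *\<^sub>R (y - x0))"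
  define gv where "gv = (\<lambda>(i :: 'n) r. 0 * smooth_norm 1 r + 0 * (r - 0)\<^sup>2 + 0 * (r - 0)\<^sup>2 + q' i * (r :: real))"
  define gv' where "gv' = (\<lambda>(i :: 'n) r. 0 * smooth_norm_grad 1 r + 2 * 0 * (r - 0) + 2 * 0 * (r - 0) + q' i :: real)"
  have C1v: "sep_C1 T \<tau>v \<tau>v' fv fv' gv gv'"
    unfolding \<tau>v_def \<tau>v'_def fv_def fv'_def gv_def gv'_def by (rule sep_C1_pen)
  define \<psi> where "\<psi> = sep \<tau>v fv gv"
  have \<psi>: "\<psi> (s, Y) = - a * (s - t0)\<^sup>2 - \<eta> / (T - s) - b * (norm (tang Y - x0))\<^sup>2 + q' i * nrm Y i"
    if "Y \<in> branch i" for s Y i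
    using sum_branch[OF that, of q'] by (simp add: \<psi>_def sep_def \<tau>v_def fv_def gv_def)
  have "\<exists>r>0. \<forall>s Y. (s, Y) \<in> dom0 T \<and> Y \<in> branch i \<and> \<bar>s - s0\<bar> \<le> r \<and> norm (tang Y - y0) \<le> r \<and> nrm Y i \<le> r
      \<longrightarrow> \<psi> (s, Y) - V (s, Y) \<le> \<psi> (s0, Y0) - V (s0, Y0)" for i
  proof -
    obtain K y1 where K: "0 < K" "0 < y1" and slope: "\<forall>y. 0 < y \<and> y \<le> y1 \<longrightarrow>
      (\<exists>t X. (t, X) \<in> dom0 T \<and> X \<in> branch i \<and> nrm X i = y \<and>
        \<bar>t - t0\<bar> \<le> K * y \<and> norm (tang X - tang X0) \<le> K * y \<and>
        U (t0, X0) - \<tau> t0 - f (tang X0) + q i * y \<le> U (t, X) - \<tau> t - f (tang X))"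
      using lower_slope[OF U H C1 t0 X0 maxU, of "q i" i] q(1) unfolding \<tau>'0 f'0 x0_def[symmetric] by blast
    \<comment> \<open>Collects the two cross terms, each linear in K y times r, and the normal
      penalization; the summand 1 makes M positive.\<close>
    define M where "M = 2 * a * K + 2 * b * K + \<alpha> + 1"
    have M: "0 < M" unfolding M_def using pos K by (intro add_nonneg_pos add_nonneg_nonneg mult_nonneg_nonneg) auto
    define r where "r = min y1 ((q i - q' i) / M)"
    have r: "0 < r" "r \<le> y1" "M * r \<le> q i - q' i"
    proof -
      have "M * r \<le> M * ((q i - q' i) / M)" using M by (intro mult_left_mono) (auto simp: r_def)
      then show "M * r \<le> q i - q' i" using M by simp
    qed (use K M q(2)[of i] in \<open>auto simp: r_def\<close>)
    have Y0i: "Y0 \<in> branch i" "nrm Y0 i = 0" using Y0 by (auto simp: interface_nrm branch_def)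
    show ?thesis
    proof (intro exI[of _ r] conjI r(1) allI impI, elim conjE)
      fix s Y
      assume sY: "(s, Y) \<in> dom0 T" "Y \<in> branch i" and near: "\<bar>s - s0\<bar> \<le> r" "norm (tang Y - y0) \<le> r" "nrm Y i \<le> r"
      define y where "y = nrm Y i"
      show "\<psi> (s, Y) - V (s, Y) \<le> \<psi> (s0, Y0) - V (s0, Y0)"
      proof (cases "y = 0")
        case True
        have X0i: "X0 \<in> branch i" "nrm X0 i = 0" using X0 by (auto simp: interface_nrm branch_def)
        have "nrm X0 = nrm Y"
          using X0 sY(2) True by (auto simp: fun_eq_iff interface_nrm branch_def y_def)
        then have "dbl t0 X0 s Y \<le> dbl t0 X0 s0 Y0" using max'[OF dom(1) sY(1) X0i(1)] X0i(2) by simp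
        then show ?thesis
          unfolding \<psi>[OF sY(2)] \<psi>[OF Y0i(1)] using True Y0i(2)
          by (simp add: dbl_def x0_def y_def power2_commute[of s t0] power2_commute[of s0 t0] norm_minus_commute)
      next
        case False
        then have y: "0 < y" using nrm_nonneg[of Y i] by (simp add: y_def)
        \<comment> \<open>A partner for Y at the same height is required, as maximality only
          compares points with equal normal coordinates; \<open>lower_slope\<close> supplies it
          together with the gain q y.\<close>
        then obtain t X where X: "(t, X) \<in> dom0 T" "X \<in> branch i" "nrm X i = y"
          and tX: "\<bar>t - t0\<bar> \<le> K * y" "norm (tang X - x0) \<le> K * y"
          and up: "U (t0, X0) - \<tau> t0 - f x0 + q i * y \<le> U (t, X) - \<tau> t - f (tang X)"
          using slope near(3) r(2) unfolding y_def[symmetric] x0_def by (meson order_trans)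
        have nn: "nrm X = nrm Y" using branch_nrm_eqI[OF X(2) sY(2)] X(3) by (simp add: y_def)
        have D: "dbl t X s Y \<le> dbl t0 X0 s0 Y0 + \<alpha> * y\<^sup>2"
          using max'[OF X(1) sY(1) X(2) nn] X(3) by simp
        \<comment> \<open>Moving both points changes the quadratic coupling by the separate changes
          plus a bilinear cross term. One factor is at most K y, the other at most r, so it is
          negligible against y for small r.\<close>
        have 1: "a * (t - s)\<^sup>2 - a * (s - t0)\<^sup>2 - a * (t - s0)\<^sup>2 + a * (t0 - s0)\<^sup>2 = 2 * a * ((t - t0) * (s0 - s))"
          by (simp add: power2_eq_square algebra_simps)
        have 2: "b * (norm (tang X - tang Y))\<^sup>2 - b * (norm (tang Y - x0))\<^sup>2 - b * (norm (tang X - y0))\<^sup>2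
            + b * (norm (x0 - y0))\<^sup>2 = 2 * b * ((tang X - x0) \<bullet> (y0 - tang Y))"
          by (simp add: power2_norm_eq_inner inner_diff_left inner_diff_right inner_commute algebra_simps)
        have "(t - t0) * (s0 - s) \<le> \<bar>t - t0\<bar> * \<bar>s - s0\<bar>" by (metis abs_ge_self abs_minus_commute abs_mult)
        also have "\<dots> \<le> (K * y) * r" using tX near by (intro mult_mono) auto
        finally have 3: "2 * a * ((t - t0) * (s0 - s)) \<le> 2 * a * ((K * y) * r)" using pos by simp
        have "(tang X - x0) \<bullet> (y0 - tang Y) \<le> norm (tang X - x0) * norm (y0 - tang Y)" by (rule norm_cauchy_schwarz)
        also have "\<dots> \<le> (K * y) * r" using tX near by (intro mult_mono) (auto simp: norm_minus_commute)
        finally have 4: "2 * b * ((tang X - x0) \<bullet> (y0 - tang Y)) \<le> 2 * b * ((K * y) * r)" using pos by simp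
        have "\<alpha> * y\<^sup>2 \<le> \<alpha> * (y * r)"
          using pos(5) near(3) y unfolding power2_eq_square y_def by (intro mult_left_mono) auto
        moreover have "M * r * y = 2 * a * ((K * y) * r) + 2 * b * ((K * y) * r) + \<alpha> * (y * r) + y * r"
          by (simp add: M_def algebra_simps)
        moreover have "M * r * y \<le> (q i - q' i) * y" using r(3) y by (intro mult_right_mono) auto
        moreover have "0 \<le> y * r" using y r by simp
        ultimately have 5: "2 * a * ((t - t0) * (s0 - s)) + 2 * b * ((tang X - x0) \<bullet> (y0 - tang Y)) + \<alpha> * y\<^sup>2 + q' i * y \<le> q i * y"
          using 3 4 unfolding left_diff_distrib by linarith
        have 6: "norm (y0 - x0) = norm (x0 - y0)" "(s0 - t0)\<^sup>2 = (t0 - s0)\<^sup>2"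
          by (simp_all add: norm_minus_commute power2_commute)
        show ?thesis
          unfolding \<psi>[OF sY(2)] \<psi>[OF Y0i(1)] Y0i(2) y_def[symmetric] y0_def[symmetric] 6
          using D up 1 2 5 unfolding dbl_def \<tau>_def f_def x0_def[symmetric] y0_def[symmetric] by simp
      qed
    qed
  qed
  then obtain r where r: "\<And>i. 0 < r i" and touch: "\<And>i s Y. (s, Y) \<in> dom0 T \<Longrightarrow> Y \<in> branch i \<Longrightarrow> \<bar>s - s0\<bar> \<le> r i \<Longrightarrow>
      norm (tang Y - y0) \<le> r i \<Longrightarrow> nrm Y i \<le> r i \<Longrightarrow> \<psi> (s, Y) - V (s, Y) \<le> \<psi> (s0, Y0) - V (s0, Y0)"
    by metis
  define \<rho> where "\<rho> = min (Min (range r)) (min (s0 / 2) ((T - s0) / 2))"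
  have \<rho>i: "\<rho> \<le> r i" for i unfolding \<rho>_def by (rule min.coboundedI1) simp
  have "0 < Min (range r)" using r by (subst Min_gr_iff) auto
  then have "0 < \<rho>" using s0 by (simp add: \<rho>_def)
  moreover have "\<rho> \<le> s0 / 2" "\<rho> \<le> (T - s0) / 2" unfolding \<rho>_def min_le_iff_disj by simp_all
  ultimately have \<rho>: "0 < \<rho>" "\<rho> < s0" "\<rho> < T - s0" using s0 by auto
  have "loc_max (\<lambda>z. \<psi> z - V z) (s0, Y0)"
  proof (rule loc_max_cyl[of s0 y0 \<rho> \<rho>])
    fix z :: "real \<times> ('a, 'n) junction" assume z: "z \<in> cyl s0 y0 \<rho> \<rho>"
    obtain s Y where sY: "z = (s, Y)" by (cases z)
    have "z \<in> dom0 T" using z cyl_subset[OF \<rho>(2,3)] JT_subset_dom0 by blast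
    moreover have "Y \<in> (\<Union>i. branch i)" by (simp add: Union_branch)
    then obtain i where "Y \<in> branch i" by auto
    moreover have "\<bar>s - s0\<bar> \<le> r i" "norm (tang Y - y0) \<le> r i" "nrm Y i \<le> r i"
      using z sY \<rho>i[of i] nrm_le_height[of Y i] by (auto simp: cyl_def)
    ultimately show "\<psi> z - V z \<le> \<psi> (s0, Y0) - V (s0, Y0)" using touch sY by blast
  next
    have "height Y0 = 0" using Y0 by (simp add: height_eq_0_iff)
    then show "height Y0 < \<rho>" using \<rho> by simp
  qed (use \<rho> in \<open>auto simp: y0_def\<close>)
  then have "0 \<le> \<tau>v' s0 + F_lim H A (fv' (tang Y0)) (\<lambda>i. gv' i 0)"
    using V(2) C1v s0 Y0 unfolding super_sep_def \<psi>_def by blast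
  moreover have "\<tau>v' s0 = av" by (simp add: \<tau>v'_def av_def algebra_simps)
  moreover have "fv' (tang Y0) = pv" by (simp add: fv'_def pv_def y0_def algebra_simps)
  moreover have "(\<lambda>i. gv' i 0) = q'" by (simp add: gv'_def)
  moreover have "F_lim H A pv q' < - av" using H A_pv q(3) by (intro F_lim_less)
  ultimately show False by simp
qed

text \<open>Close to the maximum both points stay on the open branch J_i, so the normal coordinate
  can be doubled with a large weight \<beta>. The resulting slopes need no bound in terms of
  \<beta>: the subsolution inequality puts them in {H_i \<le> \<Lambda>}, where the modulus is
  uniform.\<close>

lemma no_interior_max:
  assumes t0: "0 < t0" "t0 < T" and s0: "0 < s0" "s0 < T"
    and X0: "X0 \<in> branch i" "0 < nrm X0 i" and Y0: "nrm X0 = nrm Y0"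
    and max: "\<And>t X s Y. (t, X) \<in> dom0 T \<Longrightarrow> (s, Y) \<in> dom0 T \<Longrightarrow> nrm X = nrm Y \<Longrightarrow>
       dbl_pen t X s Y \<le> dbl_pen t0 X0 s0 Y0"
  shows False
proof -
  define x0 where "x0 = tang X0"
  define y0 where "y0 = tang Y0"
  define h0 where "h0 = nrm X0 i"
  have h0: "0 < h0" "nrm Y0 i = h0" using X0 Y0 by (auto simp: h0_def)
  \<comment> \<open>h0/2 keeps the boxes off the interface. \<sigma>/8 bounds the change of slopes
    by four localization terms, leaving \<sigma>/2 for \<alpha>; \<kappa> bounds their effect on the
    time slopes, and 1/2 accounts for the 1 in \<Lambda>.\<close>
  define r where "r = min (min (min (t0 / 2) ((T - t0) / 2)) (min (s0 / 2) ((T - s0) / 2)))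
    (min (min (h0 / 2) (\<sigma> / 8)) (min \<kappa> (1 / 2)))"
  have "0 < r" using t0 s0 h0 pos by (simp add: r_def)
  moreover have "r \<le> t0 / 2" "r \<le> (T - t0) / 2" "r \<le> s0 / 2" "r \<le> (T - s0) / 2"
    "r \<le> h0 / 2" "r \<le> \<sigma> / 8" "r \<le> \<kappa>" "r \<le> 1 / 2"
    unfolding r_def min_le_iff_disj by simp_all
  ultimately have r: "0 < r" "r \<le> t0 / 2" "r \<le> (T - t0) / 2" "r \<le> s0 / 2" "r \<le> (T - s0) / 2"
    "r \<le> h0 / 2" "r \<le> \<sigma> / 8" "r \<le> \<kappa>" "r \<le> 1 / 2" .
  let ?S = "smooth_norm 1 :: real \<Rightarrow> real"
  let ?Q1 = "{z :: real \<times> ('a, 'n) junction. \<bar>fst z - t0\<bar> \<le> r \<and> norm (tang (snd z) - x0) \<le> r \<and> \<bar>nrm (snd z) i - h0\<bar> \<le> r}"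
  let ?Q2 = "{z :: real \<times> ('a, 'n) junction. \<bar>fst z - s0\<bar> \<le> r \<and> norm (tang (snd z) - y0) \<le> r \<and> \<bar>nrm (snd z) i - h0\<bar> \<le> r}"
  have "r < h0" using r h0 by simp
  then have cQ: "compact ?Q1" "compact ?Q2" by (rule compact_side_box)+
  have Qd: "0 < fst z \<and> fst z < T \<and> snd z \<in> branch i - interface" if "z \<in> ?Q1 \<or> z \<in> ?Q2" for z
  proof -
    have "0 < nrm (snd z) i" using that r h0 by auto
    then have "snd z \<in> branch i - interface" by (rule pos_nrm_branch)
    then show ?thesis using that r t0 s0 by (auto simp: abs_le_iff)
  qed
  have Qdom: "z \<in> dom0 T" if "z \<in> ?Q1 \<or> z \<in> ?Q2" for z
    using Qd[OF that] by (cases z) (auto simp: dom0_def)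
  \<comment> \<open>Makes the maximum strict, so that maxima with approximate constraint stay inside
    the boxes.\<close>
  define P where "P z t1 x1 = (fst z - t1)\<^sup>2 + (norm (tang (snd z) - x1))\<^sup>2 + (nrm (snd z) i - h0)\<^sup>2"
    for z :: "real \<times> ('a, 'n) junction" and t1 x1
  define R where "R p = a * (fst (fst p) - fst (snd p))\<^sup>2 + b * (norm (tang (snd (fst p)) - tang (snd (snd p))))\<^sup>2
     + \<eta> / (T - fst (fst p)) + \<eta> / (T - fst (snd p)) + \<alpha> * smooth_norm 1 (tang (snd (fst p)))
     + \<alpha> * ?S (nrm (snd (fst p)) i) + P (fst p) t0 x0 + P (snd p) s0 y0"
    for p :: "(real \<times> ('a, 'n) junction) \<times> (real \<times> ('a, 'n) junction)"
  define F where "F p = U (fst p) + - V (snd p) - R p" for p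
  define N where "N p = (nrm (snd (fst p)) i - nrm (snd (snd p)) i)\<^sup>2"
    for p :: "(real \<times> ('a, 'n) junction) \<times> (real \<times> ('a, 'n) junction)"
  define bar where "bar = F ((t0, X0), (s0, Y0))"
  have F_dbl: "F ((t, X), (s, Y)) = dbl_pen t X s Y + \<alpha> * (\<Sum>j\<in>UNIV - {i}. ?S 0) - P (t, X) t0 x0 - P (s, Y) s0 y0"
    if "X \<in> branch i" for t X s Y
  proof -
    have "(\<Sum>j\<in>UNIV. ?S (nrm X j)) = ?S (nrm X i) + (\<Sum>j\<in>UNIV - {i}. ?S (nrm X j))"
      by (rule sum.remove) auto
    also have "(\<Sum>j\<in>UNIV - {i}. ?S (nrm X j)) = (\<Sum>j\<in>UNIV - {i}. ?S 0)"
      using that by (intro sum.cong) (auto simp: branch_def)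
    finally have "(\<Sum>j\<in>UNIV. ?S (nrm X j)) = ?S (nrm X i) + (\<Sum>j\<in>UNIV - {i}. ?S 0)" .
    then have "\<alpha> * (\<Sum>j\<in>UNIV. ?S (nrm X j)) = \<alpha> * ?S (nrm X i) + \<alpha> * (\<Sum>j\<in>UNIV - {i}. ?S 0)"
      by (simp only: distrib_left)
    then show ?thesis unfolding F_def R_def dbl_pen_def dbl_def fst_conv snd_conv by linarith
  qed
  have P0: "P (t0, X0) t0 x0 = 0" "P (s0, Y0) s0 y0 = 0"
    using h0 by (simp_all add: P_def x0_def y0_def h0_def)
  have diag: "F p \<le> bar - P (fst p) t0 x0 - P (snd p) s0 y0" if p: "p \<in> ?Q1 \<times> ?Q2" "N p = 0" for p
  proof -
    obtain t X s Y where pe: "p = ((t, X), (s, Y))" by (metis surj_pair)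
    have "(t, X) \<in> ?Q1" "(s, Y) \<in> ?Q2" using p(1) pe by auto
    then have br: "X \<in> branch i" "Y \<in> branch i" and d: "(t, X) \<in> dom0 T" "(s, Y) \<in> dom0 T"
      using Qd[of "(t, X)"] Qd[of "(s, Y)"] Qdom by auto
    have "nrm X = nrm Y" using p(2) pe by (intro branch_nrm_eqI[OF br]) (simp add: N_def)
    then have "dbl_pen t X s Y \<le> dbl_pen t0 X0 s0 Y0" using max d by blast
    then show ?thesis
      using P0 unfolding pe bar_def F_dbl[OF br(1)] F_dbl[OF X0(1)] fst_conv snd_conv by linarith
  qed
  have "continuous_on (?Q1 \<times> ?Q2) R"
  proof -
    have "T - fst (fst p) \<noteq> 0" "T - fst (snd p) \<noteq> 0" if "p \<in> ?Q1 \<times> ?Q2" for p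
      using Qd[of "fst p"] Qd[of "snd p"] that by auto
    then show ?thesis unfolding R_def P_def by (intro continuous_intros) auto
  qed
  moreover have "usc_on (?Q1 \<times> ?Q2) (\<lambda>p. U (fst p))"
    by (rule usc_on_compose[OF U(1)]) (use Qdom in \<open>auto intro!: continuous_intros\<close>)
  moreover have "usc_on (?Q1 \<times> ?Q2) (\<lambda>p. - V (snd p))"
    by (rule usc_on_compose[OF V(1)]) (use Qdom in \<open>auto intro!: continuous_intros\<close>)
  ultimately have uscF: "usc_on (?Q1 \<times> ?Q2) F"
    unfolding F_def by (intro usc_on_diff usc_on_add)
  define m where "m z t1 x1 = Max {\<bar>fst z - t1\<bar>, norm (tang (snd z) - x1), \<bar>nrm (snd z) i - h0\<bar>}"
    for z :: "real \<times> ('a, 'n) junction" and t1 x1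
  have m_eq: "m z t1 x1 = max \<bar>fst z - t1\<bar> (max (norm (tang (snd z) - x1)) \<bar>nrm (snd z) i - h0\<bar>)" for z t1 x1
    by (simp add: m_def)
  have P_m: "0 < P z t1 x1" if "r \<le> m z t1 x1" for z t1 x1
  proof (rule ccontr)
    assume "\<not> ?thesis"
    moreover have "0 \<le> (fst z - t1)\<^sup>2" "0 \<le> (norm (tang (snd z) - x1))\<^sup>2" "0 \<le> (nrm (snd z) i - h0)\<^sup>2" by simp_all
    ultimately have "(fst z - t1)\<^sup>2 = 0" "(norm (tang (snd z) - x1))\<^sup>2 = 0" "(nrm (snd z) i - h0)\<^sup>2 = 0"
      unfolding P_def by linarith+
    then show False using that r(1) by (simp add: m_eq)
  qed
  have P_ge: "0 \<le> P z t1 x1" for z t1 x1 by (simp add: P_def)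
  let ?E = "{p \<in> ?Q1 \<times> ?Q2. r \<le> max (m (fst p) t0 x0) (m (snd p) s0 y0)}"
  have cQQ: "compact (?Q1 \<times> ?Q2)" using cQ by (rule compact_Times)
  have "closed {p. r \<le> max (m (fst p) t0 x0) (m (snd p) s0 y0)}"
    unfolding m_eq by (intro closed_Collect_le continuous_intros)
  then have "compact ((?Q1 \<times> ?Q2) \<inter> {p. r \<le> max (m (fst p) t0 x0) (m (snd p) s0 y0)})"
    by (rule compact_Int_closed[OF cQQ])
  moreover have "(?Q1 \<times> ?Q2) \<inter> {p. r \<le> max (m (fst p) t0 x0) (m (snd p) s0 y0)} = ?E" by blast
  ultimately have cE: "compact ?E" by (simp only:)
  have uE: "usc_on ?E F" using uscF by (rule usc_on_subset) blast
  have NE: "continuous_on ?E N" unfolding N_def by (intro continuous_intros)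
  have "F p < bar" if "p \<in> ?E" "N p = 0" for p
  proof -
    have "0 < P (fst p) t0 x0 \<or> 0 < P (snd p) s0 y0" using that(1) P_m by (auto simp: le_max_iff_disj)
    then show ?thesis
      using diag[of p] that P_ge[of "fst p" t0 x0] P_ge[of "snd p" s0 y0] by auto
  qed
  moreover have "0 \<le> N p" for p by (simp add: N_def)
  ultimately have "\<exists>\<beta>>0. \<forall>p\<in>?E. \<forall>M\<ge>\<beta>. F p - M * N p < bar"
    using usc_on_penalization[OF cE uE NE, of bar] by blast
  \<comment> \<open>A weight for which no maximum lies on the boundary: where the normal coordinates
    agree P is positive there, and where they differ the penalty acts.\<close>
  then obtain \<beta> where \<beta>: "0 < \<beta>" "\<forall>p\<in>?E. \<forall>M\<ge>\<beta>. F p - M * N p < bar" by (elim exE conjE)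
  have "continuous_on (?Q1 \<times> ?Q2) (\<lambda>p. \<beta> * N p)" unfolding N_def by (intro continuous_intros)
  then have u\<Phi>: "usc_on (?Q1 \<times> ?Q2) (\<lambda>p. F p - \<beta> * N p)" by (rule usc_on_diff[OF uscF])
  have bars: "((t0, X0), (s0, Y0)) \<in> ?Q1 \<times> ?Q2"
    using r(1) h0 by (simp add: x0_def y0_def h0_def)
  then have "?Q1 \<times> ?Q2 \<noteq> {}" by blast
  from usc_on_attains_max[OF cQQ this u\<Phi>]
  obtain p where p: "p \<in> ?Q1 \<times> ?Q2" "\<forall>w\<in>?Q1 \<times> ?Q2. F w - \<beta> * N w \<le> F p - \<beta> * N p" ..
  have "N ((t0, X0), (s0, Y0)) = 0" using Y0 by (simp add: N_def)
  then have "bar \<le> F p - \<beta> * N p" using p(2)[rule_format, OF bars] by (simp add: bar_def)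
  moreover have "F p - \<beta> * N p < bar" if "p \<in> ?E" using \<beta>(2)[rule_format, OF that order_refl] .
  ultimately have "p \<notin> ?E" by linarith
  then have "\<not> r \<le> max (m (fst p) t0 x0) (m (snd p) s0 y0)" using p(1) by blast
  then have ins: "m (fst p) t0 x0 < r" "m (snd p) s0 y0 < r" by (simp_all add: not_le)
  obtain t X s Y where pe: "p = ((t, X), (s, Y))" by (metis surj_pair)
  define x where "x = tang X"
  define y where "y = tang Y"
  define h where "h = nrm X i"
  define k where "k = nrm Y i"
  have inX: "\<bar>t - t0\<bar> < r" "norm (x - x0) < r" "\<bar>h - h0\<bar> < r"
    and inY: "\<bar>s - s0\<bar> < r" "norm (y - y0) < r" "\<bar>k - h0\<bar> < r"
    using ins by (auto simp: pe m_eq x_def y_def h_def k_def)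
  have tX: "0 < t" "t < T" "X \<in> branch i - interface" and sY: "0 < s" "s < T" "Y \<in> branch i - interface"
    using Qd[of "(t, X)"] Qd[of "(s, Y)"] p(1) pe by auto
  \<comment> \<open>Indicator of J_i: the other branches carry no normal part in these test
    functions.\<close>
  define d where "d j = (if j = i then 1 else 0 :: real)" for j
  let ?\<tau> = "\<lambda>t. a * (t - s)\<^sup>2 + \<eta> / (T - t) + 1 * (t - t0)\<^sup>2"
  let ?\<tau>' = "\<lambda>t. 2 * a * (t - s) + \<eta> / (T - t)\<^sup>2 + 2 * 1 * (t - t0)"
  let ?f = "\<lambda>x. b * (norm (x - y))\<^sup>2 + \<alpha> * smooth_norm 1 x + 1 * (norm (x - x0))\<^sup>2"
  let ?f' = "\<lambda>x. (2 * b) *\<^sub>R (x - y) + \<alpha> *\<^sub>R smooth_norm_grad 1 x + (2 * 1) *\<^sub>R (x - x0)"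
  let ?g = "\<lambda>j \<rho>. (\<alpha> * d j) * ?S \<rho> + (\<beta> * d j) * (\<rho> - k)\<^sup>2 + d j * (\<rho> - h0)\<^sup>2 + 0 * \<rho>"
  let ?g' = "\<lambda>j \<rho>. (\<alpha> * d j) * smooth_norm_grad 1 \<rho> + 2 * (\<beta> * d j) * (\<rho> - k) + 2 * d j * (\<rho> - h0) + 0"
  let ?\<tau>v = "\<lambda>s. (- a) * (s - t)\<^sup>2 + (- \<eta>) / (T - s) + (- 1) * (s - s0)\<^sup>2"
  let ?\<tau>v' = "\<lambda>s. 2 * (- a) * (s - t) + (- \<eta>) / (T - s)\<^sup>2 + 2 * (- 1) * (s - s0)"
  let ?fv = "\<lambda>y. (- b) * (norm (y - x))\<^sup>2 + 0 * smooth_norm 1 y + (- 1) * (norm (y - y0))\<^sup>2"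
  let ?fv' = "\<lambda>y. (2 * (- b)) *\<^sub>R (y - x) + 0 *\<^sub>R smooth_norm_grad 1 y + (2 * (- 1)) *\<^sub>R (y - y0)"
  let ?gv = "\<lambda>j \<rho>. 0 * ?S \<rho> + (- \<beta> * d j) * (\<rho> - h)\<^sup>2 + (- d j) * (\<rho> - h0)\<^sup>2 + 0 * \<rho>"
  let ?gv' = "\<lambda>j \<rho>. 0 * smooth_norm_grad 1 \<rho> + 2 * (- \<beta> * d j) * (\<rho> - h) + 2 * (- d j) * (\<rho> - h0) + 0"
  have C1u: "sep_C1 T ?\<tau> ?\<tau>' ?f ?f' ?g ?g'" by (rule sep_C1_pen)
  have C1v: "sep_C1 T ?\<tau>v ?\<tau>v' ?fv ?fv' ?gv ?gv'" by (rule sep_C1_pen)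
  have sumg: "(\<Sum>j\<in>UNIV. ?g j (nrm Z j)) = \<alpha> * ?S (nrm Z i) + \<beta> * (nrm Z i - k)\<^sup>2 + (nrm Z i - h0)\<^sup>2"
    for Z :: "('a, 'n) junction"
    by (subst sum_single[of i]) (simp_all add: d_def)
  have sumgv: "(\<Sum>j\<in>UNIV. ?gv j (nrm Z j)) = - \<beta> * (nrm Z i - h)\<^sup>2 - (nrm Z i - h0)\<^sup>2"
    for Z :: "('a, 'n) junction"
    by (subst sum_single[of i]) (simp_all add: d_def)
  have Uz: "U z - sep ?\<tau> ?f ?g z = F (z, (s, Y)) - \<beta> * N (z, (s, Y)) + (V (s, Y) + \<eta> / (T - s) + P (s, Y) s0 y0)" for z
    unfolding sep_def sumg F_def R_def N_def P_def by (simp add: y_def k_def)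
  have Vz: "sep ?\<tau>v ?fv ?gv w - V w = F ((t, X), w) - \<beta> * N ((t, X), w)
      - (U (t, X) - \<eta> / (T - t) - \<alpha> * smooth_norm 1 x - \<alpha> * ?S h - P (t, X) t0 x0)" for w
    unfolding sep_def sumgv F_def R_def N_def P_def
    by (simp add: x_def h_def power2_commute[of "fst w" t] power2_commute[of "nrm (snd w) i"] norm_minus_commute)
  have "\<forall>\<^sub>F z in nhds (t, X). m z t0 x0 < r"
  proof -
    have "open {z. m z t0 x0 < r}" unfolding m_eq by (intro open_Collect_less continuous_intros)
    then show ?thesis using eventually_nhds_in_open[of "{z. m z t0 x0 < r}" "(t, X)"] ins pe by simp
  qed
  then have "loc_max (\<lambda>z. U z - sep ?\<tau> ?f ?g z) (t, X)"
    unfolding loc_max_def Uz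
  proof eventually_elim
    case (elim z)
    then have "(z, (s, Y)) \<in> ?Q1 \<times> ?Q2" using p(1) pe by (auto simp: m_eq)
    then show ?case using p(2) pe by fastforce
  qed
  then have subU: "?\<tau>' t + H i (?f' (tang X), ?g' i (nrm X i)) \<le> 0"
    using U(2) C1u tX unfolding sub_sep_def by blast
  have "\<forall>\<^sub>F w in nhds (s, Y). m w s0 y0 < r"
  proof -
    have "open {z. m z s0 y0 < r}" unfolding m_eq by (intro open_Collect_less continuous_intros)
    then show ?thesis using eventually_nhds_in_open[of "{z. m z s0 y0 < r}" "(s, Y)"] ins pe by simp
  qed
  then have "loc_max (\<lambda>w. sep ?\<tau>v ?fv ?gv w - V w) (s, Y)"
    unfolding loc_max_def Vz
  proof eventually_elim
    case (elim w)
    then have "((t, X), w) \<in> ?Q1 \<times> ?Q2" using p(1) pe by (auto simp: m_eq)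
    then show ?case using p(2) pe by fastforce
  qed
  then have superV: "0 \<le> ?\<tau>v' s + H i (?fv' (tang Y), ?gv' i (nrm Y i))"
    using V(2) C1v sY unfolding super_sep_def by blast
  define pu where "pu = ?f' x"
  define pv where "pv = ?fv' y"
  define qu where "qu = ?g' i h"
  define qv where "qv = ?gv' i k"
  have "pu - pv = \<alpha> *\<^sub>R smooth_norm_grad 1 x + 2 *\<^sub>R (x - x0) + 2 *\<^sub>R (y - y0)"
    by (simp add: pu_def pv_def algebra_simps)
  then have "norm (pu - pv) \<le> norm (\<alpha> *\<^sub>R smooth_norm_grad 1 x) + norm (2 *\<^sub>R (x - x0)) + norm (2 *\<^sub>R (y - y0))"
    by (simp only:) (intro norm_triangle_mono order_refl)
  also have "\<dots> = \<alpha> * norm (smooth_norm_grad 1 x) + 2 * norm (x - x0) + 2 * norm (y - y0)"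
    using pos(5) by simp
  also have "\<alpha> * norm (smooth_norm_grad 1 x) \<le> \<alpha> * 1"
    using pos(5) norm_smooth_norm_grad_le[of 1 x] by (intro mult_left_mono) auto
  finally have npq: "norm (pu - pv) \<le> \<sigma>" using \<alpha> r(7) inX(2) inY(2) by linarith
  have "qu - qv = \<alpha> * smooth_norm_grad 1 h + 2 * (h - h0) + 2 * (k - h0)"
    by (simp add: qu_def qv_def d_def algebra_simps)
  moreover have "\<bar>\<alpha> * smooth_norm_grad 1 h\<bar> \<le> \<alpha> * 1"
    unfolding abs_mult using pos(5) norm_smooth_norm_grad_le[of 1 h] by (intro mult_mono) auto
  ultimately have nq: "\<bar>qu - qv\<bar> \<le> \<sigma>"
    using \<alpha> r(7) inX(3) inY(3) unfolding right_diff_distrib by linarith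
  have Hu: "H i (pu, qu) \<le> - ?\<tau>' t" using subU by (simp add: pu_def qu_def x_def h_def)
  have "- (2 * a * T) - 1 \<le> ?\<tau>' t"
    using time_slope_ge[OF tX(1,2) sY(1,2)] blowup_deriv_ge[OF tX(1,2)] inX(1) r(9) pos(7)
    unfolding right_diff_distrib by linarith
  then have "H i (pu, qu) \<le> \<Lambda>" using Hu \<Lambda> pos(7) by linarith
  then have "H i (pv, qv) \<le> H i (pu, qu) + \<kappa>" using npq nq by (rule H_uc)
  moreover have "- ?\<tau>v' s \<le> H i (pv, qv)" using superV by (simp add: pv_def qv_def y_def k_def)
  ultimately have "?\<tau>' t - ?\<tau>v' s \<le> \<kappa>" using Hu by linarith
  \<comment> \<open>The coupling terms cancel. The blow-up terms give at least 8\<kappa> and the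
    localization removes less than 4\<kappa>, which contradicts the upper bound \<kappa>.\<close>
  moreover have "?\<tau>' t - ?\<tau>v' s = \<eta> / (T - t)\<^sup>2 + \<eta> / (T - s)\<^sup>2 + 2 * (t - t0) + 2 * (s - s0)"
    by (simp add: algebra_simps)
  ultimately show False
    using blowup_deriv_ge[OF tX(1,2)] blowup_deriv_ge[OF sY(1,2)] inX(1) inY(1) r(8) pos(7)
    unfolding right_diff_distrib by linarith
qed

end

section \<open>The comparison principle\<close>

text \<open>K contains the unit neighbourhood of the sublevel set, so both points lie in K once the
  distance is at most 1; f is uniformly continuous there.\<close>

lemma sublevel_modulus:
  fixes f :: "'b::metric_space \<Rightarrow> real"
  assumes f: "continuous_on UNIV f" and K: "compact K" and sub: "\<And>x. f x \<le> \<Lambda> \<Longrightarrow> cball x 1 \<subseteq> K"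
    and "0 < \<kappa>"
  shows "\<exists>\<sigma>>0. \<forall>x x'. f x \<le> \<Lambda> \<longrightarrow> dist x x' \<le> \<sigma> \<longrightarrow> f x' \<le> f x + \<kappa>"
proof -
  have "continuous_on K f" using f continuous_on_subset by blast
  then have "uniformly_continuous_on K f" using K by (rule compact_uniformly_continuous)
  then obtain d where d: "0 < d" "\<And>x x'. x \<in> K \<Longrightarrow> x' \<in> K \<Longrightarrow> dist x' x < d \<Longrightarrow> dist (f x') (f x) < \<kappa>"
    using \<open>0 < \<kappa>\<close> unfolding uniformly_continuous_on_def by metis
  show ?thesis
  proof (intro exI[of _ "min (d / 2) 1"] conjI allI impI)
    fix x x' assume x: "f x \<le> \<Lambda>" "dist x x' \<le> min (d / 2) 1"
    have "x \<in> cball x 1" "x' \<in> cball x 1" using x(2) by auto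
    then have "x \<in> K" "x' \<in> K" using sub[OF x(1)] by blast+
    moreover have "dist x' x < d" using x(2) d(1) by (simp add: dist_commute)
    ultimately have "dist (f x') (f x) < \<kappa>" by (rule d(2))
    then show "f x' \<le> f x + \<kappa>" by (simp add: dist_real_def)
  qed (use d in simp)
qed

lemma joint_modulus:
  fixes H :: "'n::finite \<Rightarrow> 'a::finite_dim_inner \<times> real \<Rightarrow> real" and A :: "'a \<Rightarrow> real"
  assumes H: "\<And>i. continuous_on UNIV (H i)" "\<And>i. coercive (H i)" and A: "continuous_on UNIV A"
    and A_min: "\<And>i p. A_min (H i) p \<le> A p" and \<kappa>: "0 < \<kappa>"
  shows "\<exists>\<sigma>>0. (\<forall>i p q p' q'. H i (p, q) \<le> \<Lambda> \<longrightarrow> norm (p - p') \<le> \<sigma> \<longrightarrow> \<bar>q - q'\<bar> \<le> \<sigma> \<longrightarrow> H i (p', q') \<le> H i (p, q) + \<kappa>) \<and>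
    (\<forall>p p'. A p \<le> \<Lambda> \<longrightarrow> norm (p - p') \<le> \<sigma> \<longrightarrow> A p' \<le> A p + \<kappa>)"
proof -
  obtain B where B: "0 < B" "\<forall>i p. B \<le> norm p \<longrightarrow> \<Lambda> + 1 < H i p"
    using coercive_bound_uniform[of H "\<Lambda> + 1", OF H(2)] by blast
  have "\<exists>\<sigma>>0. \<forall>x x'. H i x \<le> \<Lambda> \<longrightarrow> dist x x' \<le> \<sigma> \<longrightarrow> H i x' \<le> H i x + \<kappa>" for i
  proof (rule sublevel_modulus[OF H(1) compact_slopes[of "B + 1"] _ \<kappa>])
    fix x assume "H i x \<le> \<Lambda>"
    then have nx: "norm x < B" using B(2)[rule_format, of x i] by (cases "B \<le> norm x") auto
    show "cball x 1 \<subseteq> {p. norm (fst p) \<le> B + 1 \<and> \<bar>snd p\<bar> \<le> B + 1}"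
    proof
      fix y assume "y \<in> cball x 1"
      then have "norm y \<le> B + 1"
        using nx norm_triangle_ineq2[of y x] by (simp add: dist_norm norm_minus_commute)
      moreover have "norm (fst y) \<le> norm y" "\<bar>snd y\<bar> \<le> norm y"
        using norm_fst_le[of "fst y" "snd y"] abs_snd_le[of "snd y" "fst y"] by simp_all
      ultimately show "y \<in> {p. norm (fst p) \<le> B + 1 \<and> \<bar>snd p\<bar> \<le> B + 1}" by simp
    qed
  qed
  then obtain s where s: "\<And>i. 0 < s i" "\<And>i x x'. H i x \<le> \<Lambda> \<Longrightarrow> dist x x' \<le> s i \<Longrightarrow> H i x' \<le> H i x + \<kappa>"
    by metis
  have "\<exists>\<sigma>>0. \<forall>x x'. A x \<le> \<Lambda> \<longrightarrow> dist x x' \<le> \<sigma> \<longrightarrow> A x' \<le> A x + \<kappa>"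
  proof (rule sublevel_modulus[OF A compact_cball_finite_dim[of "B + 1"] _ \<kappa>])
    fix x assume "A x \<le> \<Lambda>"
    obtain i :: 'n where True by blast
    \<comment> \<open>A inherits coercivity from below: where A is at most \<Lambda>, some H_i (x,
      q) is below \<Lambda> + 1, which bounds x.\<close>
    have "A_min (H i) x < \<Lambda> + 1" using A_min[of i x] \<open>A x \<le> \<Lambda>\<close> by simp
    then have "\<exists>y\<in>range (\<lambda>q. H i (x, q)). y < \<Lambda> + 1" unfolding A_min_def by (intro cInf_lessD) auto
    then obtain q where "H i (x, q) < \<Lambda> + 1" by auto
    then have "norm (x, q) < B" using B(2)[rule_format, of "(x, q)" i] by (cases "B \<le> norm (x, q)") auto
    then have nx: "norm x < B" using norm_fst_le[of x q] by simp
    show "cball x 1 \<subseteq> {p. norm p \<le> B + 1}"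
    proof
      fix y assume "y \<in> cball x 1"
      then show "y \<in> {p. norm p \<le> B + 1}"
        using nx norm_triangle_ineq2[of y x] by (simp add: dist_norm norm_minus_commute)
    qed
  qed
  then obtain sA where sA: "0 < sA" "\<And>x x'. A x \<le> \<Lambda> \<Longrightarrow> dist x x' \<le> sA \<Longrightarrow> A x' \<le> A x + \<kappa>" by metis
  \<comment> \<open>Halved because the distance of pairs is at most the sum of two distances, each
    up to \<sigma>.\<close>
  define \<sigma> where "\<sigma> = min sA (Min (range s) / 2)"
  have si: "2 * \<sigma> \<le> s i" for i
  proof -
    have "Min (range s) \<le> s i" by simp
    moreover have "\<sigma> \<le> Min (range s) / 2" unfolding \<sigma>_def by (rule min.cobounded2)
    ultimately show ?thesis by linarith
  qed
  have "0 < Min (range s)" using s(1) by (subst Min_gr_iff) auto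
  then have \<sigma>: "0 < \<sigma>" "\<sigma> \<le> sA" using sA(1) by (auto simp: \<sigma>_def)
  show ?thesis
  proof (intro exI[of _ \<sigma>] conjI allI impI \<sigma>(1))
    fix i p q p' q' assume "H i (p, q) \<le> \<Lambda>" and "norm (p - p') \<le> \<sigma>" "\<bar>q - q'\<bar> \<le> \<sigma>"
    moreover have "dist (p, q) (p', q') \<le> dist p p' + dist q q'"
      unfolding dist_Pair_Pair by (rule sqrt_sum_squares_le_sum) auto
    ultimately show "H i (p', q') \<le> H i (p, q) + \<kappa>"
      using s(2)[of i "(p, q)" "(p', q')"] si[of i] by (simp add: dist_norm)
  next
    fix p p' assume "A p \<le> \<Lambda>" "norm (p - p') \<le> \<sigma>"
    then show "A p' \<le> A p + \<kappa>" using sA(2)[of p p'] \<sigma>(2) by (simp add: dist_norm)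
  qed
qed

lemma linear_minus_square_le:
  fixes K a \<mu> r :: real
  assumes "0 < a" "0 < \<mu>" "4 * K\<^sup>2 \<le> \<mu> * a"
  shows "K * r - a * r\<^sup>2 \<le> \<mu> / 16"
proof -
  have "4 * a * (K * r - a * r\<^sup>2) \<le> K\<^sup>2"
    using zero_le_power2[of "K - 2 * a * r"] by (simp add: power2_eq_square algebra_simps)
  also have "\<dots> \<le> 4 * a * (\<mu> / 16)" using assms(3) by simp
  finally show ?thesis using assms(1) by simp
qed

text \<open>The order of choice matters: a, b and \<eta> depend only on the data and the assumed gap
  \<mu>; they determine \<kappa> and \<Lambda>, these a modulus \<sigma>, and only then is \<alpha>
  taken small.\<close>

lemma envelope_comparison:
  fixes H :: "'n::finite \<Rightarrow> 'a::finite_dim_inner \<times> real \<Rightarrow> real" and A :: "'a \<Rightarrow> real"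
    and U V :: "real \<times> ('a, 'n) junction \<Rightarrow> real"
  assumes H: "\<And>i. continuous_on UNIV (H i)" "\<And>i. coercive (H i)" and A: "continuous_on UNIV A"
    and A_min: "\<And>i p. A_min (H i) p \<le> A p"
    and w: "uniformly_continuous_on UNIV w" and T: "0 < T"
    and U: "usc_on (dom0 T) U" "sub_sep H A T U"
    and V: "usc_on (dom0 T) (\<lambda>z. - V z)" "super_sep H A T V"
    and C: "0 < C" "\<And>t X. (t, X) \<in> dom0 T \<Longrightarrow> U (t, X) \<le> C * (1 + dist X0 X)"
      "\<And>t X. (t, X) \<in> dom0 T \<Longrightarrow> - V (t, X) \<le> C * (1 + dist X0 X)"
    and init: "\<And>X. U (0, X) \<le> w X" "\<And>X. - V (0, X) \<le> - w X"
    and t1: "(t1, X1) \<in> dom0 T"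
  shows "U (t1, X1) \<le> V (t1, X1)"
proof (rule ccontr)
  assume neg: "\<not> U (t1, X1) \<le> V (t1, X1)"
  define \<mu> where "\<mu> = U (t1, X1) - V (t1, X1)"
  have \<mu>: "0 < \<mu>" using neg by (simp add: \<mu>_def)
  \<comment> \<open>One \<theta> is lost in each growth estimate and one in the modulus of w. With
    3\<theta> = \<mu>/8 and two coupling errors of \<mu>/16, values at initial times stay at most
    \<mu>/4, below the maximum of at least \<mu>/2.\<close>
  define \<theta> where "\<theta> = \<mu> / 24"
  have \<theta>: "0 < \<theta>" using \<mu> by (simp add: \<theta>_def)
  have w': "uniformly_continuous_on UNIV (\<lambda>X. - w X)"
    using w by (rule uniformly_continuous_on_minus)
  obtain K1 where K1: "0 \<le> K1" "\<And>t X. (t, X) \<in> dom0 T \<Longrightarrow> U (t, X) \<le> w X + \<theta> + K1 * t"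
    using linear_time_growth[OF U(1) C(2) C(1) time_bound_sub[OF H(1) A U(2)] init(1) w \<theta>] by metis
  obtain K2 where K2: "0 \<le> K2" "\<And>t X. (t, X) \<in> dom0 T \<Longrightarrow> - V (t, X) \<le> - w X + \<theta> + K2 * t"
    using linear_time_growth[OF V(1) C(3) C(1) time_bound_super[OF H A V(2)] init(2) w' \<theta>] by metis
  define K where "K = max K1 K2"
  obtain L where L: "0 \<le> L"
    "\<And>X Y. w X - w Y \<le> \<theta> + L * (dist (tang X) (tang Y) + (\<Sum>i\<in>UNIV. \<bar>nrm X i - nrm Y i\<bar>))"
    using uniformly_continuous_junction_bound[OF w \<theta>] by metis
  have K: "0 \<le> K" using K1(1) by (simp add: K_def)
  have UV: "U (t, X) - V (s, Y) \<le> 3 * \<theta> + (K * t + K * s) + L * norm (tang X - tang Y)"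
    if "(t, X) \<in> dom0 T" "(s, Y) \<in> dom0 T" "nrm X = nrm Y" for t X s Y
  proof -
    have "K1 * t \<le> K * t" "K2 * s \<le> K * s"
      using that by (auto simp: K_def dom0_def intro!: mult_right_mono)
    then show ?thesis
      using K1(2)[OF that(1)] K2(2)[OF that(2)] L(2)[of X Y] that(3) by (simp add: dist_norm)
  qed
  \<comment> \<open>Each blow-up term costs \<mu>/8 at t1; with at most \<mu>/4 for the penalization
    at infinity, \<mu>/2 remains.\<close>
  define \<eta> where "\<eta> = \<mu> / 8 * (T - t1)"
  have t1': "0 \<le> t1" "t1 < T" using t1 by (auto simp: dom0_def)
  have \<eta>: "0 < \<eta>" "\<eta> / (T - t1) = \<mu> / 8" using \<mu> t1' unfolding \<eta>_def
    by (auto intro!: nonzero_mult_div_cancel_right simp del: times_divide_eq_left)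
  define a where "a = 4 * K\<^sup>2 / \<mu> + 1"
  define b where "b = 4 * L\<^sup>2 / \<mu> + L + 1"
  have "0 \<le> 4 * K\<^sup>2 / \<mu>" "0 \<le> 4 * L\<^sup>2 / \<mu>" using \<mu> by auto
  then have ab: "0 < a" "0 < b" "L + 1 \<le> b" using L(1) unfolding a_def b_def by linarith+
  have "\<mu> * a = 4 * K\<^sup>2 + \<mu>" "\<mu> * b = 4 * L\<^sup>2 + \<mu> * (L + 1)" using \<mu> by (auto simp: a_def b_def field_simps)
  moreover have "0 \<le> \<mu> * (L + 1)" using \<mu> L(1) by simp
  ultimately have "4 * K\<^sup>2 \<le> \<mu> * a" "4 * L\<^sup>2 \<le> \<mu> * b" using \<mu> by linarith+
  then have Ka: "K * r - a * r\<^sup>2 \<le> \<mu> / 16" and Lb: "L * r - b * r\<^sup>2 \<le> \<mu> / 16" for r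
    using linear_minus_square_le ab \<mu> by blast+
  define \<kappa> where "\<kappa> = \<eta> / (4 * T\<^sup>2)"
  have \<kappa>: "0 < \<kappa>" using \<eta> T by (simp add: \<kappa>_def)
  define \<Lambda> where "\<Lambda> = 2 * a * T + 1 + \<kappa>"
  obtain \<sigma> where \<sigma>: "0 < \<sigma>"
    "\<forall>i p q p' q'. H i (p, q) \<le> \<Lambda> \<longrightarrow> norm (p - p') \<le> \<sigma> \<longrightarrow> \<bar>q - q'\<bar> \<le> \<sigma> \<longrightarrow> H i (p', q') \<le> H i (p, q) + \<kappa>"
    "\<forall>p p'. A p \<le> \<Lambda> \<longrightarrow> norm (p - p') \<le> \<sigma> \<longrightarrow> A p' \<le> A p + \<kappa>"
    using joint_modulus[of H A \<kappa> \<Lambda>, OF H A A_min \<kappa>] by (elim exE conjE)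
  let ?N = "\<lambda>X :: ('a, 'n) junction. smooth_norm 1 (tang X) + (\<Sum>i\<in>UNIV. smooth_norm 1 (nrm X i))"
  have S0: "0 \<le> (\<Sum>i\<in>UNIV. smooth_norm 1 (nrm X i))" for X :: "('a, 'n) junction"
    by (intro sum_nonneg less_imp_le smooth_norm_pos) simp
  have N: "0 < ?N X" for X
    by (rule add_pos_nonneg[OF _ S0]) (simp add: smooth_norm_pos)
  define \<alpha> where "\<alpha> = min (\<sigma> / 2) (\<mu> / (4 * ?N X1))"
  have \<alpha>: "0 < \<alpha>" "2 * \<alpha> \<le> \<sigma>" "\<alpha> * ?N X1 \<le> \<mu> / 4"
  proof -
    show "0 < \<alpha>" using \<sigma>(1) \<mu> N[of X1] by (simp add: \<alpha>_def)
    have "\<alpha> \<le> \<sigma> / 2" unfolding \<alpha>_def by (rule min.cobounded1)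
    then show "2 * \<alpha> \<le> \<sigma>" by simp
    have "\<alpha> * ?N X1 \<le> \<mu> / (4 * ?N X1) * ?N X1"
      using N[of X1] unfolding \<alpha>_def by (intro mult_right_mono min.cobounded2 less_imp_le)
    also have "\<dots> = \<mu> / 4"
    proof -
      have "\<mu> / (4 * x) * x = \<mu> / 4" if "0 < x" for x using that by simp
      then show ?thesis using N by blast
    qed
    finally show "\<alpha> * ?N X1 \<le> \<mu> / 4" .
  qed
  interpret dd: doubling H A U V T a b \<eta> \<alpha> \<sigma> \<kappa> \<Lambda>
  proof
    show "4 * \<kappa> \<le> \<eta> / T\<^sup>2" by (simp add: \<kappa>_def)
    show "2 * a * T + 1 + \<kappa> \<le> \<Lambda>" by (simp add: \<Lambda>_def)
    show "H i (p', q') \<le> H i (p, q) + \<kappa>" if "H i (p, q) \<le> \<Lambda>" "norm (p - p') \<le> \<sigma>" "\<bar>q - q'\<bar> \<le> \<sigma>" for i p q p' q'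
      using \<sigma>(2) that by blast
    show "A p' \<le> A p + \<kappa>" if "A p \<le> \<Lambda>" "norm (p - p') \<le> \<sigma>" for p p'
      using \<sigma>(3) that by blast
  qed (use H A_min U V T ab \<eta> \<alpha> \<sigma>(1) \<kappa> in auto)
  have dbl_pen_eq: "dd.dbl_pen t X s Y = U (t, X) - V (s, Y) - a * (t - s)\<^sup>2 - b * (norm (tang X - tang Y))\<^sup>2
     - \<eta> / (T - t) - \<eta> / (T - s) - \<alpha> * ?N X" for t X s Y
    by (simp add: dd.dbl_pen_def dd.dbl_def distrib_left)
  define R where "R p = a * (fst (fst p) - fst (snd p))\<^sup>2 + b * (norm (tang (snd (fst p)) - tang (snd (snd p))))\<^sup>2
     + \<eta> / (T - fst (fst p)) + \<eta> / (T - fst (snd p)) + \<alpha> * ?N (snd (fst p))"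
    for p :: "(real \<times> ('a, 'n) junction) \<times> (real \<times> ('a, 'n) junction)"
  define F where "F p = U (fst p) + - V (snd p) - R p" for p
  have F: "F ((t, X), (s, Y)) = dd.dbl_pen t X s Y" for t X s Y
    by (simp add: F_def R_def dbl_pen_eq)
  have "F ((t1, X1), (t1, X1)) = \<mu> - \<eta> / (T - t1) - \<eta> / (T - t1) - \<alpha> * ?N X1"
    by (simp add: F dbl_pen_eq \<mu>_def)
  then have F1: "\<mu> / 2 \<le> F ((t1, X1), (t1, X1))" using \<eta>(2) \<alpha>(3) by linarith
  define B where "B = 3 * \<theta> + 2 * K * T + \<mu> / 16 + 1"
  have B: "0 < B"
  proof -
    have "0 \<le> 2 * K * T" using K T by simp
    then show ?thesis unfolding B_def using \<theta> \<mu> by linarith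
  qed
  define T1 where "T1 = T - \<eta> / B"
  define \<rho> where "\<rho> = B / \<alpha> + 1 + B"
  have T1: "T1 < T" using \<eta> B by (simp add: T1_def)
  let ?X = "{X :: ('a, 'n) junction. norm (tang X) \<le> \<rho> \<and> (\<forall>i. nrm X i \<le> \<rho>)}"
  \<comment> \<open>The shared normal coordinate is a closed constraint, so compactness is
    preserved.\<close>
  define Q where "Q = (({0..T1} \<times> ?X) \<times> ({0..T1} \<times> ?X)) \<inter> {p. \<forall>i. nrm (snd (fst p)) i = nrm (snd (snd p)) i}"
  have "closed {p :: (real \<times> ('a, 'n) junction) \<times> (real \<times> ('a, 'n) junction). \<forall>i. nrm (snd (fst p)) i = nrm (snd (snd p)) i}"
    by (intro closed_Collect_all closed_Collect_eq continuous_intros)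
  then have cQ: "compact Q"
    unfolding Q_def by (intro compact_Int_closed compact_Times compact_Icc compact_junction_box)
  have Qdom: "fst p \<in> dom0 T \<and> snd p \<in> dom0 T" if "p \<in> Q" for p
    using that T1 by (auto simp: dom0_def Q_def)
  \<comment> \<open>All admissible pairs of nonnegative value lie in Q, so a maximum over Q with
    positive value is global.\<close>
  have inQ: "((t, X), (s, Y)) \<in> Q"
    if d: "(t, X) \<in> dom0 T" "(s, Y) \<in> dom0 T" and n: "nrm X = nrm Y" and F0: "0 \<le> F ((t, X), (s, Y))" for t X s Y
  proof -
    have ts: "0 \<le> t" "t < T" "0 \<le> s" "s < T" using d by (auto simp: dom0_def)
    define D where "D = norm (tang X - tang Y)"
    have kt: "K * t \<le> K * T" "K * s \<le> K * T" using ts K by (auto intro: mult_left_mono)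
    have p: "0 \<le> a * (t - s)\<^sup>2" "0 < \<eta> / (T - t)" "0 < \<eta> / (T - s)" using ts ab \<eta> by auto
    have p2: "0 \<le> \<alpha> * ?N X" using \<alpha>(1) N[of X] by simp
    have sum: "\<eta> / (T - t) + \<eta> / (T - s) + \<alpha> * ?N X + (b * D\<^sup>2 - L * D) \<le> 3 * \<theta> + 2 * K * T"
      using UV[OF d n] F0 kt p unfolding F dbl_pen_eq D_def[symmetric] by linarith
    have bnd: "\<eta> / (T - t) \<le> B" "\<eta> / (T - s) \<le> B" "\<alpha> * ?N X \<le> B" "b * D\<^sup>2 - L * D \<le> B"
      using sum Lb[of D] p p2 \<mu> unfolding B_def by linarith+
    have tT: "t \<le> T1" "s \<le> T1" using bnd ts B by (auto simp: T1_def field_simps)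
    have NX: "?N X \<le> B / \<alpha>" using bnd(3) \<alpha>(1) by (simp add: field_simps)
    have nX: "norm (tang X) \<le> B / \<alpha>" using NX S0[of X] norm_le_smooth_norm[of 1 "tang X"] by simp
    have nX': "nrm X i \<le> B / \<alpha>" for i
    proof -
      have "smooth_norm 1 (nrm X i) \<le> (\<Sum>i\<in>UNIV. smooth_norm 1 (nrm X i))"
        by (rule member_le_sum) (simp_all add: less_imp_le smooth_norm_pos)
      moreover have "nrm X i \<le> smooth_norm 1 (nrm X i)"
        using norm_le_smooth_norm[of 1 "nrm X i"] by simp
      moreover have "0 < smooth_norm 1 (tang X)" by (simp add: smooth_norm_pos)
      ultimately show ?thesis using NX by linarith
    qed
    have "D \<le> 1 + B"
    proof (cases "D \<le> 1")
      case False
      then have "(L + 1) * D\<^sup>2 \<le> b * D\<^sup>2" "L * D \<le> L * D\<^sup>2" "D \<le> D\<^sup>2"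
        using ab(3) L(1) by (auto intro!: mult_right_mono mult_left_mono simp: power2_eq_square)
      then have "D \<le> b * D\<^sup>2 - L * D" unfolding distrib_right by linarith
      then show ?thesis using bnd(4) by linarith
    qed (use B in simp)
    moreover have "norm (tang Y) \<le> norm (tang X) + D"
      using norm_triangle_ineq2[of "tang Y" "tang X"] by (simp add: D_def norm_minus_commute)
    ultimately have "norm (tang Y) \<le> \<rho>" using nX by (simp add: \<rho>_def)
    moreover have "norm (tang X) \<le> \<rho>" "nrm X i \<le> \<rho>" for i using nX nX'[of i] B by (auto simp: \<rho>_def)
    ultimately show ?thesis using ts tT n by (simp add: Q_def)
  qed
  have "continuous_on Q R"
  proof -
    have "T - fst (fst p) \<noteq> 0" "T - fst (snd p) \<noteq> 0" if "p \<in> Q" for p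
      using Qdom[OF that] by (auto simp: dom0_def mem_Times_iff)
    then show ?thesis unfolding R_def by (intro continuous_intros) auto
  qed
  moreover have "usc_on Q (\<lambda>p. U (fst p))"
    by (rule usc_on_compose[OF U(1)]) (use Qdom in \<open>auto intro!: continuous_intros\<close>)
  moreover have "usc_on Q (\<lambda>p. - V (snd p))"
    by (rule usc_on_compose[OF V(1)]) (use Qdom in \<open>auto intro!: continuous_intros\<close>)
  ultimately have uF: "usc_on Q F" unfolding F_def by (intro usc_on_diff usc_on_add)
  have p1: "((t1, X1), (t1, X1)) \<in> Q" using F1 \<mu> by (intro inQ t1) auto
  then have "Q \<noteq> {}" by blast
  from usc_on_attains_max[OF cQ this uF] obtain p where p: "p \<in> Q" "\<forall>x\<in>Q. F x \<le> F p" ..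
  obtain t X s Y where pe: "p = ((t, X), (s, Y))" by (metis surj_pair)
  have Fp: "\<mu> / 2 \<le> dd.dbl_pen t X s Y" using p(2) p1 F1 pe F by (metis order_trans)
  have max: "dd.dbl_pen t' X' s' Y' \<le> dd.dbl_pen t X s Y"
    if "(t', X') \<in> dom0 T" "(s', Y') \<in> dom0 T" "nrm X' = nrm Y'" for t' X' s' Y'
  proof (cases "0 \<le> F ((t', X'), (s', Y'))")
    case True
    then show ?thesis using p(2) inQ[OF that True] pe F by metis
  next
    case False
    then show ?thesis using Fp \<mu> F[of t' X' s' Y'] by linarith
  qed
  have d: "(t, X) \<in> dom0 T" "(s, Y) \<in> dom0 T" using Qdom[OF p(1)] pe by auto
  have n: "nrm X = nrm Y" using p(1) pe by (auto simp: fun_eq_iff Q_def)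
  have ts: "0 \<le> t" "t < T" "0 \<le> s" "s < T" using d by (auto simp: dom0_def)
  have "t \<noteq> 0 \<and> s \<noteq> 0"
  proof (rule ccontr)
    assume "\<not> ?thesis"
    then have "K * t + K * s - a * (t - s)\<^sup>2 = K * (t + s) - a * (t + s)\<^sup>2"
      by (auto simp: distrib_left)
    then have "K * t + K * s - a * (t - s)\<^sup>2 \<le> \<mu> / 16" using Ka[of "t + s"] by simp
    moreover have "0 < \<eta> / (T - t)" "0 < \<eta> / (T - s)" using ts \<eta> by auto
    moreover have "0 \<le> \<alpha> * ?N X" using \<alpha>(1) N[of X] by simp
    ultimately have "dd.dbl_pen t X s Y \<le> 3 * \<theta> + \<mu> / 8"
      using UV[OF d n] Lb[of "norm (tang X - tang Y)"] unfolding dbl_pen_eq by linarith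
    then show False using Fp \<mu> by (simp add: \<theta>_def)
  qed
  then have ts': "0 < t" "0 < s" using ts by auto
  show False
  proof (cases rule: branch_cases[of X])
    case 1
    moreover have "Y \<in> interface" using 1 n by (simp add: interface_nrm)
    ultimately show False by (rule dd.no_interface_max[OF ts'(1) ts(2) ts'(2) ts(4) _ _ max])
  next
    case (2 i)
    then have "nrm X i \<noteq> 0" using height_branch[of X i] height_eq_0_iff[of X] by auto
    then have "0 < nrm X i" using nrm_nonneg[of X i] by simp
    then show False using 2 by (intro dd.no_interior_max[OF ts'(1) ts(2) ts'(2) ts(4) _ _ n max]) auto
  qed
qed

lemma A_min_le_A0: "A_min (H i) p \<le> A0 H p"
  unfolding A0_def by (rule Max_ge) auto

theorem theorem1p3:
  fixes H :: "'n::finite \<Rightarrow> 'a::finite_dim_inner \<times> real \<Rightarrow> real"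
    and A :: "'a \<Rightarrow> real"
    and u0 :: "('a, 'n) junction \<Rightarrow> real"
    and u v :: "real \<times> ('a, 'n) junction \<Rightarrow> real"
    and T C :: real
    and X0 :: "('a, 'n) junction"
  assumes "\<And>i. continuous_on UNIV (H i)"
    and "\<And>i. quasiconvex (H i)"
    and "\<And>i. coercive (H i)"
    and "continuous_on UNIV A"
    and "quasiconvex A"
    and "\<And>p'. A0 H p' \<le> A p'"
    and "uniformly_continuous_on UNIV u0"
    and "0 < T"
    and "flux_limited_subsolution H A T u"
    and "flux_limited_supersolution H A T v"
    and "0 < C"
    and "\<And>t X. t \<in> {0..<T} \<Longrightarrow> u (t, X) \<le> C * (1 + dist X0 X)"
    and "\<And>t X. t \<in> {0..<T} \<Longrightarrow> - C * (1 + dist X0 X) \<le> v (t, X)"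
    and "\<And>X. usc_env (dom0 T) u (0, X) \<le> ereal (u0 X)"
    and "\<And>X. ereal (u0 X) \<le> lsc_env (dom0 T) v (0, X)"
  shows "\<forall>t\<in>{0..<T}. \<forall>X. u (t, X) \<le> v (t, X)"
proof (intro ballI allI)
  fix t and X :: "('a, 'n) junction" assume t: "t \<in> {0..<T}"
  let ?u = "usc_real (dom0 T) u" and ?v = "usc_real (dom0 T) (\<lambda>z. - v z)"
  have u: "locally_bounded_on (dom0 T) u"
    using assms(9) unfolding flux_limited_subsolution_def by (rule conjunct1)
  have "locally_bounded_on (dom0 T) v"
    using assms(10) unfolding flux_limited_supersolution_def by (rule conjunct1)
  then have v: "locally_bounded_on (dom0 T) (\<lambda>z. - v z)" by (rule locally_bounded_on_uminus)
  have cont: "continuous_on S (\<lambda>z. C * (1 + dist X0 (snd z)))" for S :: "(real \<times> ('a, 'n) junction) set"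
    by (intro continuous_intros)
  have gu: "?u (t, X) \<le> C * (1 + dist X0 X)" if "(t, X) \<in> dom0 T" for t X
  proof -
    have "u w \<le> C * (1 + dist X0 (snd w))" if "w \<in> dom0 T" for w
      using assms(12)[of "fst w" "snd w"] that by (auto simp: dom0_def)
    from usc_real_le[OF u that cont this] show ?thesis by simp
  qed
  have gv: "?v (t, X) \<le> C * (1 + dist X0 X)" if "(t, X) \<in> dom0 T" for t X
  proof -
    have "- v w \<le> C * (1 + dist X0 (snd w))" if "w \<in> dom0 T" for w
      using assms(13)[of "fst w" "snd w"] that by (auto simp: dom0_def)
    from usc_real_le[OF v that cont this] show ?thesis by simp
  qed
  have z0: "(0, Y) \<in> dom0 T" for Y :: "('a, 'n) junction" using assms(8) by (simp add: dom0_def)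
  have iu: "?u (0, Y) \<le> u0 Y" for Y
    using assms(14)[of Y] unfolding usc_env_real[OF u z0] by simp
  have iv: "?v (0, Y) \<le> - u0 Y" for Y
    using assms(15)[of Y] unfolding lsc_env_eq usc_env_real[OF v z0] by simp
  have Am: "A_min (H i) p \<le> A p" for i p
    using A_min_le_A0[of H i p] assms(6)[of p] by linarith
  have tX: "(t, X) \<in> dom0 T" using t by (simp add: dom0_def)
  have "?u (t, X) \<le> - ?v (t, X)"
    by (rule envelope_comparison[OF assms(1,3,4) Am assms(7,8) usc_on_usc_real[OF u] sub_sep_usc_real[OF assms(9)]
          _ super_sep_usc_real[OF assms(10)] assms(11) gu _ iu _ tX])
       (use usc_on_usc_real[OF v] gv iv in simp_all)
  moreover have "u (t, X) \<le> ?u (t, X)" by (rule le_usc_real[OF u tX])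
  moreover have "- v (t, X) \<le> ?v (t, X)" by (rule le_usc_real[OF v tX])
  ultimately show "u (t, X) \<le> v (t, X)" by linarith
qed

end
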